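(* For every $n\geq 0$, every $\Pi_{n+1}$ sentence provable in $I\Sigma_{n+1}$ is provable in $C\Sigma_n$. (That is, $I\Sigma_{n+1}\subseteq C\Sigma_n$ over $\Pi_{n+1}$ theorems.)
   Context: Language of arithmetic: $\{0,\mathsf{s},+,\times,<\}$. Formulae are in De Morgan normal form (negation only on atoms). $\Delta_0=\Sigma_0=\Pi_0$ is the class of bounded formulae (all quantifiers of the form $\forall x<t$, $\exists x<t$); $\Sigma_{n+1}$ consists of formulae $\exists\vec x.\phi$ with $\phi\in\Pi_n$, and $\Pi_{n+1}$ of formulae $\forall\vec x.\phi$ with $\phi\in\Sigma_n$. $\mathsf{Q}$ is Robinson arithmetic with inequality: $\mathsf{s}x\neq 0$; $\mathsf{s}x=\mathsf{s}y\supset x=y$; $x\neq0\supset\exists y.x=\mathsf{s}y$; $x+0=x$; $x+\mathsf{s}y=\mathsf{s}(x+y)$; $x\cdot0=0$; $x\cdot\mathsf{s}y=x\cdot y+x$; $x<y\equiv\exists z.(x+\mathsf{s}z=y)$. $I\Sigma_n$ is $\mathsf{Q}$ plus the induction schema $(\phi(0)\wedge\forall x.(\phi(x)\supset\phi(\mathsf{s}x)))\supset\forall x.\phi(x)$ for $\phi\in\Sigma_n$ (parameters allowed). Cyclic arithmetic: work in a sequent calculus for first-order logic with equality, where sequents $\Gamma\Rightarrow\Delta$ have finite sets of formulae as cedents, with rules: identity, equality axioms, negation axioms, weakening, cut, the usual left/right rules for $\wedge,\vee,\forall,\exists$ (eigenvariables fresh), a substitution rule $\theta$-$\mathit{sub}$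 (from $\Gamma\Rightarrow\Delta$ infer $\theta(\Gamma)\Rightarrow\theta(\Delta)$ for a substitution $\theta$ of terms for variables), and initial sequents for instances of the axioms of $\mathsf{Q}$. A preproof is a possibly infinite binary tree labelled by sequents and rule instances in a locally correct way; it is regular if it has only finitely many distinct labelled subtrees. Along an infinite branch $(\Gamma_i\Rightarrow\Delta_i)_{i\ge0}$, a term $t'$ is a precursor of $t$ at $i$ if either $\Gamma_i\Rightarrow\Delta_i$ concludes a $\theta$-$\mathit{sub}$ step and $t=\theta(t')$, or it concludes another step and either $t'=t$ occurs in $\Gamma_i$ or $t'$ is $t$. A trace is a sequence $(t_i)_{i\ge m}$ with $t_i$ occurring in $\Gamma_i\Rightarrow\Delta_i$ such that for each $i\geq m$ either $t_{i+1}$ is a precursor of $t_i$ at $i$, or the atom $t_{i+1}<t$ occurs in $\Gamma_{i+1}$ for some precursor $t$ of $t_i$ at $i$ (in which case the trace progresses at $i+1$). An $\infty$-proof is a preproof in which every infinite branch has a trace progressing infinitely often; a cyclic proof is a regular $\infty$-proof. For a class $\Phi$ of formulae closed under subformulae and substitution, $C\Phi$ is the first-order theory axiomatised by the universal closures of conclusions of cyclic proofs containing only $\Phi$-formulae; $C\Sigma_n$ is this for $\Phi=\Sigma_n$.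
   Formalization: Axioms of Q enter cyclic proofs as sequents (implication as arrow), and formulas ∃y.t=sy and ∃z.t+sz=u are always allowed there; this matters only for n=0, where otherwise < is unconstrained and 0<s0 would be unprovable in CΣ_0. *)

theory Defs
  imports Main
begin

section \<open>Syntax\<close>

text \<open>Locally nameless representation: free variables are named (\<open>FVar\<close>), bound variables are
  de Bruijn indices (\<open>BVar\<close>). Formulae are thereby identified up to renaming of bound variables,
  while a free variable keeps its name from one sequent of a proof to the next, as the definition
  of traces requires. The terms and formulae of the logic are those without dangling indices,
  i.e. those satisfying \<open>lc_tm 0\<close> and \<open>lc_fm 0\<close>.\<close>

datatype tm = FVar nat | BVar nat | Zero | Succ tm | Plus tm tm | Times tm tm

datatype atom = Eq tm tm | Lt tm tm

datatype fm = Pos atom | Neg atom | Conj fm fm | Disj fm fm | Forall fm | Exists fm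

primrec lc_tm :: "nat \<Rightarrow> tm \<Rightarrow> bool" where
  "lc_tm k (FVar x) = True"
| "lc_tm k (BVar i) = (i < k)"
| "lc_tm k Zero = True"
| "lc_tm k (Succ t) = lc_tm k t"
| "lc_tm k (Plus t u) = (lc_tm k t \<and> lc_tm k u)"
| "lc_tm k (Times t u) = (lc_tm k t \<and> lc_tm k u)"

primrec lc_atom :: "nat \<Rightarrow> atom \<Rightarrow> bool" where
  "lc_atom k (Eq t u) = (lc_tm k t \<and> lc_tm k u)"
| "lc_atom k (Lt t u) = (lc_tm k t \<and> lc_tm k u)"

primrec lc_fm :: "nat \<Rightarrow> fm \<Rightarrow> bool" where
  "lc_fm k (Pos a) = lc_atom k a"
| "lc_fm k (Neg a) = lc_atom k a"
| "lc_fm k (Conj \<phi> \<psi>) = (lc_fm k \<phi> \<and> lc_fm k \<psi>)"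
| "lc_fm k (Disj \<phi> \<psi>) = (lc_fm k \<phi> \<and> lc_fm k \<psi>)"
| "lc_fm k (Forall \<phi>) = lc_fm (Suc k) \<phi>"
| "lc_fm k (Exists \<phi>) = lc_fm (Suc k) \<phi>"

primrec fv_tm :: "tm \<Rightarrow> nat set" where
  "fv_tm (FVar x) = {x}"
| "fv_tm (BVar i) = {}"
| "fv_tm Zero = {}"
| "fv_tm (Succ t) = fv_tm t"
| "fv_tm (Plus t u) = fv_tm t \<union> fv_tm u"
| "fv_tm (Times t u) = fv_tm t \<union> fv_tm u"

primrec fv_atom :: "atom \<Rightarrow> nat set" where
  "fv_atom (Eq t u) = fv_tm t \<union> fv_tm u"
| "fv_atom (Lt t u) = fv_tm t \<union> fv_tm u"

primrec fv_fm :: "fm \<Rightarrow> nat set" where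
  "fv_fm (Pos a) = fv_atom a"
| "fv_fm (Neg a) = fv_atom a"
| "fv_fm (Conj \<phi> \<psi>) = fv_fm \<phi> \<union> fv_fm \<psi>"
| "fv_fm (Disj \<phi> \<psi>) = fv_fm \<phi> \<union> fv_fm \<psi>"
| "fv_fm (Forall \<phi>) = fv_fm \<phi>"
| "fv_fm (Exists \<phi>) = fv_fm \<phi>"

definition sentence :: "fm \<Rightarrow> bool" where
  "sentence \<phi> \<longleftrightarrow> lc_fm 0 \<phi> \<and> fv_fm \<phi> = {}"

text \<open>Simultaneous substitution for free variables. It is capture-avoiding for substitutions
  into \<open>lc_tm 0\<close> terms, which are the only ones used below.\<close>

primrec sub_tm :: "(nat \<Rightarrow> tm) \<Rightarrow> tm \<Rightarrow> tm" where
  "sub_tm \<theta> (FVar x) = \<theta> x"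
| "sub_tm \<theta> (BVar i) = BVar i"
| "sub_tm \<theta> Zero = Zero"
| "sub_tm \<theta> (Succ t) = Succ (sub_tm \<theta> t)"
| "sub_tm \<theta> (Plus t u) = Plus (sub_tm \<theta> t) (sub_tm \<theta> u)"
| "sub_tm \<theta> (Times t u) = Times (sub_tm \<theta> t) (sub_tm \<theta> u)"

primrec sub_atom :: "(nat \<Rightarrow> tm) \<Rightarrow> atom \<Rightarrow> atom" where
  "sub_atom \<theta> (Eq t u) = Eq (sub_tm \<theta> t) (sub_tm \<theta> u)"
| "sub_atom \<theta> (Lt t u) = Lt (sub_tm \<theta> t) (sub_tm \<theta> u)"

primrec sub_fm :: "(nat \<Rightarrow> tm) \<Rightarrow> fm \<Rightarrow> fm" where
  "sub_fm \<theta> (Pos a) = Pos (sub_atom \<theta> a)"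
| "sub_fm \<theta> (Neg a) = Neg (sub_atom \<theta> a)"
| "sub_fm \<theta> (Conj \<phi> \<psi>) = Conj (sub_fm \<theta> \<phi>) (sub_fm \<theta> \<psi>)"
| "sub_fm \<theta> (Disj \<phi> \<psi>) = Disj (sub_fm \<theta> \<phi>) (sub_fm \<theta> \<psi>)"
| "sub_fm \<theta> (Forall \<phi>) = Forall (sub_fm \<theta> \<phi>)"
| "sub_fm \<theta> (Exists \<phi>) = Exists (sub_fm \<theta> \<phi>)"

definition subst1 :: "nat \<Rightarrow> tm \<Rightarrow> fm \<Rightarrow> fm" where
  "subst1 x t = sub_fm (FVar(x := t))"

text \<open>\<open>open_fm k u \<phi>\<close> replaces the index dangling at depth \<open>k\<close> by \<open>u\<close> (again for \<open>lc_tm 0 u\<close>);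
  in particular \<open>inst \<phi> u\<close> is the instance at \<open>u\<close> of \<open>Forall \<phi>\<close> or \<open>Exists \<phi>\<close>.
  Conversely, \<open>close_fm 0 x \<phi>\<close> is the body obtained by binding the free variable \<open>x\<close>.\<close>

primrec open_tm :: "nat \<Rightarrow> tm \<Rightarrow> tm \<Rightarrow> tm" where
  "open_tm k u (FVar x) = FVar x"
| "open_tm k u (BVar i) = (if i = k then u else BVar i)"
| "open_tm k u Zero = Zero"
| "open_tm k u (Succ t) = Succ (open_tm k u t)"
| "open_tm k u (Plus t t') = Plus (open_tm k u t) (open_tm k u t')"
| "open_tm k u (Times t t') = Times (open_tm k u t) (open_tm k u t')"

primrec open_atom :: "nat \<Rightarrow> tm \<Rightarrow> atom \<Rightarrow> atom" where
  "open_atom k u (Eq t t') = Eq (open_tm k u t) (open_tm k u t')"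
| "open_atom k u (Lt t t') = Lt (open_tm k u t) (open_tm k u t')"

primrec open_fm :: "nat \<Rightarrow> tm \<Rightarrow> fm \<Rightarrow> fm" where
  "open_fm k u (Pos a) = Pos (open_atom k u a)"
| "open_fm k u (Neg a) = Neg (open_atom k u a)"
| "open_fm k u (Conj \<phi> \<psi>) = Conj (open_fm k u \<phi>) (open_fm k u \<psi>)"
| "open_fm k u (Disj \<phi> \<psi>) = Disj (open_fm k u \<phi>) (open_fm k u \<psi>)"
| "open_fm k u (Forall \<phi>) = Forall (open_fm (Suc k) u \<phi>)"
| "open_fm k u (Exists \<phi>) = Exists (open_fm (Suc k) u \<phi>)"

definition inst :: "fm \<Rightarrow> tm \<Rightarrow> fm" where
  "inst \<phi> u = open_fm 0 u \<phi>"

primrec close_tm :: "nat \<Rightarrow> nat \<Rightarrow> tm \<Rightarrow> tm" where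
  "close_tm k x (FVar y) = (if y = x then BVar k else FVar y)"
| "close_tm k x (BVar i) = BVar i"
| "close_tm k x Zero = Zero"
| "close_tm k x (Succ t) = Succ (close_tm k x t)"
| "close_tm k x (Plus t u) = Plus (close_tm k x t) (close_tm k x u)"
| "close_tm k x (Times t u) = Times (close_tm k x t) (close_tm k x u)"

primrec close_atom :: "nat \<Rightarrow> nat \<Rightarrow> atom \<Rightarrow> atom" where
  "close_atom k x (Eq t u) = Eq (close_tm k x t) (close_tm k x u)"
| "close_atom k x (Lt t u) = Lt (close_tm k x t) (close_tm k x u)"

primrec close_fm :: "nat \<Rightarrow> nat \<Rightarrow> fm \<Rightarrow> fm" where
  "close_fm k x (Pos a) = Pos (close_atom k x a)"
| "close_fm k x (Neg a) = Neg (close_atom k x a)"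
| "close_fm k x (Conj \<phi> \<psi>) = Conj (close_fm k x \<phi>) (close_fm k x \<psi>)"
| "close_fm k x (Disj \<phi> \<psi>) = Disj (close_fm k x \<phi>) (close_fm k x \<psi>)"
| "close_fm k x (Forall \<phi>) = Forall (close_fm (Suc k) x \<phi>)"
| "close_fm k x (Exists \<phi>) = Exists (close_fm (Suc k) x \<phi>)"

definition allv :: "nat \<Rightarrow> fm \<Rightarrow> fm" where
  "allv x \<phi> = Forall (close_fm 0 x \<phi>)"

definition exv :: "nat \<Rightarrow> fm \<Rightarrow> fm" where
  "exv x \<phi> = Exists (close_fm 0 x \<phi>)"

definition univ_closure :: "fm \<Rightarrow> fm" where
  "univ_closure \<phi> = foldr allv (sorted_list_of_set (fv_fm \<phi>)) \<phi>"

primrec neg :: "fm \<Rightarrow> fm" where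
  "neg (Pos a) = Neg a"
| "neg (Neg a) = Pos a"
| "neg (Conj \<phi> \<psi>) = Disj (neg \<phi>) (neg \<psi>)"
| "neg (Disj \<phi> \<psi>) = Conj (neg \<phi>) (neg \<psi>)"
| "neg (Forall \<phi>) = Exists (neg \<phi>)"
| "neg (Exists \<phi>) = Forall (neg \<phi>)"

definition imp :: "fm \<Rightarrow> fm \<Rightarrow> fm" where
  "imp \<phi> \<psi> = Disj (neg \<phi>) \<psi>"

definition iff :: "fm \<Rightarrow> fm \<Rightarrow> fm" where
  "iff \<phi> \<psi> = Conj (imp \<phi> \<psi>) (imp \<psi> \<phi>)"

definition Tru :: fm where "Tru = Pos (Eq Zero Zero)"
definition Fls :: fm where "Fls = Neg (Eq Zero Zero)"

section \<open>The arithmetical hierarchy\<close>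

text \<open>\<open>\<forall>x<t. \<phi>\<close> is \<open>\<forall>x. (\<not> x < t \<or> \<phi>)\<close> and \<open>\<exists>x<t. \<phi>\<close> is \<open>\<exists>x. (x < t \<and> \<phi>)\<close>. The quantified
  variable must not occur in \<open>t\<close>.\<close>

primrec bv_tm :: "tm \<Rightarrow> nat set" where
  "bv_tm (FVar x) = {}"
| "bv_tm (BVar i) = {i}"
| "bv_tm Zero = {}"
| "bv_tm (Succ t) = bv_tm t"
| "bv_tm (Plus t u) = bv_tm t \<union> bv_tm u"
| "bv_tm (Times t u) = bv_tm t \<union> bv_tm u"

inductive_set Delta0 :: "fm set" where
  "Pos a \<in> Delta0"
| "Neg a \<in> Delta0"
| "\<phi> \<in> Delta0 \<Longrightarrow> \<psi> \<in> Delta0 \<Longrightarrow> Conj \<phi> \<psi> \<in> Delta0"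
| "\<phi> \<in> Delta0 \<Longrightarrow> \<psi> \<in> Delta0 \<Longrightarrow> Disj \<phi> \<psi> \<in> Delta0"
| "\<phi> \<in> Delta0 \<Longrightarrow> 0 \<notin> bv_tm t \<Longrightarrow> Forall (Disj (Neg (Lt (BVar 0) t)) \<phi>) \<in> Delta0"
| "\<phi> \<in> Delta0 \<Longrightarrow> 0 \<notin> bv_tm t \<Longrightarrow> Exists (Conj (Pos (Lt (BVar 0) t)) \<phi>) \<in> Delta0"

text \<open>Quantifier blocks may be empty; this makes the classes cumulative and closed under
  subformulae.\<close>

fun Sigma_fm :: "nat \<Rightarrow> fm set" and Pi_fm :: "nat \<Rightarrow> fm set" where
  "Sigma_fm 0 = Delta0"
| "Sigma_fm (Suc n) = {(Exists ^^ k) \<phi> | k \<phi>. \<phi> \<in> Pi_fm n}"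
| "Pi_fm 0 = Delta0"
| "Pi_fm (Suc n) = {(Forall ^^ k) \<phi> | k \<phi>. \<phi> \<in> Sigma_fm n}"

section \<open>Sequent calculus for first-order logic with equality\<close>

type_synonym sequent = "fm set \<times> fm set"

definition fv_sequent :: "sequent \<Rightarrow> nat set" where
  "fv_sequent s = (\<Union>\<phi> \<in> fst s \<union> snd s. fv_fm \<phi>)"

definition wf_sequent :: "sequent \<Rightarrow> bool" where
  "wf_sequent s \<longleftrightarrow> finite (fst s) \<and> finite (snd s) \<and> (\<forall>\<phi> \<in> fst s \<union> snd s. lc_fm 0 \<phi>)"

datatype rule_name =
    Ident | EqRefl | EqSubst | NegL | NegR | Weak | Cut
  | ConjL | ConjR | DisjL | DisjR | ForallL | ForallR | ExistsL | ExistsR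
  | Sub "nat \<Rightarrow> tm" | QInit

text \<open>\<open>step r ps s\<close>: the sequent \<open>s\<close> follows from the list of premises \<open>ps\<close> by \<open>r\<close>. Since cedents
  are sets, contraction and exchange are implicit.\<close>

inductive step :: "rule_name \<Rightarrow> sequent list \<Rightarrow> sequent \<Rightarrow> bool" where
  "step Ident [] ({\<phi>}, {\<phi>})"
| "step EqRefl [] ({}, {Pos (Eq t t)})"
| "step EqSubst [] ({Pos (Eq t u), subst1 x t \<phi>}, {subst1 x u \<phi>})"
| "step NegL [] ({Pos a, Neg a}, {})"
| "step NegR [] ({}, {Pos a, Neg a})"
| "\<Gamma> \<subseteq> \<Gamma>' \<Longrightarrow> \<Delta> \<subseteq> \<Delta>' \<Longrightarrow> step Weak [(\<Gamma>, \<Delta>)] (\<Gamma>', \<Delta>')"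
| "step Cut [(\<Gamma>, insert \<phi> \<Delta>), (insert \<phi> \<Gamma>, \<Delta>)] (\<Gamma>, \<Delta>)"
| "step ConjL [(insert \<phi> (insert \<psi> \<Gamma>), \<Delta>)] (insert (Conj \<phi> \<psi>) \<Gamma>, \<Delta>)"
| "step ConjR [(\<Gamma>, insert \<phi> \<Delta>), (\<Gamma>, insert \<psi> \<Delta>)] (\<Gamma>, insert (Conj \<phi> \<psi>) \<Delta>)"
| "step DisjL [(insert \<phi> \<Gamma>, \<Delta>), (insert \<psi> \<Gamma>, \<Delta>)] (insert (Disj \<phi> \<psi>) \<Gamma>, \<Delta>)"
| "step DisjR [(\<Gamma>, insert \<phi> (insert \<psi> \<Delta>))] (\<Gamma>, insert (Disj \<phi> \<psi>) \<Delta>)"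
| "lc_tm 0 t \<Longrightarrow> step ForallL [(insert (inst \<phi> t) \<Gamma>, \<Delta>)] (insert (Forall \<phi>) \<Gamma>, \<Delta>)"
| "a \<notin> fv_sequent (\<Gamma>, insert (Forall \<phi>) \<Delta>) \<Longrightarrow>
     step ForallR [(\<Gamma>, insert (inst \<phi> (FVar a)) \<Delta>)] (\<Gamma>, insert (Forall \<phi>) \<Delta>)"
| "a \<notin> fv_sequent (insert (Exists \<phi>) \<Gamma>, \<Delta>) \<Longrightarrow>
     step ExistsL [(insert (inst \<phi> (FVar a)) \<Gamma>, \<Delta>)] (insert (Exists \<phi>) \<Gamma>, \<Delta>)"
| "lc_tm 0 t \<Longrightarrow> step ExistsR [(\<Gamma>, insert (inst \<phi> t) \<Delta>)] (\<Gamma>, insert (Exists \<phi>) \<Delta>)"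
| "(\<forall>x. lc_tm 0 (\<theta> x)) \<Longrightarrow> step (Sub \<theta>) [(\<Gamma>, \<Delta>)] (sub_fm \<theta> ` \<Gamma>, sub_fm \<theta> ` \<Delta>)"

text \<open>A theory is a set of sentences; \<open>derivable T\<close> is derivability by finite proofs with the
  axioms \<open>T\<close> as additional initial sequents. No \<open>QInit\<close> steps are available here.\<close>

inductive derivable :: "fm set \<Rightarrow> sequent \<Rightarrow> bool" for T where
  "\<phi> \<in> T \<Longrightarrow> sentence \<phi> \<Longrightarrow> derivable T ({}, {\<phi>})"
| "step r ps s \<Longrightarrow> (\<forall>p \<in> set ps. derivable T p) \<Longrightarrow> wf_sequent s \<Longrightarrow> derivable T s"

definition provable :: "fm set \<Rightarrow> fm \<Rightarrow> bool" where
  "provable T \<phi> \<longleftrightarrow> derivable T ({}, {\<phi>})"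

section \<open>Robinson arithmetic and induction\<close>

definition Q_axioms :: "fm set" where
  "Q_axioms = (let x = FVar 0; y = FVar 1; z = FVar 2 in
    {Neg (Eq (Succ x) Zero),
     imp (Pos (Eq (Succ x) (Succ y))) (Pos (Eq x y)),
     imp (Neg (Eq x Zero)) (exv 1 (Pos (Eq x (Succ y)))),
     Pos (Eq (Plus x Zero) x),
     Pos (Eq (Plus x (Succ y)) (Succ (Plus x y))),
     Pos (Eq (Times x Zero) Zero),
     Pos (Eq (Times x (Succ y)) (Plus (Times x y) x)),
     iff (Pos (Lt x y)) (exv 2 (Pos (Eq (Plus x (Succ z)) y)))})"

definition induction_fm :: "nat \<Rightarrow> fm \<Rightarrow> fm" where
  "induction_fm x \<phi> =
     imp (Conj (subst1 x Zero \<phi>) (allv x (imp \<phi> (subst1 x (Succ (FVar x)) \<phi>)))) (allv x \<phi>)"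

definition ISigma :: "nat \<Rightarrow> fm set" where
  "ISigma n = univ_closure ` Q_axioms
     \<union> {univ_closure (induction_fm x \<phi>) | x \<phi>. \<phi> \<in> Sigma_fm n \<and> lc_fm 0 \<phi>}"

section \<open>Cyclic proofs\<close>

text \<open>The initial sequents for instances of the axioms of \<open>Q\<close>, with outermost implications
  rendered by the sequent arrow and the equivalence by two sequents. (As single formulae, the
  implications lie in no class of the prenex hierarchy.)\<close>

inductive Q_initial :: "sequent \<Rightarrow> bool" where
  "Q_initial ({}, {Neg (Eq (Succ t) Zero)})"
| "Q_initial ({Pos (Eq (Succ t) (Succ u))}, {Pos (Eq t u)})"
| "lc_tm 0 t \<Longrightarrow> Q_initial ({Neg (Eq t Zero)}, {Exists (Pos (Eq t (Succ (BVar 0))))})"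
| "Q_initial ({}, {Pos (Eq (Plus t Zero) t)})"
| "Q_initial ({}, {Pos (Eq (Plus t (Succ u)) (Succ (Plus t u)))})"
| "Q_initial ({}, {Pos (Eq (Times t Zero) Zero)})"
| "Q_initial ({}, {Pos (Eq (Times t (Succ u)) (Plus (Times t u) t))})"
| "lc_tm 0 t \<Longrightarrow> lc_tm 0 u \<Longrightarrow>
     Q_initial ({Pos (Lt t u)}, {Exists (Pos (Eq (Plus t (Succ (BVar 0))) u))})"
| "lc_tm 0 t \<Longrightarrow> lc_tm 0 u \<Longrightarrow>
     Q_initial ({Exists (Pos (Eq (Plus t (Succ (BVar 0))) u))}, {Pos (Lt t u)})"

codatatype tree = Node (concl: sequent) (rname: rule_name) (children: "tree list")

inductive subtree :: "tree \<Rightarrow> tree \<Rightarrow> bool" where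
  "subtree \<pi> \<pi>"
| "subtree \<pi>' \<pi> \<Longrightarrow> \<pi>'' \<in> set (children \<pi>') \<Longrightarrow> subtree \<pi>'' \<pi>"

definition preproof :: "tree \<Rightarrow> bool" where
  "preproof \<pi> \<longleftrightarrow> (\<forall>\<pi>'. subtree \<pi>' \<pi> \<longrightarrow>
     wf_sequent (concl \<pi>') \<and>
     (step (rname \<pi>') (map concl (children \<pi>')) (concl \<pi>') \<or>
      rname \<pi>' = QInit \<and> children \<pi>' = [] \<and> Q_initial (concl \<pi>')))"

definition regular :: "tree \<Rightarrow> bool" where
  "regular \<pi> \<longleftrightarrow> finite {\<pi>'. subtree \<pi>' \<pi>}"

definition infinite_branch :: "tree \<Rightarrow> (nat \<Rightarrow> tree) \<Rightarrow> bool" where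
  "infinite_branch \<pi> b \<longleftrightarrow> b 0 = \<pi> \<and> (\<forall>i. b (Suc i) \<in> set (children (b i)))"

text \<open>An occurrence involving a bound variable of the
  surrounding formula is a subexpression with a dangling index, hence not a term.\<close>

primrec subterms :: "tm \<Rightarrow> tm set" where
  "subterms (FVar x) = {FVar x}"
| "subterms (BVar i) = {BVar i}"
| "subterms Zero = {Zero}"
| "subterms (Succ t) = insert (Succ t) (subterms t)"
| "subterms (Plus t u) = insert (Plus t u) (subterms t \<union> subterms u)"
| "subterms (Times t u) = insert (Times t u) (subterms t \<union> subterms u)"

primrec terms_atom :: "atom \<Rightarrow> tm set" where
  "terms_atom (Eq t u) = subterms t \<union> subterms u"
| "terms_atom (Lt t u) = subterms t \<union> subterms u"

primrec terms_fm :: "fm \<Rightarrow> tm set" where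
  "terms_fm (Pos a) = terms_atom a"
| "terms_fm (Neg a) = terms_atom a"
| "terms_fm (Conj \<phi> \<psi>) = terms_fm \<phi> \<union> terms_fm \<psi>"
| "terms_fm (Disj \<phi> \<psi>) = terms_fm \<phi> \<union> terms_fm \<psi>"
| "terms_fm (Forall \<phi>) = terms_fm \<phi>"
| "terms_fm (Exists \<phi>) = terms_fm \<phi>"

definition terms_sequent :: "sequent \<Rightarrow> tm set" where
  "terms_sequent s = {t. lc_tm 0 t \<and> (\<exists>\<phi> \<in> fst s \<union> snd s. t \<in> terms_fm \<phi>)}"

text \<open>\<open>precursor \<pi> t' t\<close>: the term \<open>t'\<close> is a precursor of \<open>t\<close> at the root of \<open>\<pi>\<close>.\<close>

definition precursor :: "tree \<Rightarrow> tm \<Rightarrow> tm \<Rightarrow> bool" where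
  "precursor \<pi> t' t \<longleftrightarrow>
     (case rname \<pi> of
        Sub \<theta> \<Rightarrow> t = sub_tm \<theta> t'
      | _ \<Rightarrow> Pos (Eq t' t) \<in> fst (concl \<pi>) \<or> t' = t)"

definition progresses :: "(nat \<Rightarrow> tree) \<Rightarrow> (nat \<Rightarrow> tm) \<Rightarrow> nat \<Rightarrow> bool" where
  "progresses b \<tau> i \<longleftrightarrow>
     (\<exists>t. precursor (b i) t (\<tau> i) \<and> Pos (Lt (\<tau> (Suc i)) t) \<in> fst (concl (b (Suc i))))"

text \<open>A trace \<open>(t\<^sub>i)\<^sub>i\<^sub>\<ge>\<^sub>m\<close> is a function of which only the values from \<open>m\<close> on matter.\<close>

definition trace :: "(nat \<Rightarrow> tree) \<Rightarrow> nat \<Rightarrow> (nat \<Rightarrow> tm) \<Rightarrow> bool" where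
  "trace b m \<tau> \<longleftrightarrow> (\<forall>i\<ge>m. \<tau> i \<in> terms_sequent (concl (b i)) \<and>
     (precursor (b i) (\<tau> (Suc i)) (\<tau> i) \<or> progresses b \<tau> i))"

definition infinity_proof :: "tree \<Rightarrow> bool" where
  "infinity_proof \<pi> \<longleftrightarrow> preproof \<pi> \<and>
     (\<forall>b. infinite_branch \<pi> b \<longrightarrow>
        (\<exists>m \<tau>. trace b m \<tau> \<and> (\<forall>k\<ge>m. \<exists>i\<ge>k. progresses b \<tau> i)))"

definition cyclic_proof :: "tree \<Rightarrow> bool" where
  "cyclic_proof \<pi> \<longleftrightarrow> infinity_proof \<pi> \<and> regular \<pi>"

text \<open>A cyclic proof over \<open>\<Phi>\<close> contains only \<open>\<Phi>\<close>-formulae, except that the formulae of the initial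
  sequents of \<open>Q\<close> are always admitted. For \<open>\<Phi> = Sigma_fm n\<close> this exception is void if \<open>n \<ge> 1\<close>
  (see \<open>Q_formulas_Sigma\<close>). For \<open>n = 0\<close> it admits exactly the formulae \<open>\<exists>y. t = s y\<close> and
  \<open>\<exists>z. t + s z = u\<close>, without which two of the axioms of \<open>Q\<close>, among them the only one about \<open><\<close>, could
  not be used at all.\<close>

definition Q_formulas :: "fm set" where
  "Q_formulas = {\<phi>. \<exists>s. Q_initial s \<and> \<phi> \<in> fst s \<union> snd s}"

definition contains_only :: "fm set \<Rightarrow> tree \<Rightarrow> bool" where
  "contains_only \<Phi> \<pi> \<longleftrightarrow> (\<forall>\<pi>'. subtree \<pi>' \<pi> \<longrightarrow> fst (concl \<pi>') \<union> snd (concl \<pi>') \<subseteq> \<Phi>)"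

text \<open>As cedents are unordered, every listing of the two cedents of a conclusion contributes an
  axiom.\<close>

definition C_theory :: "fm set \<Rightarrow> fm set" where
  "C_theory \<Phi> =
     {univ_closure (imp (foldr Conj \<gamma> Tru) (foldr Disj \<delta> Fls)) | \<gamma> \<delta>.
        \<exists>\<pi>. cyclic_proof \<pi> \<and> contains_only (\<Phi> \<union> Q_formulas) \<pi> \<and> concl \<pi> = (set \<gamma>, set \<delta>)}"

lemma Delta0_subset: "Delta0 \<subseteq> Sigma_fm n \<and> Delta0 \<subseteq> Pi_fm n"
proof (induction n)
  case (Suc n)
  have "\<exists>k \<psi>. \<phi> = (Exists ^^ k) \<psi> \<and> \<psi> \<in> Pi_fm n"
    "\<exists>k \<psi>. \<phi> = (Forall ^^ k) \<psi> \<and> \<psi> \<in> Sigma_fm n" if "\<phi> \<in> Delta0" for \<phi>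
    using Suc that by (intro exI[of _ 0] exI[of _ \<phi>]; auto)+
  then show ?case by auto
qed simp

lemma Q_formulas_Sigma:
  assumes "n \<ge> 1"
  shows "Q_formulas \<subseteq> Sigma_fm n"
proof -
  obtain m where n: "n = Suc m" using assms by (cases n) auto
  have ex: "Exists (Pos a) \<in> Sigma_fm n" for a
  proof -
    have "Pos a \<in> Pi_fm m" using Delta0_subset Delta0.intros(1) by blast
    moreover have "Exists (Pos a) = (Exists ^^ 1) (Pos a)" by simp
    ultimately show ?thesis unfolding n Sigma_fm.simps by blast
  qed
  have at: "Pos a \<in> Sigma_fm n" "Neg a \<in> Sigma_fm n" for a
    using Delta0_subset Delta0.intros(1,2) by blast+
  show ?thesis
    unfolding Q_formulas_def by (auto elim!: Q_initial.cases intro: ex at simp del: Sigma_fm.simps)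
qed

lemma Q_formulas_Sigma_0:
  "Q_formulas \<subseteq> Sigma_fm 0
     \<union> {Exists (Pos (Eq t (Succ (BVar 0)))) | t. lc_tm 0 t}
     \<union> {Exists (Pos (Eq (Plus t (Succ (BVar 0))) u)) | t u. lc_tm 0 t \<and> lc_tm 0 u}"
  unfolding Q_formulas_def by (auto elim!: Q_initial.cases intro: Delta0.intros)

end

(* Free-cut elimination is replaced by a completeness argument. Call a formula universal if it is a
   block of universal quantifiers over an admitted formula (a Sigma_n formula or a formula of Q). A
   sequent of universal formulae is read as a transformation of cyclic derivations: whenever all
   instances of the formulae on the left are derivable in some context, also under additional
   hypotheses that are to be discharged by back edges, then so is a chosen instance of a formula on
   the right. This relation is closed under the logical rules and cut. It is also closed under
   induction for universal formulae: the induction hypothesis is supplied by a back edge, and the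
   induction variable is the progressing trace. If a Pi_{n+1} sentence is not in the relation, a
   Henkin construction gives a model of Q and of Pi_{n+1} induction refuting the sentence; in such a
   model Sigma_{n+1} induction holds as well, so the sentence is not provable in ISigma_{n+1}.
   Otherwise its instances have cyclic proofs of Sigma_n formulae. *)
theory Submission
  imports Defs "HOL-Library.Countable"
begin


section \<open>Syntax\<close>

text \<open>The obstacle is that a Pi_{n+1} formula must not occur in the cyclic proof, although
  cuts on it and induction for it have to be simulated. The asymmetry between all instances on the
  left and one instance on the right achieves this: a cut on such a formula performs no cut, since
  the derivation from one premise asks for instances and the other premise supplies each of them. A
  request may come deep inside another derivation, within further loops; hence the stability under
  larger contexts and longer lists of loops. A back edge can supply the induction hypothesis because
  its substitution may move, besides the induction variable, all variables that stand for opened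
  quantifiers: one loop serves every instance at the predecessor. Propositional and existential
  rules are available only within the class, so the truth lemma, and with it the induction scheme of
  the model, stops at universal formulae. Sigma_{n+1} induction then comes from descending from a
  failing point to zero, since the statement carried downwards is the negation of the induction
  formula.\<close>

lemma lc_tm_mono: "lc_tm j t \<Longrightarrow> j \<le> k \<Longrightarrow> lc_tm k t"
  by (induction t) auto

lemma lc_atom_mono: "lc_atom j a \<Longrightarrow> j \<le> k \<Longrightarrow> lc_atom k a"
  by (cases a) (auto intro: lc_tm_mono)

lemma lc_fm_mono: "lc_fm j \<phi> \<Longrightarrow> j \<le> k \<Longrightarrow> lc_fm k \<phi>"
  by (induction \<phi> arbitrary: j k) (auto intro: lc_atom_mono)

lemma open_tm_lc: "lc_tm k t \<Longrightarrow> k \<le> j \<Longrightarrow> open_tm j u t = t"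
  by (induction t) auto

lemma open_atom_lc: "lc_atom k a \<Longrightarrow> k \<le> j \<Longrightarrow> open_atom j u a = a"
  by (cases a) (auto intro: open_tm_lc)

lemma open_fm_lc: "lc_fm k \<phi> \<Longrightarrow> k \<le> j \<Longrightarrow> open_fm j u \<phi> = \<phi>"
  by (induction \<phi> arbitrary: j k) (auto intro: open_atom_lc)

lemma lc_open_tm: "lc_tm 0 u \<Longrightarrow> lc_tm k (open_tm k u t) \<longleftrightarrow> lc_tm (Suc k) t"
  by (induction t) (auto intro: lc_tm_mono)

lemma lc_open_atom: "lc_tm 0 u \<Longrightarrow> lc_atom k (open_atom k u a) \<longleftrightarrow> lc_atom (Suc k) a"
  by (cases a) (auto simp: lc_open_tm)

lemma lc_open_fm: "lc_tm 0 u \<Longrightarrow> lc_fm k (open_fm k u \<phi>) \<longleftrightarrow> lc_fm (Suc k) \<phi>"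
  by (induction \<phi> arbitrary: k) (auto simp: lc_open_atom)

lemma lc_inst: "lc_tm 0 u \<Longrightarrow> lc_fm 0 (inst \<phi> u) \<longleftrightarrow> lc_fm (Suc 0) \<phi>"
  by (simp add: inst_def lc_open_fm)

definition lc_sub :: "(nat \<Rightarrow> tm) \<Rightarrow> bool" where
  "lc_sub \<sigma> \<longleftrightarrow> (\<forall>x. lc_tm 0 (\<sigma> x))"

lemma lc_sub_FVar [simp]: "lc_sub FVar"
  by (simp add: lc_sub_def)

lemma lc_sub_upd: "lc_sub \<sigma> \<Longrightarrow> lc_tm 0 t \<Longrightarrow> lc_sub (\<sigma>(x := t))"
  by (simp add: lc_sub_def)

lemma lc_sub_tm: "lc_sub \<sigma> \<Longrightarrow> lc_tm k (sub_tm \<sigma> t) \<longleftrightarrow> lc_tm k t"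
  by (induction t) (auto simp: lc_sub_def intro: lc_tm_mono)

lemma lc_sub_atom: "lc_sub \<sigma> \<Longrightarrow> lc_atom k (sub_atom \<sigma> a) \<longleftrightarrow> lc_atom k a"
  by (cases a) (auto simp: lc_sub_tm)

lemma lc_sub_fm: "lc_sub \<sigma> \<Longrightarrow> lc_fm k (sub_fm \<sigma> \<phi>) \<longleftrightarrow> lc_fm k \<phi>"
  by (induction \<phi> arbitrary: k) (auto simp: lc_sub_atom)

lemma lc_sub_tmD: "lc_tm k (sub_tm \<sigma> t) \<Longrightarrow> lc_tm k t"
  by (induction t) auto

lemma lc_sub_atomD: "lc_atom k (sub_atom \<sigma> a) \<Longrightarrow> lc_atom k a"
  by (cases a) (auto dest: lc_sub_tmD)

lemma lc_sub_fmD: "lc_fm k (sub_fm \<sigma> \<phi>) \<Longrightarrow> lc_fm k \<phi>"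
  by (induction \<phi> arbitrary: k) (auto dest: lc_sub_atomD)

lemma sub_tm_open: "lc_sub \<sigma> \<Longrightarrow> sub_tm \<sigma> (open_tm k u t) = open_tm k (sub_tm \<sigma> u) (sub_tm \<sigma> t)"
  by (induction t) (auto simp: lc_sub_def open_tm_lc[OF _ le0])

lemma sub_atom_open:
  "lc_sub \<sigma> \<Longrightarrow> sub_atom \<sigma> (open_atom k u a) = open_atom k (sub_tm \<sigma> u) (sub_atom \<sigma> a)"
  by (cases a) (auto simp: sub_tm_open)

lemma sub_fm_open: "lc_sub \<sigma> \<Longrightarrow> sub_fm \<sigma> (open_fm k u \<phi>) = open_fm k (sub_tm \<sigma> u) (sub_fm \<sigma> \<phi>)"
  by (induction \<phi> arbitrary: k) (auto simp: sub_atom_open)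

lemma sub_inst: "lc_sub \<sigma> \<Longrightarrow> sub_fm \<sigma> (inst \<phi> u) = inst (sub_fm \<sigma> \<phi>) (sub_tm \<sigma> u)"
  by (simp add: inst_def sub_fm_open)

lemma sub_tm_cong: "(\<And>x. x \<in> fv_tm t \<Longrightarrow> \<sigma> x = \<tau> x) \<Longrightarrow> sub_tm \<sigma> t = sub_tm \<tau> t"
  by (induction t) auto

lemma sub_atom_cong: "(\<And>x. x \<in> fv_atom a \<Longrightarrow> \<sigma> x = \<tau> x) \<Longrightarrow> sub_atom \<sigma> a = sub_atom \<tau> a"
  by (cases a) (auto intro!: sub_tm_cong)

lemma sub_fm_cong: "(\<And>x. x \<in> fv_fm \<phi> \<Longrightarrow> \<sigma> x = \<tau> x) \<Longrightarrow> sub_fm \<sigma> \<phi> = sub_fm \<tau> \<phi>"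
  by (induction \<phi>) (auto intro!: sub_atom_cong)

lemma sub_tm_FVar [simp]: "sub_tm FVar t = t"
  by (induction t) auto

lemma sub_atom_FVar [simp]: "sub_atom FVar a = a"
  by (cases a) auto

lemma sub_fm_FVar [simp]: "sub_fm FVar \<phi> = \<phi>"
  by (induction \<phi>) auto

lemma sub_fm_id: "(\<And>x. x \<in> fv_fm \<phi> \<Longrightarrow> \<sigma> x = FVar x) \<Longrightarrow> sub_fm \<sigma> \<phi> = \<phi>"
  using sub_fm_cong[of \<phi> \<sigma> FVar] by simp

lemma sub_tm_id: "(\<And>x. x \<in> fv_tm t \<Longrightarrow> \<sigma> x = FVar x) \<Longrightarrow> sub_tm \<sigma> t = t"
  using sub_tm_cong[of t \<sigma> FVar] by simp

lemma sub_tm_comp: "sub_tm \<sigma> (sub_tm \<theta> t) = sub_tm (\<lambda>x. sub_tm \<sigma> (\<theta> x)) t"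
  by (induction t) auto

lemma sub_atom_comp: "sub_atom \<sigma> (sub_atom \<theta> a) = sub_atom (\<lambda>x. sub_tm \<sigma> (\<theta> x)) a"
  by (cases a) (auto simp: sub_tm_comp)

lemma sub_fm_comp: "sub_fm \<sigma> (sub_fm \<theta> \<phi>) = sub_fm (\<lambda>x. sub_tm \<sigma> (\<theta> x)) \<phi>"
  by (induction \<phi>) (auto simp: sub_atom_comp)

lemma lc_sub_comp: "lc_sub \<sigma> \<Longrightarrow> lc_sub \<theta> \<Longrightarrow> lc_sub (\<lambda>x. sub_tm \<sigma> (\<theta> x))"
  using lc_sub_tm by (auto simp: lc_sub_def)

lemma finite_fv_tm [simp]: "finite (fv_tm t)"
  by (induction t) auto

lemma finite_fv_atom [simp]: "finite (fv_atom a)"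
  by (cases a) auto

lemma finite_fv_fm [simp]: "finite (fv_fm \<phi>)"
  by (induction \<phi>) auto

lemma fv_sub_tm: "fv_tm (sub_tm \<sigma> t) = (\<Union>x\<in>fv_tm t. fv_tm (\<sigma> x))"
  by (induction t) auto

lemma fv_sub_atom: "fv_atom (sub_atom \<sigma> a) = (\<Union>x\<in>fv_atom a. fv_tm (\<sigma> x))"
  by (cases a) (auto simp: fv_sub_tm)

lemma fv_sub_fm: "fv_fm (sub_fm \<sigma> \<phi>) = (\<Union>x\<in>fv_fm \<phi>. fv_tm (\<sigma> x))"
  by (induction \<phi>) (auto simp: fv_sub_atom)

lemma fv_open_tm: "fv_tm t \<subseteq> fv_tm (open_tm k u t)" "fv_tm (open_tm k u t) \<subseteq> fv_tm t \<union> fv_tm u"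
  by (induction t) auto

lemma fv_open_atom:
  "fv_atom a \<subseteq> fv_atom (open_atom k u a)" "fv_atom (open_atom k u a) \<subseteq> fv_atom a \<union> fv_tm u"
  using fv_open_tm by (cases a; fastforce)+

lemma fv_open_fm:
  "fv_fm \<phi> \<subseteq> fv_fm (open_fm k u \<phi>)" "fv_fm (open_fm k u \<phi>) \<subseteq> fv_fm \<phi> \<union> fv_tm u"
  using fv_open_atom by (induction \<phi> arbitrary: k; fastforce)+

lemma fv_inst: "fv_fm \<phi> \<subseteq> fv_fm (inst \<phi> u)" "fv_fm (inst \<phi> u) \<subseteq> fv_fm \<phi> \<union> fv_tm u"
  by (simp_all add: inst_def fv_open_fm)

lemma fv_close_tm: "fv_tm (close_tm k x t) = fv_tm t - {x}"
  by (induction t) auto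

lemma fv_close_atom: "fv_atom (close_atom k x a) = fv_atom a - {x}"
  by (cases a) (auto simp: fv_close_tm)

lemma fv_close_fm: "fv_fm (close_fm k x \<phi>) = fv_fm \<phi> - {x}"
  by (induction \<phi> arbitrary: k) (auto simp: fv_close_atom)

lemma lc_close_tm: "lc_tm k t \<Longrightarrow> lc_tm (Suc k) (close_tm k x t)"
  by (induction t) auto

lemma lc_close_atom: "lc_atom k a \<Longrightarrow> lc_atom (Suc k) (close_atom k x a)"
  by (cases a) (auto simp: lc_close_tm)

lemma lc_close_fm: "lc_fm k \<phi> \<Longrightarrow> lc_fm (Suc k) (close_fm k x \<phi>)"
  by (induction \<phi> arbitrary: k) (auto simp: lc_close_atom)

lemma open_close_tm: "lc_tm k t \<Longrightarrow> open_tm k u (close_tm k x t) = sub_tm (FVar(x := u)) t"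
  by (induction t) auto

lemma open_close_atom:
  "lc_atom k a \<Longrightarrow> open_atom k u (close_atom k x a) = sub_atom (FVar(x := u)) a"
  by (cases a) (auto simp: open_close_tm)

lemma open_close_fm: "lc_fm k \<phi> \<Longrightarrow> open_fm k u (close_fm k x \<phi>) = sub_fm (FVar(x := u)) \<phi>"
  by (induction \<phi> arbitrary: k) (auto simp: open_close_atom)

lemma inst_close: "lc_fm 0 \<phi> \<Longrightarrow> inst (close_fm 0 x \<phi>) u = sub_fm (FVar(x := u)) \<phi>"
  by (simp add: inst_def open_close_fm)

text \<open>Sending \<open>a\<close> to \<open>w\<close> commutes with opening because
  \<open>a\<close> does not occur in the body. Quantifier cases use this to trade an instance of a
  substituted body for a substituted instance at a fresh variable.\<close>

lemma inst_sub:
  assumes "lc_sub \<sigma>" "lc_tm 0 w" "a \<notin> fv_fm \<phi>"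
  shows "inst (sub_fm \<sigma> \<phi>) w = sub_fm (\<sigma>(a := w)) (inst \<phi> (FVar a))"
proof -
  have "sub_fm (\<sigma>(a := w)) \<phi> = sub_fm \<sigma> \<phi>"
    using assms(3) by (intro sub_fm_cong) auto
  then show ?thesis
    using assms by (simp add: sub_inst lc_sub_upd)
qed

lemma sub_upd_fresh: "a \<notin> fv_fm \<phi> \<Longrightarrow> sub_fm (\<sigma>(a := w)) \<phi> = sub_fm \<sigma> \<phi>"
  by (intro sub_fm_cong) auto

lemma sub_subst1: "sub_fm \<sigma> (subst1 x t \<phi>) = sub_fm (\<sigma>(x := sub_tm \<sigma> t)) \<phi>"
  unfolding subst1_def sub_fm_comp by (intro sub_fm_cong) auto

text \<open>Terms do not count, so \<open>inst\<close> leaves the measure unchanged. It drives the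
  recursion of \<open>Tr\<close> and the inductions on truth, where a quantified formula is reduced
  to its instances.\<close>

primrec cpx :: "fm \<Rightarrow> nat" where
  "cpx (Pos a) = 0"
| "cpx (Neg a) = 0"
| "cpx (Conj \<phi> \<psi>) = Suc (cpx \<phi> + cpx \<psi>)"
| "cpx (Disj \<phi> \<psi>) = Suc (cpx \<phi> + cpx \<psi>)"
| "cpx (Forall \<phi>) = Suc (cpx \<phi>)"
| "cpx (Exists \<phi>) = Suc (cpx \<phi>)"

lemma cpx_open [simp]: "cpx (open_fm k u \<phi>) = cpx \<phi>"
  by (induction \<phi> arbitrary: k) auto

lemma cpx_inst [simp]: "cpx (inst \<phi> u) = cpx \<phi>"
  by (simp add: inst_def)

lemma fresh_var: "finite W \<Longrightarrow> \<exists>x::nat. x \<notin> W"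
  by (rule ex_new_if_finite[OF infinite_UNIV_nat])

section \<open>Finite derivations with back edges\<close>

text \<open>\<open>(x, w, s)\<close> stands for an enclosing loop with conclusion \<open>s\<close> and trace variable \<open>x\<close>, whose
  antecedent contains \<open>x < w\<close> throughout. A back edge to it (\<open>Bud\<close>, with the number of loops to be left)
  is a substitution step with \<open>w := x\<close>, which turns the atom \<open>x < w\<close> of \<open>s\<close> into the progress condition.\<close>

type_synonym companion = "nat \<times> nat \<times> sequent"

datatype der =
    Inf sequent rule_name "der list"
  | Bud sequent "nat \<Rightarrow> tm" nat
  | Loop nat nat sequent der

primrec dseq :: "der \<Rightarrow> sequent" where
  "dseq (Inf s r ds) = s"
| "dseq (Bud s \<theta> i) = s"
| "dseq (Loop x w s d) = s"

definition sub_seq :: "(nat \<Rightarrow> tm) \<Rightarrow> sequent \<Rightarrow> sequent" where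
  "sub_seq \<theta> s = (sub_fm \<theta> ` fst s, sub_fm \<theta> ` snd s)"

definition tracks :: "companion list \<Rightarrow> fm set \<Rightarrow> bool" where
  "tracks H \<Gamma> \<longleftrightarrow> (\<forall>(x, w, s) \<in> set H. Pos (Lt (FVar x) (FVar w)) \<in> \<Gamma>)"

text \<open>At a substitution step a trace passes from \<open>sub_tm \<theta> t'\<close> to
  \<open>t'\<close>; fixing the variables of the open loops keeps the constant trace
  \<open>x\<close> alive. Their bounds \<open>w\<close> may be moved.\<close>

definition fixes_tracked :: "companion list \<Rightarrow> (nat \<Rightarrow> tm) \<Rightarrow> bool" where
  "fixes_tracked H \<theta> \<longleftrightarrow> (\<forall>(x, w, s) \<in> set H. \<theta> x = FVar x)"

text \<open>An infinite branch never visits an inference without premises, so tracking is demanded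
  only of the others. A back edge to \<open>(x, w, s0)\<close> leaves the loops of
  \<open>H1\<close>; hence \<open>\<theta>\<close> has to respect just those of \<open>H2\<close>,
  and its value at \<open>x\<close> is free.\<close>

inductive ok_der :: "fm set \<Rightarrow> companion list \<Rightarrow> der \<Rightarrow> bool" for \<Phi> where
  ok_Inf: "wf_sequent s \<Longrightarrow> fst s \<union> snd s \<subseteq> \<Phi> \<Longrightarrow> ds \<noteq> [] \<longrightarrow> tracks H (fst s) \<Longrightarrow>
    step r (map dseq ds) s \<or> r = QInit \<and> ds = [] \<and> Q_initial s \<Longrightarrow>
    (\<And>\<theta>. r = Sub \<theta> \<Longrightarrow> fixes_tracked H \<theta>) \<Longrightarrow>
    (\<And>d. d \<in> set ds \<Longrightarrow> ok_der \<Phi> H d) \<Longrightarrow> ok_der \<Phi> H (Inf s r ds)"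
| ok_Bud: "H = H1 @ (x, w, s0) # H2 \<Longrightarrow> i = length H1 \<Longrightarrow> s = sub_seq \<theta> s0 \<Longrightarrow> lc_sub \<theta> \<Longrightarrow>
    \<theta> w = FVar x \<Longrightarrow> fixes_tracked H2 \<theta> \<Longrightarrow> wf_sequent s \<Longrightarrow> fst s \<union> snd s \<subseteq> \<Phi> \<Longrightarrow>
    ok_der \<Phi> H (Bud s \<theta> i)"
| ok_Loop: "wf_sequent s \<Longrightarrow> fst s \<union> snd s \<subseteq> \<Phi> \<Longrightarrow> tracks ((x, w, s) # H) (fst s) \<Longrightarrow>
    dseq d = s \<Longrightarrow> ok_der \<Phi> ((x, w, s) # H) d \<Longrightarrow> ok_der \<Phi> H (Loop x w s d)"

inductive_cases ok_InfE: "ok_der \<Phi> H (Inf s r ds)"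
inductive_cases ok_BudE: "ok_der \<Phi> H (Bud s \<theta> i)"
inductive_cases ok_LoopE: "ok_der \<Phi> H (Loop x w s d)"
lemmas ok_derE = ok_InfE ok_BudE ok_LoopE

lemma ok_der_seq: "ok_der \<Phi> H d \<Longrightarrow> wf_sequent (dseq d) \<and> fst (dseq d) \<union> snd (dseq d) \<subseteq> \<Phi>"
  by (erule ok_der.cases) auto

section \<open>Unfolding a derivation into a cyclic proof\<close>

text \<open>A state consists of a subderivation and the stack of its enclosing loops, innermost first.\<close>

type_synonym state = "der \<times> der list"

fun succs :: "state \<Rightarrow> state list" where
  "succs (Inf s r ds, L) = map (\<lambda>d. (d, L)) ds"
| "succs (Bud s \<theta> i, L) = [(L ! i, drop (Suc i) L)]"
| "succs (Loop x w s d, L) = [(d, Loop x w s d # L)]"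

text \<open>A loop becomes a node whose only premise repeats its sequent, a trivial weakening. The
  companion is thus a node of its own, to which back edges can point.\<close>

fun drule :: "der \<Rightarrow> rule_name" where
  "drule (Inf s r ds) = r"
| "drule (Bud s \<theta> i) = Sub \<theta>"
| "drule (Loop x w s d) = Weak"

primcorec unfold_state :: "state \<Rightarrow> tree" where
  "unfold_state st = Node (dseq (fst st)) (drule (fst st)) (map unfold_state (succs st))"

fun comp_of :: "der \<Rightarrow> companion" where
  "comp_of (Loop x w s d) = (x, w, s)"
| "comp_of d = (0, 0, ({}, {}))"

definition is_Loop :: "der \<Rightarrow> bool" where
  "is_Loop d \<longleftrightarrow> (\<exists>x w s d'. d = Loop x w s d')"

definition is_Bud :: "der \<Rightarrow> bool" where
  "is_Bud d \<longleftrightarrow> (\<exists>s \<theta> i. d = Bud s \<theta> i)"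

section \<open>Regularity and local correctness of the unfolding\<close>

text \<open>Back edges are left out, so that the reachable states are finitely many by induction on
  the derivation. By \<open>reach_succs\<close> they are nevertheless all states of the
  unfolding.\<close>

inductive tree_edge :: "state \<Rightarrow> state \<Rightarrow> bool" where
  "d \<in> set ds \<Longrightarrow> tree_edge (Inf s r ds, L) (d, L)"
| "tree_edge (Loop x w s d, L) (d, Loop x w s d # L)"

abbreviation reach :: "state \<Rightarrow> state \<Rightarrow> bool" where
  "reach \<equiv> tree_edge\<^sup>*\<^sup>*"

lemma reach_cases:
  assumes "reach (d, L) \<sigma>"
  obtains "\<sigma> = (d, L)" | s r ds d' where "d = Inf s r ds" "d' \<in> set ds" "reach (d', L) \<sigma>"
  | x w s d' where "d = Loop x w s d'" "reach (d', d # L) \<sigma>"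
  using assms by (cases rule: converse_rtranclpE) (auto elim!: tree_edge.cases)

lemma finite_reach: "finite {\<sigma>. reach (d, L) \<sigma>}"
proof (induction d arbitrary: L)
  case (Inf s r ds)
  have "{\<sigma>. reach (Inf s r ds, L) \<sigma>} \<subseteq> insert (Inf s r ds, L) (\<Union>d\<in>set ds. {\<sigma>. reach (d, L) \<sigma>})"
    by (rule subsetI, drule CollectD, erule reach_cases) auto
  then show ?case
    by (rule finite_subset) (simp add: Inf)
next
  case (Bud s \<theta> i)
  have "{\<sigma>. reach (Bud s \<theta> i, L) \<sigma>} \<subseteq> {(Bud s \<theta> i, L)}"
    by (rule subsetI, drule CollectD, erule reach_cases) auto
  then show ?case
    by (rule finite_subset) simp
next
  case (Loop x w s d)
  have "{\<sigma>. reach (Loop x w s d, L) \<sigma>}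
      \<subseteq> insert (Loop x w s d, L) {\<sigma>. reach (d, Loop x w s d # L) \<sigma>}"
    by (rule subsetI, drule CollectD, erule reach_cases) auto
  then show ?case
    by (rule finite_subset) (simp add: Loop)
qed

definition ok_state :: "fm set \<Rightarrow> state \<Rightarrow> bool" where
  "ok_state \<Phi> st \<longleftrightarrow> ok_der \<Phi> (map comp_of (snd st)) (fst st)"

lemma ok_state_edge:
  assumes "ok_state \<Phi> \<sigma>" "tree_edge \<sigma> \<sigma>'"
  shows "ok_state \<Phi> \<sigma>'"
  using assms(2,1) by cases (auto simp: ok_state_def elim!: ok_derE)

text \<open>Every stack entry was itself visited on the way down, with exactly the remaining stack.
  A back edge pops to such an entry and therefore stays within the states reachable by tree
  edges.\<close>

lemma reach_inv:
  assumes "reach (d0, []) \<sigma>" "ok_der \<Phi> [] d0"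
  shows "ok_state \<Phi> \<sigma> \<and>
    (\<forall>L1 C L2. snd \<sigma> = L1 @ C # L2 \<longrightarrow> is_Loop C \<and> reach (d0, []) (C, L2))"
  using assms(1)
proof (induction rule: rtranclp_induct)
  case base
  then show ?case using assms by (simp add: ok_state_def)
next
  case (step \<sigma> \<sigma>')
  have 1: "ok_state \<Phi> \<sigma>'"
    using step ok_state_edge by blast
  from step(2) have "is_Loop C \<and> reach (d0, []) (C, L2)" if "snd \<sigma>' = L1 @ C # L2" for L1 C L2
  proof cases
    case 1
    then show ?thesis using step.IH that by auto
  next
    case (2 x w s d L)
    show ?thesis
    proof (cases L1)
      case Nil
      then show ?thesis using 2 that step.hyps(1) by (auto simp: is_Loop_def)
    next
      case (Cons c L1')
      then show ?thesis using 2 that step.IH by auto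
    qed
  qed
  with 1 show ?case by blast
qed

lemma succs_cases:
  assumes "ok_state \<Phi> (d, L)" "\<sigma>' \<in> set (succs (d, L))"
  obtains (tree) "tree_edge (d, L) \<sigma>'" "\<not> is_Bud d"
  | (bud) s \<theta> L1 C L2 where "d = Bud s \<theta> (length L1)" "L = L1 @ C # L2" "\<sigma>' = (C, L2)"
proof (cases d)
  case (Inf s r ds)
  then show ?thesis using assms tree by (auto intro: tree_edge.intros simp: is_Bud_def)
next
  case (Bud s \<theta> i)
  with assms(1) have "i < length L"
    unfolding ok_state_def
    by (auto elim!: ok_derE) (metis length_Cons length_append length_map less_add_Suc1 add_Suc_right)
  then have "L = take i L @ (L ! i) # drop (Suc i) L" "length (take i L) = i"
    by (simp_all add: id_take_nth_drop)
  then show ?thesis using assms bud[of s \<theta> "take i L" "L ! i" "drop (Suc i) L"] Bud by auto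
next
  case (Loop x w s d)
  then show ?thesis using assms tree by (auto intro: tree_edge.intros simp: is_Bud_def)
qed

lemma reach_succs:
  assumes "reach (d0, []) \<sigma>" "ok_der \<Phi> [] d0" "\<sigma>' \<in> set (succs \<sigma>)"
  shows "reach (d0, []) \<sigma>'"
proof -
  obtain d L where \<sigma>: "\<sigma> = (d, L)" by fastforce
  have inv: "ok_state \<Phi> \<sigma> \<and>
      (\<forall>L1 C L2. snd \<sigma> = L1 @ C # L2 \<longrightarrow> is_Loop C \<and> reach (d0, []) (C, L2))"
    using reach_inv assms by blast
  then have "ok_state \<Phi> (d, L)" using \<sigma> by simp
  then show ?thesis
    using assms(3) unfolding \<sigma>
  proof (cases rule: succs_cases)
    case tree
    then show ?thesis using assms(1) \<sigma> by auto
  next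
    case (bud s \<theta> L1 C L2)
    then show ?thesis using inv \<sigma> by auto
  qed
qed

lemma subtree_unfold:
  assumes "subtree \<pi>' (unfold_state (d0, []))" "ok_der \<Phi> [] d0"
  shows "\<exists>\<sigma>. reach (d0, []) \<sigma> \<and> \<pi>' = unfold_state \<sigma>"
  using assms(1)
proof (induction \<pi>' "unfold_state (d0, [])" rule: subtree.induct)
  case 1
  then show ?case by blast
next
  case (2 \<pi>' \<pi>'')
  then obtain \<sigma> where \<sigma>: "reach (d0, []) \<sigma>" "\<pi>' = unfold_state \<sigma>" by blast
  with 2 obtain \<sigma>' where "\<sigma>' \<in> set (succs \<sigma>)" "\<pi>'' = unfold_state \<sigma>'" by auto
  then show ?case using \<sigma> reach_succs[OF _ assms(2)] by blast
qed

lemma regular_unfold: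
  assumes "ok_der \<Phi> [] d0"
  shows "regular (unfold_state (d0, []))"
proof -
  have "{\<pi>'. subtree \<pi>' (unfold_state (d0, []))} \<subseteq> unfold_state ` {\<sigma>. reach (d0, []) \<sigma>}"
    using subtree_unfold assms by blast
  then show ?thesis
    unfolding regular_def using finite_reach finite_surj by blast
qed

lemma contains_only_unfold:
  assumes "ok_der \<Phi> [] d0"
  shows "contains_only \<Phi> (unfold_state (d0, []))"
  unfolding contains_only_def
proof (intro allI impI)
  fix \<pi>' assume "subtree \<pi>' (unfold_state (d0, []))"
  then obtain \<sigma> where "reach (d0, []) \<sigma>" "\<pi>' = unfold_state \<sigma>"
    using subtree_unfold assms by blast
  then show "fst (concl \<pi>') \<union> snd (concl \<pi>') \<subseteq> \<Phi>"
    using reach_inv[OF _ assms, of \<sigma>] ok_der_seq[of \<Phi> "map comp_of (snd \<sigma>)" "fst \<sigma>"]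
    by (simp add: ok_state_def)
qed

lemma is_Loop_comp_of:
  assumes "ok_state \<Phi> (C, L)" "is_Loop C" "comp_of C = (x, w, s)"
  shows "dseq C = s" "Pos (Lt (FVar x) (FVar w)) \<in> fst s" "tracks (map comp_of L) (fst s)"
  using assms unfolding is_Loop_def ok_state_def
  by (auto simp: tracks_def simp del: set_map elim!: ok_LoopE)

lemma ok_state_Bud:
  assumes "ok_state \<Phi> (Bud s \<theta> (length L1), L1 @ C # L2)" "comp_of C = (x, w, s0)"
  shows "s = sub_seq \<theta> s0" "lc_sub \<theta>" "\<theta> w = FVar x" "fixes_tracked (map comp_of L2) \<theta>"
  using assms unfolding ok_state_def by (auto elim!: ok_derE)

lemma preproof_unfold:
  assumes ok: "ok_der \<Phi> [] d0"
  shows "preproof (unfold_state (d0, []))"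
  unfolding preproof_def
proof (intro allI impI)
  fix \<pi>' assume "subtree \<pi>' (unfold_state (d0, []))"
  then obtain d L where r: "reach (d0, []) (d, L)" and \<pi>': "\<pi>' = unfold_state (d, L)"
    using subtree_unfold assms by (metis surj_pair)
  have inv: "ok_state \<Phi> (d, L)"
      "\<And>L1 C L2. L = L1 @ C # L2 \<Longrightarrow> is_Loop C \<and> reach (d0, []) (C, L2)"
    using reach_inv[OF r ok] by auto
  have wf: "wf_sequent (dseq d)"
    using inv(1) ok_der_seq[of \<Phi> "map comp_of L" d] by (simp add: ok_state_def)
  have "step (drule d) (map (dseq \<circ> fst) (succs (d, L))) (dseq d) \<or>
      drule d = QInit \<and> succs (d, L) = [] \<and> Q_initial (dseq d)"
  proof (cases d)
    case (Inf s r ds)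
    then show ?thesis
      using inv(1) by (auto simp: ok_state_def comp_def elim!: ok_derE)
  next
    case (Bud s \<theta> i)
    have "(L ! i, drop (Suc i) L) \<in> set (succs (d, L))" using Bud by simp
    with inv(1) obtain L1 C L2 where i: "i = length L1" and L: "L = L1 @ C # L2"
      by (cases rule: succs_cases) (use Bud in \<open>auto simp: is_Bud_def\<close>)
    have "is_Loop C" "reach (d0, []) (C, L2)" using inv L by blast+
    then have C: "is_Loop C" "ok_state \<Phi> (C, L2)" using reach_inv[OF _ ok] by blast+
    obtain x w s0 where c: "comp_of C = (x, w, s0)" by (metis prod_cases3)
    have s: "s = sub_seq \<theta> s0" "lc_sub \<theta>" using ok_state_Bud[OF _ c] inv(1) Bud i L by blast+
    have "step (Sub \<theta>) [(fst s0, snd s0)] (sub_fm \<theta> ` fst s0, sub_fm \<theta> ` snd s0)"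
      using s by (intro step.intros) (simp add: lc_sub_def)
    then show ?thesis
      using Bud i L s is_Loop_comp_of(1)[OF C(2,1) c] by (simp add: sub_seq_def)
  next
    case (Loop x w s d')
    then have "dseq d' = s" using inv(1) by (auto simp: ok_state_def elim!: ok_derE)
    then show ?thesis using Loop by (cases s) (auto intro: step.intros)
  qed
  then show "wf_sequent (concl \<pi>') \<and> (step (rname \<pi>') (map concl (children \<pi>')) (concl \<pi>') \<or>
      rname \<pi>' = QInit \<and> children \<pi>' = [] \<and> Q_initial (concl \<pi>'))"
    unfolding \<pi>' using wf by (simp add: comp_def)
qed

section \<open>The trace condition for the unfolding\<close>

lemma infinite_branch_states:
  assumes "infinite_branch (unfold_state \<sigma>0) b"
  obtains \<sigma> where "\<sigma> 0 = \<sigma>0" "\<And>i. b i = unfold_state (\<sigma> i)" "\<And>i. \<sigma> (Suc i) \<in> set (succs (\<sigma> i))"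
proof -
  have "\<exists>\<sigma>. \<forall>i. (b i = unfold_state (\<sigma> i) \<and> (i = 0 \<longrightarrow> \<sigma> i = \<sigma>0)) \<and> \<sigma> (Suc i) \<in> set (succs (\<sigma> i))"
  proof (intro dependent_nat_choice)
    show "\<exists>x. b 0 = unfold_state x \<and> (0 = (0::nat) \<longrightarrow> x = \<sigma>0)"
      using assms unfolding infinite_branch_def by blast
  next
    fix x i assume "b i = unfold_state x \<and> (i = 0 \<longrightarrow> x = \<sigma>0)"
    moreover have "b (Suc i) \<in> set (children (b i))"
      using assms by (simp add: infinite_branch_def)
    ultimately have "b (Suc i) \<in> unfold_state ` set (succs x)"
      by simp
    then show "\<exists>y. (b (Suc i) = unfold_state y \<and> (Suc i = 0 \<longrightarrow> y = \<sigma>0)) \<and> y \<in> set (succs x)"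
      by blast
  qed
  then show ?thesis using that by blast
qed


lemma terms_self: "Pos (Lt t u) \<in> fst s \<Longrightarrow> lc_tm 0 t \<Longrightarrow> t \<in> terms_sequent s"
proof -
  have "t \<in> subterms t" by (cases t) auto
  then show "Pos (Lt t u) \<in> fst s \<Longrightarrow> lc_tm 0 t \<Longrightarrow> t \<in> terms_sequent s"
    by (force simp: terms_sequent_def)
qed

text \<open>\<open>n\<close> is the least value that the sequence meets or undercuts infinitely
  often; by minimality it falls strictly below \<open>n\<close> only finitely often.\<close>

lemma bounded_liminf:
  fixes l :: "nat \<Rightarrow> nat"
  assumes "\<And>i. l i \<le> N"
  obtains n m where "\<And>i. m \<le> i \<Longrightarrow> n \<le> l i" "\<And>k. \<exists>i\<ge>k. l i = n"
proof -
  define P where "P n \<longleftrightarrow> (\<forall>k. \<exists>i\<ge>k. l i \<le> n)" for n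
  have "P N" using assms by (auto simp: P_def)
  define n where "n = (LEAST n. P n)"
  have "P n" unfolding n_def using \<open>P N\<close> by (rule LeastI)
  have "\<exists>m. \<forall>i\<ge>m. n \<le> l i"
  proof (cases n)
    case 0
    then show ?thesis by simp
  next
    case (Suc n')
    then have "\<not> P n'" unfolding n_def by (metis lessI not_less_Least)
    then obtain k where "\<forall>i\<ge>k. n' < l i" by (auto simp: P_def not_le[symmetric])
    then show ?thesis using Suc by (auto simp: Suc_le_eq)
  qed
  then obtain m where m: "\<And>i. m \<le> i \<Longrightarrow> n \<le> l i" by blast
  have "\<exists>i\<ge>k. l i = n" for k
  proof -
    obtain i where "i \<ge> max k m" "l i \<le> n" using \<open>P n\<close> unfolding P_def by blast
    then show ?thesis using m[of i] by (intro exI[of _ i]) auto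
  qed
  with m show ?thesis by (rule that)
qed

text \<open>On every infinite branch the stack height has a limit inferior \<open>n\<close>. From some point on the
  branch keeps returning to one and the same loop \<open>C\<close> at height \<open>n\<close>, and the variable of \<open>C\<close> carries
  the trace: it is left untouched inside the body and decreases at each back edge to \<open>C\<close>.\<close>

lemma returning_loop:
  assumes ok: "ok_der \<Phi> [] d0"
    and \<sigma>: "\<sigma> 0 = (d0, [])" "\<And>i. \<sigma> (Suc i) \<in> set (succs (\<sigma> i))"
  obtains C S m where "is_Loop C"
    "\<And>i. m \<le> i \<Longrightarrow> \<sigma> i = (C, S) \<or> (\<exists>L1. snd (\<sigma> i) = L1 @ C # S)"
    "\<And>k. \<exists>i\<ge>k. is_Bud (fst (\<sigma> i)) \<and> \<sigma> (Suc i) = (C, S)"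
proof -
  have r: "reach (d0, []) (\<sigma> i)" for i
    by (induction i) (use \<sigma> reach_succs[OF _ ok] in auto)
  have okst: "ok_state \<Phi> (\<sigma> i)" for i
    using reach_inv[OF r ok] by blast
  define l where "l i = length (snd (\<sigma> i))" for i
  have "finite ((\<lambda>\<sigma>. length (snd \<sigma>)) ` {\<sigma>. reach (d0, []) \<sigma>})"
    using finite_reach by blast
  then obtain N where "l i \<le> N" for i
    using r unfolding finite_nat_set_iff_bounded_le l_def by blast
  from bounded_liminf[of l, OF this] obtain n m1 where m1: "\<And>i. m1 \<le> i \<Longrightarrow> n \<le> l i" and inf: "\<And>k. \<exists>i\<ge>k. l i = n"
    by metis
  have edge: "tree_edge (\<sigma> i) (\<sigma> (Suc i)) \<and> \<not> is_Bud (fst (\<sigma> i)) \<or>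
      (\<exists>s \<theta> L1 C L2. \<sigma> i = (Bud s \<theta> (length L1), L1 @ C # L2) \<and> \<sigma> (Suc i) = (C, L2))" for i
  proof -
    obtain d L where dL: "\<sigma> i = (d, L)" by fastforce
    show ?thesis
      using okst[of i] \<sigma>(2)[of i] unfolding dL by (cases rule: succs_cases) (auto simp: dL)
  qed
  have tree: "l i \<le> l (Suc i) \<and> (l i = l (Suc i) \<longrightarrow> size (fst (\<sigma> (Suc i))) < size (fst (\<sigma> i)))"
    if "\<not> is_Bud (fst (\<sigma> i))" for i
  proof -
    have "tree_edge (\<sigma> i) (\<sigma> (Suc i))"
      using edge[of i] that by (auto simp: is_Bud_def)
    then show ?thesis
      by cases (auto simp: l_def less_Suc_eq_le size_list_estimation')
  qed
  \<comment> \<open>Otherwise the branch finally stays at height \<open>n\<close>: once above, it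
    could come down to \<open>n\<close> only by a back edge. Staying at \<open>n\<close> then
    excludes back edges, and the derivation at hand would shrink forever.\<close>
  have ret: "\<exists>i\<ge>k. is_Bud (fst (\<sigma> i)) \<and> l (Suc i) = n" for k
  proof (rule ccontr)
    assume none: "\<not> (\<exists>i\<ge>k. is_Bud (fst (\<sigma> i)) \<and> l (Suc i) = n)"
    obtain k0 where k0: "k0 \<ge> max k m1" "l k0 = n" using inf by blast
    have up: "n < l j" if "n < l i" "k0 \<le> i" "i \<le> j" for i j
      using that(3)
    proof (induction j rule: dec_induct)
      case base
      then show ?case by (fact that)
    next
      case (step j)
      show ?case
      proof (cases "is_Bud (fst (\<sigma> j))")
        case True
        then have "l (Suc j) \<noteq> n" using none k0 step that by auto
        moreover have "n \<le> l (Suc j)" using m1 k0 step that by auto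
        ultimately show ?thesis by simp
      next
        case False
        then show ?thesis using tree[of j] step by linarith
      qed
    qed
    have const: "l j = n" if "k0 \<le> j" for j
    proof (rule ccontr)
      assume "l j \<noteq> n"
      then have "n < l j" using m1[of j] k0 that by auto
      moreover obtain j' where "j \<le> j'" "l j' = n" using inf by blast
      ultimately show False using up[of j j'] that by simp
    qed
    have nobud: "\<not> is_Bud (fst (\<sigma> j))" if "k0 \<le> j" for j
      using none const[of "Suc j"] k0 that by auto
    have "size (fst (\<sigma> (Suc j))) < size (fst (\<sigma> j))" if "k0 \<le> j" for j
      using tree[OF nobud[OF that]] const[of j] const[of "Suc j"] that by simp
    then have "\<exists>f. \<forall>i. (f (Suc i), f i) \<in> less_than"
      by (intro exI[of _ "\<lambda>i. size (fst (\<sigma> (k0 + i)))"]) simp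
    then show False
      using wf_less_than unfolding wf_iff_no_infinite_down_chain by blast
  qed
  obtain k0 where k0: "k0 \<ge> m1" "is_Bud (fst (\<sigma> k0))" "l (Suc k0) = n" using ret by blast
  obtain C S where CS: "\<sigma> (Suc k0) = (C, S)" by fastforce
  have lS: "length S = n" using k0(3) CS by (simp add: l_def)
  obtain s \<theta> L1 where k0': "\<sigma> k0 = (Bud s \<theta> (length L1), L1 @ C # S)"
    using edge[of k0] k0(2) CS by auto
  have C: "is_Loop C" using reach_inv[OF r[of k0] ok] k0' by auto
  \<comment> \<open>A back edge past \<open>C\<close> would give a stack shorter than
    \<open>n\<close>, and a back edge to \<open>C\<close> itself leads to
    \<open>(C, S)\<close>.\<close>
  have inv: "\<sigma> i = (C, S) \<or> (\<exists>L1. snd (\<sigma> i) = L1 @ C # S)" if "Suc k0 \<le> i" for i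
    using that
  proof (induction i rule: dec_induct)
    case base
    then show ?case using CS by simp
  next
    case (step i)
    show ?case
    proof (cases "\<sigma> i = (C, S)")
      case True
      then have "\<sigma> (Suc i) \<in> set (succs (C, S))" using \<sigma>(2)[of i] by simp
      then show ?thesis using C by (auto simp: is_Loop_def)
    next
      case False
      then obtain L1 where L1: "snd (\<sigma> i) = L1 @ C # S" using step by blast
      from edge[of i] show ?thesis
      proof (elim disjE conjE exE)
        assume "tree_edge (\<sigma> i) (\<sigma> (Suc i))"
        then show ?thesis using L1 by cases auto
      next
        fix s \<theta> L1' C' L2
        assume e: "\<sigma> i = (Bud s \<theta> (length L1'), L1' @ C' # L2)" "\<sigma> (Suc i) = (C', L2)"
        have eq: "L1' @ C' # L2 = L1 @ C # S" using e(1) L1 by simp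
        have "length S \<le> length L2" using e m1[of "Suc i"] step k0 lS by (simp add: l_def)
        then have len: "length L1' \<le> length L1" using arg_cong[OF eq, of length] by simp
        from eq consider "C' = C" "L2 = S" | us where "L2 = us @ C # S"
          by (auto simp: append_eq_append_conv2 Cons_eq_append_conv) (use len in auto)
        then show ?thesis using e(2) by cases auto
      qed
    qed
  qed
  have "\<exists>i\<ge>k. is_Bud (fst (\<sigma> i)) \<and> \<sigma> (Suc i) = (C, S)" for k
  proof -
    obtain i where i: "i \<ge> max k (Suc k0)" "is_Bud (fst (\<sigma> i))" "l (Suc i) = n" using ret by blast
    have "\<not> (\<exists>L1. snd (\<sigma> (Suc i)) = L1 @ C # S)" using i(3) lS by (auto simp: l_def)
    then have "\<sigma> (Suc i) = (C, S)" using inv[of "Suc i"] i by auto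
    then show ?thesis using i by auto
  qed
  with C inv show ?thesis by (rule that)
qed


lemma infinity_proof_unfold:
  assumes ok: "ok_der \<Phi> [] d0"
  shows "infinity_proof (unfold_state (d0, []))"
  unfolding infinity_proof_def
proof (intro conjI allI impI)
  show "preproof (unfold_state (d0, []))" using preproof_unfold ok .
  fix b assume "infinite_branch (unfold_state (d0, [])) b"
  then obtain \<sigma> where \<sigma>0: "\<sigma> 0 = (d0, [])" and b: "\<And>i. b i = unfold_state (\<sigma> i)"
    and \<sigma>: "\<And>i. \<sigma> (Suc i) \<in> set (succs (\<sigma> i))"
    by (rule infinite_branch_states) blast
  have r: "reach (d0, []) (\<sigma> i)" for i
    by (induction i) (use \<sigma>0 \<sigma> reach_succs[OF _ ok] in auto)
  have okst: "ok_state \<Phi> (\<sigma> i)" for i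
    using reach_inv[OF r ok] by blast
  from returning_loop[of \<Phi> d0 \<sigma>, OF ok \<sigma>0 \<sigma>] obtain C S m where C: "is_Loop C"
    and inv: "\<And>i. m \<le> i \<Longrightarrow> \<sigma> i = (C, S) \<or> (\<exists>L1. snd (\<sigma> i) = L1 @ C # S)"
    and ret: "\<And>k. \<exists>i\<ge>k. is_Bud (fst (\<sigma> i)) \<and> \<sigma> (Suc i) = (C, S)"
    by metis
  obtain x w s0 where c: "comp_of C = (x, w, s0)" by (metis prod_cases3)
  obtain k0 where "\<sigma> (Suc k0) = (C, S)" using ret by blast
  with okst have okC: "ok_state \<Phi> (C, S)" by metis
  note C_props = is_Loop_comp_of[OF okC C c]
  define hit where "hit i \<longleftrightarrow> is_Bud (fst (\<sigma> i)) \<and> \<sigma> (Suc i) = (C, S)" for i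
  \<comment> \<open>At a back edge to \<open>C\<close> the trace has to be
    \<open>\<theta> x\<close>: the atom \<open>x < w\<close> of the companion has become
    \<open>\<theta> x < x\<close>, and \<open>x\<close> is a precursor of \<open>\<theta> x\<close>
    at the substitution step. The default \<open>Zero\<close> is never reached, as a hit is a back
    edge.\<close>
  define \<tau> where "\<tau> i = (if hit i then (case fst (\<sigma> i) of Bud s \<theta> j \<Rightarrow> \<theta> x | _ \<Rightarrow> Zero) else FVar x)" for i
  \<comment> \<open>A back edge leads to a loop node, so two hits are never adjacent: the trace is
    \<open>x\<close> both right before and right after a hit.\<close>
  have succ_hit: "\<not> hit (Suc i)" if "is_Bud (fst (\<sigma> i))" for i
  proof -
    obtain d L where dL: "\<sigma> i = (d, L)" by fastforce
    from okst[of i] \<sigma>[of i] have "is_Loop (fst (\<sigma> (Suc i)))"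
      unfolding dL
    proof (cases rule: succs_cases)
      case (bud s \<theta> L1 C' L2)
      then show ?thesis using reach_inv[OF r[of i] ok] dL by auto
    qed (use that dL in auto)
    then show ?thesis by (auto simp: hit_def is_Bud_def is_Loop_def)
  qed
  have hitE: thesis if "hit i"
    "\<And>s \<theta> L1. \<sigma> i = (Bud s \<theta> (length L1), L1 @ C # S) \<Longrightarrow> s = sub_seq \<theta> s0 \<Longrightarrow> lc_sub \<theta> \<Longrightarrow>
      \<theta> w = FVar x \<Longrightarrow> \<tau> i = \<theta> x \<Longrightarrow> thesis" for i thesis
  proof -
    obtain d L where dL: "\<sigma> i = (d, L)" by fastforce
    from okst[of i] \<sigma>[of i] show ?thesis
      unfolding dL
    proof (cases rule: succs_cases)
      case (bud s \<theta> L1 C' L2)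
      then have \<sigma>i: "\<sigma> i = (Bud s \<theta> (length L1), L1 @ C # S)"
        using that(1) dL by (auto simp: hit_def)
      moreover from this have "ok_state \<Phi> (Bud s \<theta> (length L1), L1 @ C # S)" using okst[of i] by simp
      ultimately show ?thesis
        using that ok_state_Bud[OF _ c] by (auto simp: \<tau>_def)
    qed (use that dL in \<open>auto simp: hit_def\<close>)
  qed
  have nohit: "\<tau> i \<in> terms_sequent (concl (b i)) \<and> precursor (b i) (FVar x) (FVar x) \<and> \<tau> i = FVar x"
    if i: "m \<le> i" "\<not> hit i" for i
  proof -
    have \<tau>i: "\<tau> i = FVar x" using i by (simp add: \<tau>_def)
    show ?thesis
    proof (cases "\<sigma> i = (C, S)")
      case True
      then show ?thesis
        using C C_props \<tau>i by (auto simp: b is_Loop_def precursor_def intro: terms_self)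
    next
      case False
      then obtain L1 where L1: "snd (\<sigma> i) = L1 @ C # S" using inv i by blast
      obtain d L where dL: "\<sigma> i = (d, L)" by fastforce
      have okd: "ok_der \<Phi> (map comp_of L1 @ (x, w, s0) # map comp_of S) d"
        using okst[of i] dL L1 c by (simp add: ok_state_def)
      show ?thesis
      proof (cases d)
        case (Inf s rl ds)
        then have "ds \<noteq> []" using \<sigma>[of i] dL by auto
        then have "Pos (Lt (FVar x) (FVar w)) \<in> fst s" "\<And>\<theta>. rl = Sub \<theta> \<Longrightarrow> \<theta> x = FVar x"
          using okd Inf by (auto simp: tracks_def fixes_tracked_def elim!: ok_InfE)
        then show ?thesis
          using \<tau>i dL Inf by (auto simp: b precursor_def intro: terms_self split: rule_name.split)
      next
        case (Loop x' w' s d')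
        then have "Pos (Lt (FVar x) (FVar w)) \<in> fst s"
          using okd by (auto simp: tracks_def elim!: ok_LoopE)
        then show ?thesis
          using \<tau>i dL Loop by (auto simp: b precursor_def intro: terms_self)
      next
        \<comment> \<open>A back edge to a loop nested inside \<open>C\<close>. It fixes
          \<open>x\<close>, because \<open>C\<close> is among the loops enclosing its
          target.\<close>
        case (Bud s \<theta> j)
        from okst[of i] \<sigma>[of i] obtain La C' L2 where
          bud: "j = length La" "L = La @ C' # L2" "\<sigma> (Suc i) = (C', L2)"
          unfolding dL by (cases rule: succs_cases) (use Bud in \<open>auto simp: is_Bud_def\<close>)
        have "(C', L2) \<noteq> (C, S)" using i(2) Bud bud dL by (auto simp: hit_def is_Bud_def)
        then obtain Lb where Lb: "L2 = Lb @ C # S" using inv[of "Suc i"] bud i by auto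
        obtain x' w' s0' where c': "comp_of C' = (x', w', s0')" by (metis prod_cases3)
        have C': "is_Loop C'" "ok_state \<Phi> (C', L2)"
          using reach_inv[OF r[of i] ok] dL bud okst[of "Suc i"] by auto
        have s: "s = sub_seq \<theta> s0'" "fixes_tracked (map comp_of L2) \<theta>"
          using ok_state_Bud[OF _ c', of \<Phi> s \<theta> La L2] okst[of i] dL bud Bud by auto
        have \<theta>x: "\<theta> x = FVar x" using s(2) Lb c by (auto simp: fixes_tracked_def)
        have "Pos (Lt (FVar x) (FVar w)) \<in> fst s0'"
          using is_Loop_comp_of(3)[OF C'(2,1) c'] Lb c by (auto simp: tracks_def)
        then have "sub_fm \<theta> (Pos (Lt (FVar x) (FVar w))) \<in> fst s"
          unfolding s(1) sub_seq_def fst_conv by (rule imageI)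
        then show ?thesis
          using \<tau>i dL Bud \<theta>x by (auto simp: b precursor_def intro: terms_self)
      qed
    qed
  qed
  have hit: "\<tau> i \<in> terms_sequent (concl (b i)) \<and> precursor (b i) (\<tau> (Suc i)) (\<tau> i) \<and>
      Pos (Lt (\<tau> i) (FVar x)) \<in> fst (concl (b i))" if "hit i" for i
    using that
  proof (rule hitE)
    fix s \<theta> L1
    assume *: "\<sigma> i = (Bud s \<theta> (length L1), L1 @ C # S)" "s = sub_seq \<theta> s0" "lc_sub \<theta>" "\<theta> w = FVar x"
      "\<tau> i = \<theta> x"
    then have "\<not> hit (Suc i)" by (intro succ_hit) (simp add: is_Bud_def)
    then have "\<tau> (Suc i) = FVar x" by (simp add: \<tau>_def)
    moreover have "sub_fm \<theta> (Pos (Lt (FVar x) (FVar w))) \<in> fst s"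
      unfolding *(2) sub_seq_def fst_conv using C_props(2) by (rule imageI)
    ultimately show ?thesis
      using * by (auto simp: b precursor_def lc_sub_def intro: terms_self)
  qed
  \<comment> \<open>Progress is made on the step into the back edge, not on leaving it:
    \<open>x\<close> is its own precursor before, and the next trace term \<open>\<theta> x\<close>
    is below \<open>x\<close> by the atom just produced.\<close>
  have prog: "progresses b \<tau> i" if "m \<le> i" "\<not> hit i" "hit (Suc i)" for i
    using nohit[OF that(1,2)] hit[OF that(3)] by (auto simp: progresses_def)
  have "trace b m \<tau>"
    unfolding trace_def
  proof (intro allI impI conjI)
    fix i assume i: "m \<le> i"
    show "\<tau> i \<in> terms_sequent (concl (b i))" using nohit hit i by blast
    show "precursor (b i) (\<tau> (Suc i)) (\<tau> i) \<or> progresses b \<tau> i"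
    proof (cases "hit i \<or> hit (Suc i)")
      case True
      then show ?thesis using hit prog i by blast
    next
      case False
      then show ?thesis using nohit[of i] nohit[of "Suc i"] i by simp
    qed
  qed
  moreover have "\<exists>i\<ge>k. progresses b \<tau> i" if "k \<ge> m" for k
  proof -
    obtain j where j: "j \<ge> Suc k" "hit j" using ret[of "Suc k"] unfolding hit_def by blast
    then obtain i where i: "j = Suc i" by (cases j) auto
    have "\<not> hit i" using succ_hit[of i] j i by (auto simp: hit_def)
    then show ?thesis using prog[of i] j i that by (intro exI[of _ i]) auto
  qed
  ultimately show "\<exists>m \<tau>. trace b m \<tau> \<and> (\<forall>k\<ge>m. \<exists>i\<ge>k. progresses b \<tau> i)" by blast
qed

theorem cyclic_proof_unfold:
  assumes "ok_der \<Phi> [] d"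
  shows "\<exists>\<pi>. cyclic_proof \<pi> \<and> contains_only \<Phi> \<pi> \<and> concl \<pi> = dseq d"
  using infinity_proof_unfold[OF assms] regular_unfold[OF assms] contains_only_unfold[OF assms]
  by (intro exI[of _ "unfold_state (d, [])"]) (simp add: cyclic_proof_def)

section \<open>Derivability inside loops\<close>

text \<open>\<open>class_sub\<close> is an equivalence so that stripping universal quantifiers until
  the class is reached stops at the same depth before and after a substitution.\<close>

locale formula_class =
  fixes \<Phi> :: "fm set"
  assumes class_lc: "\<phi> \<in> \<Phi> \<Longrightarrow> lc_fm 0 \<phi>"
    and class_Pos: "lc_atom 0 a \<Longrightarrow> Pos a \<in> \<Phi>"
    and class_Neg: "lc_atom 0 a \<Longrightarrow> Neg a \<in> \<Phi>"
    and class_Conj: "Conj \<phi> \<psi> \<in> \<Phi> \<Longrightarrow> \<phi> \<in> \<Phi> \<and> \<psi> \<in> \<Phi>"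
    and class_Disj: "Disj \<phi> \<psi> \<in> \<Phi> \<Longrightarrow> \<phi> \<in> \<Phi> \<and> \<psi> \<in> \<Phi>"
    and class_Forall: "Forall \<phi> \<in> \<Phi> \<Longrightarrow> lc_tm 0 t \<Longrightarrow> inst \<phi> t \<in> \<Phi>"
    and class_Exists: "Exists \<phi> \<in> \<Phi> \<Longrightarrow> lc_tm 0 t \<Longrightarrow> inst \<phi> t \<in> \<Phi>"
    and class_sub: "lc_sub \<sigma> \<Longrightarrow> sub_fm \<sigma> \<phi> \<in> \<Phi> \<longleftrightarrow> \<phi> \<in> \<Phi>"
    and class_succ: "lc_tm 0 t \<Longrightarrow> Exists (Pos (Eq t (Succ (BVar 0)))) \<in> \<Phi>"
    and class_less:
      "lc_tm 0 t \<Longrightarrow> lc_tm 0 u \<Longrightarrow> Exists (Pos (Eq (Plus t (Succ (BVar 0))) u)) \<in> \<Phi>"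
begin

definition derives :: "companion list \<Rightarrow> fm set \<Rightarrow> fm set \<Rightarrow> bool" where
  "derives H \<Gamma> \<Delta> \<longleftrightarrow> (\<exists>d. ok_der \<Phi> H d \<and> dseq d = (\<Gamma>, \<Delta>))"

definition wf_ctx :: "companion list \<Rightarrow> fm set \<Rightarrow> fm set \<Rightarrow> bool" where
  "wf_ctx H \<Gamma> \<Delta> \<longleftrightarrow> finite \<Gamma> \<and> finite \<Delta> \<and> \<Gamma> \<subseteq> \<Phi> \<and> \<Delta> \<subseteq> \<Phi> \<and> tracks H \<Gamma>"

lemma wf_ctx_insL [simp]: "wf_ctx H \<Gamma> \<Delta> \<Longrightarrow> \<phi> \<in> \<Phi> \<Longrightarrow> wf_ctx H (insert \<phi> \<Gamma>) \<Delta>"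
  by (auto simp: wf_ctx_def tracks_def)

lemma wf_ctx_insR [simp]: "wf_ctx H \<Gamma> \<Delta> \<Longrightarrow> \<phi> \<in> \<Phi> \<Longrightarrow> wf_ctx H \<Gamma> (insert \<phi> \<Delta>)"
  by (auto simp: wf_ctx_def)

lemma wf_ctx_wf: "wf_ctx H \<Gamma> \<Delta> \<Longrightarrow> wf_sequent (\<Gamma>, \<Delta>)"
  using class_lc by (auto simp: wf_ctx_def wf_sequent_def)

lemma derives_step:
  assumes "wf_ctx H \<Gamma> \<Delta>" "step r ps (\<Gamma>, \<Delta>)" "\<And>\<Gamma>' \<Delta>'. (\<Gamma>', \<Delta>') \<in> set ps \<Longrightarrow> derives H \<Gamma>' \<Delta>'"
    "\<And>\<theta>. r = Sub \<theta> \<Longrightarrow> fixes_tracked H \<theta>"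
  shows "derives H \<Gamma> \<Delta>"
proof -
  have "\<forall>p\<in>set ps. \<exists>d. ok_der \<Phi> H d \<and> dseq d = p"
    using assms(3) by (auto simp: derives_def)
  then obtain f where f: "\<And>p. p \<in> set ps \<Longrightarrow> ok_der \<Phi> H (f p) \<and> dseq (f p) = p"
    by metis
  then have "map dseq (map f ps) = ps"
    by (simp add: map_idI)
  then have "ok_der \<Phi> H (Inf (\<Gamma>, \<Delta>) r (map f ps))"
    using assms f wf_ctx_wf[OF assms(1)] by (intro ok_Inf) (auto simp: wf_ctx_def)
  then show ?thesis
    by (auto simp: derives_def)
qed

lemma derives_weak:
  assumes "wf_ctx H \<Gamma>' \<Delta>'" "derives H \<Gamma> \<Delta>" "\<Gamma> \<subseteq> \<Gamma>'" "\<Delta> \<subseteq> \<Delta>'"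
  shows "derives H \<Gamma>' \<Delta>'"
  by (rule derives_step[OF assms(1), where r = Weak and ps = "[(\<Gamma>, \<Delta>)]"])
    (use assms in \<open>auto intro: step.intros\<close>)

text \<open>The leaf gets the bare sequent and is weakened afterwards. Leaves are exempt from
  tracking, so \<open>wf_ctx []\<close> is the right requirement for the bare sequent whatever
  \<open>H\<close> is.\<close>

lemma derives_leaf:
  assumes "wf_ctx H \<Gamma> \<Delta>" "step r [] (\<Gamma>0, \<Delta>0)" "\<Gamma>0 \<subseteq> \<Gamma>" "\<Delta>0 \<subseteq> \<Delta>"
  shows "derives H \<Gamma> \<Delta>"
proof -
  have "\<nexists>\<theta>. r = Sub \<theta>" using assms(2) by (auto elim: step.cases)
  moreover have "wf_ctx [] \<Gamma>0 \<Delta>0"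
    using assms by (auto simp: wf_ctx_def tracks_def intro: finite_subset)
  ultimately have "ok_der \<Phi> H (Inf (\<Gamma>0, \<Delta>0) r [])"
    using assms(2) wf_ctx_wf by (intro ok_Inf) (auto simp: wf_ctx_def)
  then have "derives H \<Gamma>0 \<Delta>0" by (auto simp: derives_def)
  then show ?thesis using derives_weak assms by blast
qed

lemma derives_Q:
  assumes "wf_ctx H \<Gamma> \<Delta>" "Q_initial (\<Gamma>0, \<Delta>0)" "\<Gamma>0 \<subseteq> \<Gamma>" "\<Delta>0 \<subseteq> \<Delta>"
  shows "derives H \<Gamma> \<Delta>"
proof -
  have "wf_ctx [] \<Gamma>0 \<Delta>0"
    using assms by (auto simp: wf_ctx_def tracks_def intro: finite_subset)
  then have "ok_der \<Phi> H (Inf (\<Gamma>0, \<Delta>0) QInit [])"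
    using assms(2) wf_ctx_wf by (intro ok_Inf) (auto simp: wf_ctx_def)
  then have "derives H \<Gamma>0 \<Delta>0" by (auto simp: derives_def)
  then show ?thesis using derives_weak assms by blast
qed

lemma derives_ident: "wf_ctx H \<Gamma> \<Delta> \<Longrightarrow> \<phi> \<in> \<Gamma> \<Longrightarrow> \<phi> \<in> \<Delta> \<Longrightarrow> derives H \<Gamma> \<Delta>"
  by (rule derives_leaf[OF _ step.intros(1)[of \<phi>]]) auto

lemma derives_cut:
  assumes "wf_ctx H \<Gamma> \<Delta>" "derives H \<Gamma> (insert \<phi> \<Delta>)" "derives H (insert \<phi> \<Gamma>) \<Delta>"
  shows "derives H \<Gamma> \<Delta>"
  by (rule derives_step[OF assms(1) step.intros(7)]) (use assms in auto)

lemma derives_step':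
  assumes "wf_ctx H \<Gamma> \<Delta>" "step r ps (\<Gamma>0, \<Delta>0)" "\<Gamma>0 = \<Gamma>" "\<Delta>0 = \<Delta>"
    "list_all (\<lambda>p. derives H (fst p) (snd p)) ps" "\<And>\<theta>. r \<noteq> Sub \<theta>"
  shows "derives H \<Gamma> \<Delta>"
  by (rule derives_step[OF assms(1)]) (use assms in \<open>auto simp: list_all_iff\<close>)

lemma derives_conjL:
  assumes "wf_ctx H \<Gamma> \<Delta>" "Conj \<phi> \<psi> \<in> \<Gamma>" "derives H (insert \<phi> (insert \<psi> \<Gamma>)) \<Delta>"
  shows "derives H \<Gamma> \<Delta>"
  by (rule derives_step'[OF assms(1) step.intros(8)[of \<phi> \<psi> \<Gamma> \<Delta>]])
    (use assms in \<open>auto simp: insert_absorb\<close>)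

lemma derives_conjR:
  assumes "wf_ctx H \<Gamma> \<Delta>" "Conj \<phi> \<psi> \<in> \<Delta>" "derives H \<Gamma> (insert \<phi> \<Delta>)" "derives H \<Gamma> (insert \<psi> \<Delta>)"
  shows "derives H \<Gamma> \<Delta>"
  by (rule derives_step'[OF assms(1) step.intros(9)[of \<Gamma> \<phi> \<Delta> \<psi>]])
    (use assms in \<open>auto simp: insert_absorb\<close>)

lemma derives_disjL:
  assumes "wf_ctx H \<Gamma> \<Delta>" "Disj \<phi> \<psi> \<in> \<Gamma>" "derives H (insert \<phi> \<Gamma>) \<Delta>" "derives H (insert \<psi> \<Gamma>) \<Delta>"
  shows "derives H \<Gamma> \<Delta>"
  by (rule derives_step'[OF assms(1) step.intros(10)[of \<phi> \<Gamma> \<Delta> \<psi>]])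
    (use assms in \<open>auto simp: insert_absorb\<close>)

lemma derives_disjR:
  assumes "wf_ctx H \<Gamma> \<Delta>" "Disj \<phi> \<psi> \<in> \<Delta>" "derives H \<Gamma> (insert \<phi> (insert \<psi> \<Delta>))"
  shows "derives H \<Gamma> \<Delta>"
  by (rule derives_step'[OF assms(1) step.intros(11)[of \<Gamma> \<phi> \<psi> \<Delta>]])
    (use assms in \<open>auto simp: insert_absorb\<close>)

lemma derives_forallL:
  assumes "wf_ctx H \<Gamma> \<Delta>" "Forall \<phi> \<in> \<Gamma>" "lc_tm 0 t" "derives H (insert (inst \<phi> t) \<Gamma>) \<Delta>"
  shows "derives H \<Gamma> \<Delta>"
  by (rule derives_step'[OF assms(1) step.intros(12)[of t \<phi> \<Gamma> \<Delta>, OF assms(3)]])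
    (use assms in \<open>auto simp: insert_absorb\<close>)

lemma derives_forallR:
  assumes "wf_ctx H \<Gamma> \<Delta>" "Forall \<phi> \<in> \<Delta>" "a \<notin> fv_sequent (\<Gamma>, \<Delta>)" "derives H \<Gamma> (insert (inst \<phi> (FVar a)) \<Delta>)"
  shows "derives H \<Gamma> \<Delta>"
  by (rule derives_step'[OF assms(1) step.intros(13)[of a \<Gamma> \<phi> \<Delta>]])
    (use assms in \<open>auto simp: insert_absorb\<close>)

lemma derives_existsL:
  assumes "wf_ctx H \<Gamma> \<Delta>" "Exists \<phi> \<in> \<Gamma>" "a \<notin> fv_sequent (\<Gamma>, \<Delta>)" "derives H (insert (inst \<phi> (FVar a)) \<Gamma>) \<Delta>"
  shows "derives H \<Gamma> \<Delta>"
  by (rule derives_step'[OF assms(1) step.intros(14)[of a \<phi> \<Gamma> \<Delta>]])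
    (use assms in \<open>auto simp: insert_absorb\<close>)

lemma derives_existsR:
  assumes "wf_ctx H \<Gamma> \<Delta>" "Exists \<phi> \<in> \<Delta>" "lc_tm 0 t" "derives H \<Gamma> (insert (inst \<phi> t) \<Delta>)"
  shows "derives H \<Gamma> \<Delta>"
  by (rule derives_step'[OF assms(1) step.intros(15)[of t \<Gamma> \<phi> \<Delta>, OF assms(3)]])
    (use assms in \<open>auto simp: insert_absorb\<close>)

lemma derives_sub:
  assumes "wf_ctx H (sub_fm \<theta> ` \<Gamma>) (sub_fm \<theta> ` \<Delta>)" "lc_sub \<theta>" "fixes_tracked H \<theta>" "derives H \<Gamma> \<Delta>"
  shows "derives H (sub_fm \<theta> ` \<Gamma>) (sub_fm \<theta> ` \<Delta>)"
  by (rule derives_step[OF assms(1) step.intros(16)]) (use assms in \<open>auto simp: lc_sub_def\<close>)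

text \<open>The back edge itself has exactly the substituted sequent of its companion. The surplus
  of \<open>\<Gamma>\<close> and \<open>\<Delta>\<close>, including the atoms of inner loops, is
  absorbed by a weakening.\<close>

lemma derives_bud:
  assumes "wf_ctx (H1 @ (x, w, (\<Gamma>0, \<Delta>0)) # H2) \<Gamma> \<Delta>" "lc_sub \<theta>" "\<theta> w = FVar x" "fixes_tracked H2 \<theta>"
    "sub_fm \<theta> ` \<Gamma>0 \<subseteq> \<Gamma>" "sub_fm \<theta> ` \<Delta>0 \<subseteq> \<Delta>"
  shows "derives (H1 @ (x, w, (\<Gamma>0, \<Delta>0)) # H2) \<Gamma> \<Delta>"
proof -
  have "wf_ctx [] (sub_fm \<theta> ` \<Gamma>0) (sub_fm \<theta> ` \<Delta>0)"
    using assms by (auto simp: wf_ctx_def tracks_def intro: finite_subset)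
  then have "ok_der \<Phi> (H1 @ (x, w, (\<Gamma>0, \<Delta>0)) # H2)
      (Bud (sub_fm \<theta> ` \<Gamma>0, sub_fm \<theta> ` \<Delta>0) \<theta> (length H1))"
    using assms wf_ctx_wf by (intro ok_Bud) (auto simp: wf_ctx_def sub_seq_def)
  then have "derives (H1 @ (x, w, (\<Gamma>0, \<Delta>0)) # H2) (sub_fm \<theta> ` \<Gamma>0) (sub_fm \<theta> ` \<Delta>0)"
    by (auto simp: derives_def)
  then show ?thesis using derives_weak assms by blast
qed

lemma derives_loop:
  assumes "wf_ctx ((x, w, (\<Gamma>, \<Delta>)) # H) \<Gamma> \<Delta>" "derives ((x, w, (\<Gamma>, \<Delta>)) # H) \<Gamma> \<Delta>"
  shows "derives H \<Gamma> \<Delta>"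
proof -
  obtain d where "ok_der \<Phi> ((x, w, (\<Gamma>, \<Delta>)) # H) d" "dseq d = (\<Gamma>, \<Delta>)"
    using assms(2) by (auto simp: derives_def)
  then have "ok_der \<Phi> H (Loop x w (\<Gamma>, \<Delta>) d)"
    using assms(1) wf_ctx_wf by (intro ok_Loop) (auto simp: wf_ctx_def)
  then show ?thesis by (auto simp: derives_def)
qed

section \<open>Equality and elementary arithmetic inside derivations\<close>

lemma derives_negL: "wf_ctx H \<Gamma> \<Delta> \<Longrightarrow> Pos a \<in> \<Gamma> \<Longrightarrow> Neg a \<in> \<Gamma> \<Longrightarrow> derives H \<Gamma> \<Delta>"
  by (rule derives_leaf[OF _ step.intros(4)[of a]]) auto

lemma derives_negR: "wf_ctx H \<Gamma> \<Delta> \<Longrightarrow> Pos a \<in> \<Delta> \<Longrightarrow> Neg a \<in> \<Delta> \<Longrightarrow> derives H \<Gamma> \<Delta>"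
  by (rule derives_leaf[OF _ step.intros(5)[of a]]) auto

lemma derives_refl: "wf_ctx H \<Gamma> \<Delta> \<Longrightarrow> Pos (Eq t t) \<in> \<Delta> \<Longrightarrow> derives H \<Gamma> \<Delta>"
  by (rule derives_leaf[OF _ step.intros(2)[of t]]) auto

lemma derives_subst:
  "wf_ctx H \<Gamma> \<Delta> \<Longrightarrow> Pos (Eq t u) \<in> \<Gamma> \<Longrightarrow> subst1 v t \<phi> \<in> \<Gamma> \<Longrightarrow> subst1 v u \<phi> \<in> \<Delta> \<Longrightarrow> derives H \<Gamma> \<Delta>"
  by (rule derives_leaf[OF _ step.intros(3)[of t u v \<phi>]]) auto

lemma class_lc_eq: "Pos (Eq t u) \<in> \<Phi> \<Longrightarrow> lc_tm 0 t \<and> lc_tm 0 u"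
  using class_lc by fastforce

lemma derives_sym:
  assumes "wf_ctx H \<Gamma> \<Delta>" "Pos (Eq t u) \<in> \<Gamma>" "derives H (insert (Pos (Eq u t)) \<Gamma>) \<Delta>"
  shows "derives H \<Gamma> \<Delta>"
proof -
  have lc: "lc_tm 0 t" "lc_tm 0 u"
    using assms(1,2) class_lc_eq by (auto simp: wf_ctx_def)
  then have \<Phi>: "Pos (Eq u t) \<in> \<Phi>" "Pos (Eq t t) \<in> \<Phi>" by (auto intro: class_Pos)
  obtain v where v: "v \<notin> fv_tm t" using fresh_var finite_fv_tm by blast
  have s: "subst1 v r (Pos (Eq (FVar v) t)) = Pos (Eq r t)" for r
    using v by (auto simp: subst1_def intro!: sub_tm_id)
  have "derives H (insert (Pos (Eq t t)) \<Gamma>) (insert (Pos (Eq u t)) \<Delta>)"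
    using assms \<Phi> s[of t] s[of u] by - (rule derives_subst[of _ _ _ t u v "Pos (Eq (FVar v) t)"], auto)
  moreover have "derives H \<Gamma> (insert (Pos (Eq t t)) (insert (Pos (Eq u t)) \<Delta>))"
    using assms \<Phi> by - (rule derives_refl[of _ _ _ t], auto)
  ultimately have "derives H \<Gamma> (insert (Pos (Eq u t)) \<Delta>)"
    using assms \<Phi> by - (rule derives_cut[of H \<Gamma> _ "Pos (Eq t t)"], auto)
  then show ?thesis
    using assms by - (rule derives_cut[of H \<Gamma> \<Delta> "Pos (Eq u t)"])
qed

text \<open>Replaces the goal at \<open>u\<close> by the goal at \<open>t\<close>. The equality rule
  transports in the direction from \<open>t\<close> to \<open>u\<close>, so the equation is reversed
  first.\<close>

lemma derives_rewrite:
  assumes "wf_ctx H \<Gamma> \<Delta>" "Pos (Eq u t) \<in> \<Gamma>" "subst1 v u \<phi> \<in> \<Delta>" "derives H \<Gamma> (insert (subst1 v t \<phi>) \<Delta>)"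
  shows "derives H \<Gamma> \<Delta>"
proof -
  have lc: "lc_tm 0 t" "lc_tm 0 u"
    using assms(1,2) class_lc_eq by (auto simp: wf_ctx_def)
  have "subst1 v u \<phi> \<in> \<Phi>" using assms by (auto simp: wf_ctx_def)
  then have \<Phi>: "subst1 v t \<phi> \<in> \<Phi>" "Pos (Eq t u) \<in> \<Phi>"
    using lc by (auto simp: subst1_def class_sub lc_sub_upd intro: class_Pos)
  have "derives H (insert (subst1 v t \<phi>) \<Gamma>) \<Delta>"
    by (rule derives_sym[of _ _ _ u t]) (use assms \<Phi> in \<open>auto intro: derives_subst[of _ _ _ t u v \<phi>]\<close>)
  then show ?thesis
    using assms by - (rule derives_cut[of H \<Gamma> \<Delta> "subst1 v t \<phi>"])
qed

lemma finite_fv_sequent: "finite \<Gamma> \<Longrightarrow> finite \<Delta> \<Longrightarrow> finite (fv_sequent (\<Gamma>, \<Delta>))"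
  by (simp add: fv_sequent_def)

lemma inst_succ: "lc_tm 0 t \<Longrightarrow> inst (Pos (Eq t (Succ (BVar 0)))) u = Pos (Eq t (Succ u))"
  by (simp add: inst_def open_tm_lc)

lemma inst_less:
  "lc_tm 0 t \<Longrightarrow> lc_tm 0 u \<Longrightarrow>
    inst (Pos (Eq (Plus t (Succ (BVar 0))) u)) v = Pos (Eq (Plus t (Succ v)) u)"
  by (simp add: inst_def open_tm_lc)

text \<open>The initial sequent for predecessors has a negated equation as its hypothesis; a cut on
  that literal turns it into the case distinction.\<close>

lemma derives_nat_cases:
  assumes "wf_ctx H \<Gamma> \<Delta>" "lc_tm 0 t" "y \<notin> fv_sequent (\<Gamma>, \<Delta>)" "y \<notin> fv_tm t"
    "derives H (insert (Pos (Eq t Zero)) \<Gamma>) \<Delta>" "derives H (insert (Pos (Eq t (Succ (FVar y)))) \<Gamma>) \<Delta>"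
  shows "derives H \<Gamma> \<Delta>"
proof -
  let ?ex = "Exists (Pos (Eq t (Succ (BVar 0))))"
  have \<Phi>: "?ex \<in> \<Phi>" "Pos (Eq t Zero) \<in> \<Phi>" "Neg (Eq t Zero) \<in> \<Phi>" "Pos (Eq t (Succ (FVar y))) \<in> \<Phi>"
    using assms(2) by (auto intro: class_succ class_Pos class_Neg)
  have "derives H (insert (Neg (Eq t Zero)) \<Gamma>) (insert (Pos (Eq t Zero)) (insert ?ex \<Delta>))"
    using assms \<Phi> by - (rule derives_Q[OF _ Q_initial.intros(3)[of t]], auto)
  then have "derives H \<Gamma> (insert (Pos (Eq t Zero)) (insert ?ex \<Delta>))"
    using assms \<Phi> by - (rule derives_cut[OF _ derives_negR[of _ _ _ "Eq t Zero"]], auto)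
  moreover have "derives H (insert (Pos (Eq t Zero)) \<Gamma>) (insert ?ex \<Delta>)"
    by (rule derives_weak[OF _ assms(5)]) (use assms \<Phi> in auto)
  ultimately have "derives H \<Gamma> (insert ?ex \<Delta>)"
    using assms \<Phi> by - (rule derives_cut[of H \<Gamma> _ "Pos (Eq t Zero)"], auto)
  moreover have "derives H (insert ?ex \<Gamma>) \<Delta>"
  proof (rule derives_existsL[where a = y])
    show "derives H (insert (inst (Pos (Eq t (Succ (BVar 0)))) (FVar y)) (insert ?ex \<Gamma>)) \<Delta>"
      unfolding inst_succ[OF assms(2)] by (rule derives_weak[OF _ assms(6)]) (use assms \<Phi> in auto)
  qed (use assms \<Phi> in \<open>auto simp: fv_sequent_def\<close>)
  ultimately show ?thesis using assms by - (rule derives_cut[of H \<Gamma> \<Delta> ?ex])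
qed

lemma derives_axiom:
  assumes "wf_ctx H \<Gamma> \<Delta>" "Q_initial ({}, {\<phi>})" "\<phi> \<in> \<Phi>" "derives H (insert \<phi> \<Gamma>) \<Delta>"
  shows "derives H \<Gamma> \<Delta>"
  by (rule derives_cut[OF assms(1) derives_Q[OF _ assms(2)] assms(4)]) (use assms in auto)

text \<open>The witness for \<open><\<close> is \<open>Zero\<close>:
  \<open>t + s 0 = s (t + 0) = s t\<close> follows from the recursion equations alone.\<close>

lemma derives_less_succ:
  assumes "wf_ctx H \<Gamma> \<Delta>" "lc_tm 0 t" "Pos (Lt t (Succ t)) \<in> \<Delta>"
  shows "derives H \<Gamma> \<Delta>"
proof -
  let ?B = "Pos (Eq (Plus t (Succ (BVar 0))) (Succ t))"
  let ?e1 = "Pos (Eq (Plus t (Succ Zero)) (Succ (Plus t Zero)))"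
  let ?e2 = "Pos (Eq (Plus t Zero) t)"
  let ?e3 = "Pos (Eq (Plus t (Succ Zero)) (Succ t))"
  have \<Phi>: "Exists ?B \<in> \<Phi>" "?e1 \<in> \<Phi>" "?e2 \<in> \<Phi>" "?e3 \<in> \<Phi>"
    using assms(2) by (auto intro!: class_less class_Pos)
  obtain v where v: "v \<notin> fv_tm t" using fresh_var finite_fv_tm by blast
  have s: "subst1 v r (Pos (Eq (Plus t (Succ Zero)) (Succ (FVar v)))) =
      Pos (Eq (Plus t (Succ Zero)) (Succ r))" for r
    using v by (auto simp: subst1_def intro!: sub_tm_id)
  have "derives H (insert ?e2 (insert ?e1 \<Gamma>)) (insert ?e3 (insert (Exists ?B) \<Delta>))"
    using assms \<Phi> s[of "Plus t Zero"] s[of t]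
    by - (rule derives_subst[of _ _ _ "Plus t Zero" t v "Pos (Eq (Plus t (Succ Zero)) (Succ (FVar v)))"], auto)
  then have "derives H (insert ?e1 \<Gamma>) (insert ?e3 (insert (Exists ?B) \<Delta>))"
    using assms \<Phi> Q_initial.intros(4) by - (rule derives_axiom[of _ "insert ?e1 \<Gamma>" _ ?e2], auto)
  then have "derives H \<Gamma> (insert ?e3 (insert (Exists ?B) \<Delta>))"
    using assms \<Phi> Q_initial.intros(5) by - (rule derives_axiom[of _ "\<Gamma>" _ ?e1], auto)
  then have "derives H \<Gamma> (insert (Exists ?B) \<Delta>)"
    using assms \<Phi> by - (rule derives_existsR[of H \<Gamma> _ ?B Zero], auto simp: inst_less)
  moreover have "derives H (insert (Exists ?B) \<Gamma>) \<Delta>"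
    using assms \<Phi> by - (rule derives_Q[OF _ Q_initial.intros(9)[of t "Succ t"]], auto)
  ultimately show ?thesis using assms by - (rule derives_cut[of H \<Gamma> \<Delta> "Exists ?B"])
qed

text \<open>Produces the atom that a back edge from \<open>x\<close> to its predecessor
  \<open>y\<close> needs in order to progress.\<close>

lemma derives_pred_less:
  assumes "wf_ctx H \<Gamma> \<Delta>" "Pos (Eq (FVar x) (Succ (FVar y))) \<in> \<Gamma>"
    "derives H (insert (Pos (Lt (FVar y) (FVar x))) \<Gamma>) \<Delta>"
  shows "derives H \<Gamma> \<Delta>"
proof -
  let ?l = "Pos (Lt (FVar y) (FVar x))"
  have \<Phi>: "?l \<in> \<Phi>" "Pos (Lt (FVar y) (Succ (FVar y))) \<in> \<Phi>" by (auto intro: class_Pos)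
  have s: "subst1 (Suc y) r (Pos (Lt (FVar y) (FVar (Suc y)))) = Pos (Lt (FVar y) r)" for r
    by (simp add: subst1_def)
  have "derives H \<Gamma> (insert ?l \<Delta>)"
  proof (rule derives_rewrite[of _ _ _ "FVar x" "Succ (FVar y)"])
    show "subst1 (Suc y) (FVar x) (Pos (Lt (FVar y) (FVar (Suc y)))) \<in> insert ?l \<Delta>"
      unfolding s by simp
    show "derives H \<Gamma> (insert (subst1 (Suc y) (Succ (FVar y)) (Pos (Lt (FVar y) (FVar (Suc y))))) (insert ?l \<Delta>))"
      unfolding s using assms \<Phi> by - (rule derives_less_succ[of _ _ _ "FVar y"], auto)
  qed (use assms \<Phi> in auto)
  then show ?thesis using assms by - (rule derives_cut[of H \<Gamma> \<Delta> ?l])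
qed

section \<open>A sequent relation for universal formulae over the class\<close>

text \<open>The quantifier clause ranges over all instances, not over a body with a dangling index:
  the class is a class of locally closed formulae, and the induction hypothesis is wanted at
  arbitrary terms.\<close>

inductive universal :: "fm \<Rightarrow> bool" where
  universal_class: "\<phi> \<in> \<Phi> \<Longrightarrow> universal \<phi>"
| universal_Forall: "(\<And>t. lc_tm 0 t \<Longrightarrow> universal (inst \<phi> t)) \<Longrightarrow> universal (Forall \<phi>)"

text \<open>Stripping stops as soon as the class is reached. A class formula is its own only
  instance, even if it begins with a universal quantifier, and every instance may occur in a cyclic
  proof.\<close>

inductive instance_of :: "fm \<Rightarrow> fm \<Rightarrow> bool" where
  instance_of_class: "\<phi> \<in> \<Phi> \<Longrightarrow> instance_of \<phi> \<phi>"
| instance_of_Forall: "Forall \<phi> \<notin> \<Phi> \<Longrightarrow> lc_tm 0 t \<Longrightarrow> instance_of (inst \<phi> t) \<psi> \<Longrightarrow> instance_of (Forall \<phi>) \<psi>"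

lemma universal_lc: "universal \<phi> \<Longrightarrow> lc_fm 0 \<phi>"
proof (induction rule: universal.induct)
  case (universal_Forall \<phi>)
  from universal_Forall.IH[of Zero] show ?case by (simp add: lc_inst)
qed (use class_lc in auto)

lemma universal_sub: "universal \<phi> \<Longrightarrow> lc_sub \<sigma> \<Longrightarrow> universal (sub_fm \<sigma> \<phi>)"
proof (induction arbitrary: \<sigma> rule: universal.induct)
  case (universal_class \<phi>)
  then show ?case by (simp add: universal.universal_class class_sub)
next
  case (universal_Forall \<phi>)
  obtain b where b: "b \<notin> fv_fm \<phi>" using fresh_var finite_fv_fm by blast
  have "universal (inst (sub_fm \<sigma> \<phi>) t)" if "lc_tm 0 t" for t
    unfolding inst_sub[OF universal_Forall.prems that b]
    by (rule universal_Forall.IH[OF _ lc_sub_upd[OF universal_Forall.prems that]]) simp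
  then show ?case by (simp add: universal.universal_Forall)
qed

lemma universal_Forall_inst: "universal (Forall \<phi>) \<Longrightarrow> lc_tm 0 t \<Longrightarrow> universal (inst \<phi> t)"
  by (erule universal.cases) (auto intro: universal_class class_Forall)

inductive_cases instance_of_ForallE: "instance_of (Forall \<phi>) \<psi>"

lemma instance_of_in_class: "instance_of P \<psi> \<Longrightarrow> \<psi> \<in> \<Phi>"
  by (induction rule: instance_of.induct) auto

lemma instance_of_class_iff: "P \<in> \<Phi> \<Longrightarrow> instance_of P \<psi> \<longleftrightarrow> \<psi> = P"
  by (rule iffI, erule instance_of.cases) (auto intro: instance_of_class)

lemma instance_of_Forall_iff:
  "Forall \<phi> \<notin> \<Phi> \<Longrightarrow> instance_of (Forall \<phi>) \<psi> \<longleftrightarrow> (\<exists>t. lc_tm 0 t \<and> instance_of (inst \<phi> t) \<psi>)"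
  by (auto intro: instance_of_Forall elim!: instance_of_ForallE)

lemma instance_of_sub: "instance_of P \<psi> \<Longrightarrow> lc_sub \<sigma> \<Longrightarrow> instance_of (sub_fm \<sigma> P) (sub_fm \<sigma> \<psi>)"
proof (induction rule: instance_of.induct)
  case (instance_of_class \<phi>)
  then show ?case by (simp add: instance_of.instance_of_class class_sub)
next
  case (instance_of_Forall \<phi> t \<psi>)
  then have "Forall (sub_fm \<sigma> \<phi>) \<notin> \<Phi>" using class_sub[of \<sigma> "Forall \<phi>"] by simp
  then show ?case
    using instance_of_Forall instance_of.instance_of_Forall[of "sub_fm \<sigma> \<phi>" "sub_tm \<sigma> t"] by (simp add: sub_inst lc_sub_tm)
qed

text \<open>Opening all quantifiers with fresh variables yields an instance from which every instance of
  every substitution instance arises by substitution; it is the succedent of the companions below.\<close>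

lemma generic_instance:
  assumes "universal P" "finite W" "fv_fm P \<subseteq> W"
  shows "\<exists>\<psi>0. instance_of P \<psi>0 \<and> (\<forall>\<sigma> \<psi>. lc_sub \<sigma> \<longrightarrow> instance_of (sub_fm \<sigma> P) \<psi> \<longrightarrow>
    (\<exists>\<sigma>'. lc_sub \<sigma>' \<and> (\<forall>z\<in>W. \<sigma>' z = \<sigma> z) \<and> \<psi> = sub_fm \<sigma>' \<psi>0))"
proof -
  have small: "\<exists>\<psi>0. instance_of P \<psi>0 \<and> (\<forall>\<sigma> \<psi>. lc_sub \<sigma> \<longrightarrow> instance_of (sub_fm \<sigma> P) \<psi> \<longrightarrow>
      (\<exists>\<sigma>'. lc_sub \<sigma>' \<and> (\<forall>z\<in>W. \<sigma>' z = \<sigma> z) \<and> \<psi> = sub_fm \<sigma>' \<psi>0))" if "P \<in> \<Phi>" for P and W :: "nat set"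
  proof (intro exI[of _ P] conjI allI impI)
    show "instance_of P P" using that by (rule instance_of_class)
    fix \<sigma> \<psi> assume \<sigma>: "lc_sub \<sigma>" "instance_of (sub_fm \<sigma> P) \<psi>"
    then have "\<psi> = sub_fm \<sigma> P" using that by (simp add: instance_of_class_iff class_sub)
    then show "\<exists>\<sigma>'. lc_sub \<sigma>' \<and> (\<forall>z\<in>W. \<sigma>' z = \<sigma> z) \<and> \<psi> = sub_fm \<sigma>' P" using \<sigma> by blast
  qed
  show ?thesis
    using assms
  proof (induction arbitrary: W rule: universal.induct)
    case (universal_class \<phi>)
    show ?case by (rule small[OF universal_class(1)])
  next
    case (universal_Forall \<phi>)
    show ?case
    proof (cases "Forall \<phi> \<in> \<Phi>")
      case True
      then show ?thesis by (rule small)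
    next
      case False
      obtain b where b: "b \<notin> W" using fresh_var universal_Forall.prems by blast
      have "fv_fm (inst \<phi> (FVar b)) \<subseteq> insert b W"
        using fv_inst(2)[of \<phi> "FVar b"] universal_Forall.prems by auto
      moreover have "lc_tm 0 (FVar b)" "finite (insert b W)" using universal_Forall.prems by simp_all
      ultimately obtain \<psi>0 where \<psi>0: "instance_of (inst \<phi> (FVar b)) \<psi>0"
        "\<forall>\<sigma> \<psi>. lc_sub \<sigma> \<longrightarrow> instance_of (sub_fm \<sigma> (inst \<phi> (FVar b))) \<psi> \<longrightarrow>
           (\<exists>\<sigma>'. lc_sub \<sigma>' \<and> (\<forall>z\<in>insert b W. \<sigma>' z = \<sigma> z) \<and> \<psi> = sub_fm \<sigma>' \<psi>0)"
        using universal_Forall.IH[of "FVar b" "insert b W"] by blast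
      show ?thesis
      proof (intro exI[of _ \<psi>0] conjI allI impI)
        show "instance_of (Forall \<phi>) \<psi>0" using instance_of_Forall[OF False _ \<psi>0(1)] by simp
        fix \<sigma> \<psi> assume \<sigma>: "lc_sub \<sigma>" "instance_of (sub_fm \<sigma> (Forall \<phi>)) \<psi>"
        then have "Forall (sub_fm \<sigma> \<phi>) \<notin> \<Phi>" using class_sub[of \<sigma> "Forall \<phi>"] False by simp
        then obtain t where t: "lc_tm 0 t" "instance_of (inst (sub_fm \<sigma> \<phi>) t) \<psi>"
          using \<sigma> by (auto simp: instance_of_Forall_iff)
        have "b \<notin> fv_fm \<phi>" using b universal_Forall.prems by auto
        then have "instance_of (sub_fm (\<sigma>(b := t)) (inst \<phi> (FVar b))) \<psi>"
          using t \<sigma> by (simp add: inst_sub)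
        \<comment> \<open>The witness \<open>t\<close> of the outermost quantifier becomes the value
          at \<open>b\<close>. As \<open>b\<close> has joined the set of protected variables, the
          substitution found for the remaining quantifiers keeps this value.\<close>
        then obtain \<sigma>' where \<sigma>': "lc_sub \<sigma>'" "\<forall>z\<in>insert b W. \<sigma>' z = (\<sigma>(b := t)) z" "\<psi> = sub_fm \<sigma>' \<psi>0"
          using \<psi>0(2) lc_sub_upd[OF \<sigma>(1) t(1)] by blast
        then show "\<exists>\<sigma>'. lc_sub \<sigma>' \<and> (\<forall>z\<in>W. \<sigma>' z = \<sigma> z) \<and> \<psi> = sub_fm \<sigma>' \<psi>0"
          using b by (intro exI[of _ \<sigma>']) auto
      qed
    qed
  qed
qed

text \<open>A Kripke-style reading of sequents of universal formulae: the formulae on the left are forced,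
  i.e. their instances are derivable in every extension of the context, possibly under additional
  loops, and the context is required to contain an instance of each formula on the right.\<close>

definition forced :: "companion list \<Rightarrow> fm set \<Rightarrow> fm set \<Rightarrow> fm \<Rightarrow> bool" where
  "forced H \<Gamma> \<Delta> P \<longleftrightarrow> (\<forall>H1 \<Gamma>' \<Delta>'. \<Gamma> \<subseteq> \<Gamma>' \<longrightarrow> \<Delta> \<subseteq> \<Delta>' \<longrightarrow> wf_ctx (H1 @ H) \<Gamma>' \<Delta>' \<longrightarrow>
    (\<forall>\<psi>. instance_of P \<psi> \<longrightarrow> derives (H1 @ H) \<Gamma>' (insert \<psi> \<Delta>')))"

definition hits :: "fm set \<Rightarrow> fm \<Rightarrow> bool" where
  "hits \<Delta> P \<longleftrightarrow> (\<exists>\<psi>. instance_of P \<psi> \<and> \<psi> \<in> \<Delta>)"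

text \<open>Quantifying over \<open>\<theta>\<close> makes the free variables of a sequent
  schematic: an eigenvariable can be sent to any term, and the induction step can be used at a fresh
  predecessor.\<close>

definition entails :: "fm set \<Rightarrow> fm set \<Rightarrow> bool" where
  "entails \<Gamma> \<Delta> \<longleftrightarrow> (\<forall>H \<Gamma>' \<Delta>' \<theta>. wf_ctx H \<Gamma>' \<Delta>' \<longrightarrow> lc_sub \<theta> \<longrightarrow>
    (\<forall>P\<in>\<Gamma>. forced H \<Gamma>' \<Delta>' (sub_fm \<theta> P)) \<longrightarrow> (\<forall>P\<in>\<Delta>. hits \<Delta>' (sub_fm \<theta> P)) \<longrightarrow> derives H \<Gamma>' \<Delta>')"

section \<open>Structural and witnessing rules for the sequent relation\<close>

lemma entailsI:
  assumes "\<And>H \<Gamma>' \<Delta>' \<theta>. wf_ctx H \<Gamma>' \<Delta>' \<Longrightarrow> lc_sub \<theta> \<Longrightarrow>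
    (\<And>P. P \<in> \<Gamma> \<Longrightarrow> forced H \<Gamma>' \<Delta>' (sub_fm \<theta> P)) \<Longrightarrow> (\<And>P. P \<in> \<Delta> \<Longrightarrow> hits \<Delta>' (sub_fm \<theta> P)) \<Longrightarrow> derives H \<Gamma>' \<Delta>'"
  shows "entails \<Gamma> \<Delta>"
  using assms unfolding entails_def by blast

lemma entailsD:
  assumes "entails \<Gamma> \<Delta>" "wf_ctx H \<Gamma>' \<Delta>'" "lc_sub \<theta>" "\<And>P. P \<in> \<Gamma> \<Longrightarrow> forced H \<Gamma>' \<Delta>' (sub_fm \<theta> P)"
    "\<And>P. P \<in> \<Delta> \<Longrightarrow> hits \<Delta>' (sub_fm \<theta> P)"
  shows "derives H \<Gamma>' \<Delta>'"
  using assms unfolding entails_def by blast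

lemma forcedD: "forced H \<Gamma> \<Delta> P \<Longrightarrow> wf_ctx H \<Gamma> \<Delta> \<Longrightarrow> instance_of P \<psi> \<Longrightarrow> derives H \<Gamma> (insert \<psi> \<Delta>)"
  unfolding forced_def by (metis append_Nil order_refl)

lemma forced_mono: "forced H \<Gamma> \<Delta> P \<Longrightarrow> \<Gamma> \<subseteq> \<Gamma>' \<Longrightarrow> \<Delta> \<subseteq> \<Delta>' \<Longrightarrow> forced (H1 @ H) \<Gamma>' \<Delta>' P"
  unfolding forced_def by (metis append_assoc order_trans)

lemma forced_mono': "forced H \<Gamma> \<Delta> P \<Longrightarrow> \<Gamma> \<subseteq> \<Gamma>' \<Longrightarrow> \<Delta> \<subseteq> \<Delta>' \<Longrightarrow> forced H \<Gamma>' \<Delta>' P"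
  using forced_mono[of H \<Gamma> \<Delta> P \<Gamma>' \<Delta>' "[]"] by simp

lemma forced_member: "\<phi> \<in> \<Phi> \<Longrightarrow> \<phi> \<in> \<Gamma> \<Longrightarrow> forced H \<Gamma> \<Delta> \<phi>"
  unfolding forced_def by (auto simp: instance_of_class_iff intro!: derives_ident[of _ _ _ \<phi>])

lemma hits_mono: "hits \<Delta> P \<Longrightarrow> \<Delta> \<subseteq> \<Delta>' \<Longrightarrow> hits \<Delta>' P"
  unfolding hits_def by blast

lemma hits_class: "P \<in> \<Phi> \<Longrightarrow> hits \<Delta> P \<longleftrightarrow> P \<in> \<Delta>"
  by (simp add: hits_def instance_of_class_iff)

lemma entails_mono: "entails \<Gamma> \<Delta> \<Longrightarrow> \<Gamma> \<subseteq> \<Gamma>' \<Longrightarrow> \<Delta> \<subseteq> \<Delta>' \<Longrightarrow> entails \<Gamma>' \<Delta>'"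
  unfolding entails_def by blast

lemma entails_ident: "P \<in> \<Gamma> \<Longrightarrow> P \<in> \<Delta> \<Longrightarrow> entails \<Gamma> \<Delta>"
proof (rule entailsI)
  fix H \<Gamma>' \<Delta>' \<theta>
  assume "P \<in> \<Gamma>" "P \<in> \<Delta>" and *: "wf_ctx H \<Gamma>' \<Delta>'"
    and "\<And>P. P \<in> \<Gamma> \<Longrightarrow> forced H \<Gamma>' \<Delta>' (sub_fm \<theta> P)" "\<And>P. P \<in> \<Delta> \<Longrightarrow> hits \<Delta>' (sub_fm \<theta> P)"
  then obtain \<psi> where \<psi>: "forced H \<Gamma>' \<Delta>' (sub_fm \<theta> P)" "instance_of (sub_fm \<theta> P) \<psi>" "\<psi> \<in> \<Delta>'"
    unfolding hits_def by blast
  show "derives H \<Gamma>' \<Delta>'"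
    using forcedD[OF \<psi>(1) * \<psi>(2)] \<psi>(3) by (simp add: insert_absorb)
qed

text \<open>No cut on \<open>P\<close> is performed. The second premise asks for instances of
  \<open>P\<close>; each request, in whatever extension of the context it arises, is answered by the
  first premise with that instance as the chosen one on the right.\<close>

lemma entails_cut:
  assumes "entails \<Gamma> (insert P \<Delta>)" "entails (insert P \<Gamma>) \<Delta>"
  shows "entails \<Gamma> \<Delta>"
proof (rule entailsI)
  fix H \<Gamma>' \<Delta>' \<theta>
  assume *: "wf_ctx H \<Gamma>' \<Delta>'" "lc_sub \<theta>" "\<And>P. P \<in> \<Gamma> \<Longrightarrow> forced H \<Gamma>' \<Delta>' (sub_fm \<theta> P)"
    "\<And>P. P \<in> \<Delta> \<Longrightarrow> hits \<Delta>' (sub_fm \<theta> P)"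
  have "forced H \<Gamma>' \<Delta>' (sub_fm \<theta> P)"
    unfolding forced_def
  proof (intro allI impI)
    fix H1 \<Gamma>'' \<Delta>'' \<psi>
    assume e: "\<Gamma>' \<subseteq> \<Gamma>''" "\<Delta>' \<subseteq> \<Delta>''" "wf_ctx (H1 @ H) \<Gamma>'' \<Delta>''" "instance_of (sub_fm \<theta> P) \<psi>"
    have sub: "\<Delta>' \<subseteq> insert \<psi> \<Delta>''" using e by blast
    show "derives (H1 @ H) \<Gamma>'' (insert \<psi> \<Delta>'')"
    proof (rule entailsD[OF assms(1)])
      show "wf_ctx (H1 @ H) \<Gamma>'' (insert \<psi> \<Delta>'')" using e instance_of_in_class by simp
      show "forced (H1 @ H) \<Gamma>'' (insert \<psi> \<Delta>'') (sub_fm \<theta> Q)" if "Q \<in> \<Gamma>" for Q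
        using forced_mono[OF *(3)[OF that] e(1) sub] .
      show "hits (insert \<psi> \<Delta>'') (sub_fm \<theta> Q)" if "Q \<in> insert P \<Delta>" for Q
        using that e(4) hits_mono[OF *(4) sub] by (auto simp: hits_def)
    qed (fact *)
  qed
  then show "derives H \<Gamma>' \<Delta>'"
    using * by (intro entailsD[OF assms(2), of H \<Gamma>' \<Delta>' \<theta>]) auto
qed

text \<open>For class formulae being forced is as good as being present, since the formula can be
  cut into the antecedent. Schematically derivable sequents of class formulae thereby become rules
  of the relation.\<close>

lemma entails_small:
  assumes "finite \<Gamma>" "\<Gamma> \<subseteq> \<Phi>" "\<Delta> \<subseteq> \<Phi>"
    and derives: "\<And>H \<Gamma>' \<Delta>' \<theta>. wf_ctx H \<Gamma>' \<Delta>' \<Longrightarrow> lc_sub \<theta> \<Longrightarrow> sub_fm \<theta> ` \<Gamma> \<subseteq> \<Gamma>' \<Longrightarrow> sub_fm \<theta> ` \<Delta> \<subseteq> \<Delta>' \<Longrightarrow> derives H \<Gamma>' \<Delta>'"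
  shows "entails \<Gamma> \<Delta>"
proof (rule entailsI)
  fix H \<Gamma>' \<Delta>' \<theta>
  assume *: "wf_ctx H \<Gamma>' \<Delta>'" "lc_sub \<theta>" "\<And>P. P \<in> \<Gamma> \<Longrightarrow> forced H \<Gamma>' \<Delta>' (sub_fm \<theta> P)"
    "\<And>P. P \<in> \<Delta> \<Longrightarrow> hits \<Delta>' (sub_fm \<theta> P)"
  have \<Delta>: "sub_fm \<theta> ` \<Delta> \<subseteq> \<Delta>'"
  proof (intro image_subsetI)
    fix P assume "P \<in> \<Delta>"
    with *(2,4) assms(3) show "sub_fm \<theta> P \<in> \<Delta>'" by (metis hits_class class_sub subsetD)
  qed
  \<comment> \<open>\<open>G\<close> is the part of the antecedent that has still to be cut
    in.\<close>
  have "derives H \<Gamma>'' \<Delta>'" if "G \<subseteq> \<Gamma>" "\<Gamma>' \<subseteq> \<Gamma>''" "wf_ctx H \<Gamma>'' \<Delta>'" "sub_fm \<theta> ` (\<Gamma> - G) \<subseteq> \<Gamma>''" for G \<Gamma>''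
    using finite_subset[OF that(1) assms(1)] that
  proof (induction G arbitrary: \<Gamma>'' rule: finite_induct)
    case empty
    then show ?case using derives[of H \<Gamma>'' \<Delta>' \<theta>] * \<Delta> by simp
  next
    case (insert P G)
    have P: "P \<in> \<Gamma>" using insert.prems by simp
    then have P\<Phi>: "sub_fm \<theta> P \<in> \<Phi>" using assms(2) *(2) by (simp add: class_sub subset_iff)
    have "forced H \<Gamma>'' \<Delta>' (sub_fm \<theta> P)"
      by (rule forced_mono'[OF *(3)[OF P]]) (use insert.prems in auto)
    then have "derives H \<Gamma>'' (insert (sub_fm \<theta> P) \<Delta>')"
      using P\<Phi> insert.prems by (intro forcedD) (auto intro: instance_of_class)
    moreover have "derives H (insert (sub_fm \<theta> P) \<Gamma>'') \<Delta>'"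
      using insert.prems P\<Phi> by (intro insert.IH) auto
    ultimately show ?case using insert.prems by - (rule derives_cut)
  qed
  from this[of \<Gamma> \<Gamma>'] show "derives H \<Gamma>' \<Delta>'" using * by simp
qed

text \<open>An existential class formula is its own instance, so it may be cut in and opened by an
  actual eigenvariable \<open>b\<close>; the premise is used with \<open>a\<close> sent to
  \<open>b\<close>.\<close>

lemma entails_existsW:
  assumes "Exists \<phi> \<in> \<Gamma>" "Exists \<phi> \<in> \<Phi>" "a \<notin> fv_sequent (\<Gamma>, \<Delta>)" "entails (insert (inst \<phi> (FVar a)) \<Gamma>) \<Delta>"
  shows "entails \<Gamma> \<Delta>"
proof (rule entailsI)
  fix H \<Gamma>' \<Delta>' \<theta>
  assume *: "wf_ctx H \<Gamma>' \<Delta>'" "lc_sub \<theta>" "\<And>P. P \<in> \<Gamma> \<Longrightarrow> forced H \<Gamma>' \<Delta>' (sub_fm \<theta> P)"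
    "\<And>P. P \<in> \<Delta> \<Longrightarrow> hits \<Delta>' (sub_fm \<theta> P)"
  let ?E = "Exists (sub_fm \<theta> \<phi>)"
  have E: "?E \<in> \<Phi>" using assms(2) *(2) class_sub[of \<theta> "Exists \<phi>"] by simp
  have "finite (fv_sequent (\<Gamma>', \<Delta>') \<union> fv_fm (sub_fm \<theta> \<phi>))"
    using * by (auto simp: wf_ctx_def finite_fv_sequent)
  then obtain b where b: "b \<notin> fv_sequent (\<Gamma>', \<Delta>')" "b \<notin> fv_fm (sub_fm \<theta> \<phi>)" using fresh_var by blast
  have a: "a \<notin> fv_fm \<phi>" using assms(1,3) by (force simp: fv_sequent_def)
  have "derives H \<Gamma>' (insert ?E \<Delta>')"
    using *(3)[OF assms(1)] *(1) E by (intro forcedD) (auto intro: instance_of_class)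
  moreover have "derives H (insert ?E \<Gamma>') \<Delta>'"
  proof (rule derives_existsL[where a = b])
    let ?\<theta> = "\<theta>(a := FVar b)"
    let ?\<Gamma> = "insert (inst (sub_fm \<theta> \<phi>) (FVar b)) (insert ?E \<Gamma>')"
    have i: "inst (sub_fm \<theta> \<phi>) (FVar b) = sub_fm ?\<theta> (inst \<phi> (FVar a))"
      using a *(2) by (simp add: inst_sub)
    have i\<Phi>: "inst (sub_fm \<theta> \<phi>) (FVar b) \<in> \<Phi>" using class_Exists[OF E] by simp
    show "derives H ?\<Gamma> \<Delta>'"
    proof (rule entailsD[OF assms(4), of _ _ _ ?\<theta>])
      show "wf_ctx H ?\<Gamma> \<Delta>'" using * E i\<Phi> by simp
      show "lc_sub ?\<theta>" using * by (simp add: lc_sub_upd)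
      have eq: "sub_fm ?\<theta> P = sub_fm \<theta> P" if "P \<in> \<Gamma> \<union> \<Delta>" for P
        using that assms(3) by (intro sub_upd_fresh) (auto simp: fv_sequent_def)
      show "forced H ?\<Gamma> \<Delta>' (sub_fm ?\<theta> P)" if "P \<in> insert (inst \<phi> (FVar a)) \<Gamma>" for P
      proof (cases "P = inst \<phi> (FVar a)")
        case True
        then show ?thesis using i i\<Phi> by (intro forced_member) auto
      next
        case False
        then have P: "P \<in> \<Gamma>" using that by simp
        show ?thesis
          unfolding eq[OF UnI1[OF P]] by (rule forced_mono'[OF *(3)[OF P]]) auto
      qed
      show "hits \<Delta>' (sub_fm ?\<theta> P)" if "P \<in> \<Delta>" for P
        using that eq *(4) by simp
    qed
  qed (use * E b in \<open>auto simp: fv_sequent_def\<close>)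
  ultimately show "derives H \<Gamma>' \<Delta>'" using * by - (rule derives_cut)
qed

text \<open>Outside the class the context already contains an instance at some term
  \<open>t\<close>, and the premise is applied with \<open>a\<close> sent to \<open>t\<close>. Only
  for a class formula is an eigenvariable inference carried out.\<close>

lemma entails_forallW:
  assumes "Forall \<phi> \<in> \<Delta>" "a \<notin> fv_sequent (\<Gamma>, \<Delta>)" "entails \<Gamma> (insert (inst \<phi> (FVar a)) \<Delta>)"
  shows "entails \<Gamma> \<Delta>"
proof (rule entailsI)
  fix H \<Gamma>' \<Delta>' \<theta>
  assume *: "wf_ctx H \<Gamma>' \<Delta>'" "lc_sub \<theta>" "\<And>P. P \<in> \<Gamma> \<Longrightarrow> forced H \<Gamma>' \<Delta>' (sub_fm \<theta> P)"
    "\<And>P. P \<in> \<Delta> \<Longrightarrow> hits \<Delta>' (sub_fm \<theta> P)"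
  let ?A = "Forall (sub_fm \<theta> \<phi>)"
  have a: "a \<notin> fv_fm \<phi>" using assms(1,2) by (force simp: fv_sequent_def)
  have derives: "derives H \<Gamma>' (insert \<psi> \<Delta>')" if t: "lc_tm 0 t" "instance_of (inst (sub_fm \<theta> \<phi>) t) \<psi>" for t \<psi>
  proof (rule entailsD[OF assms(3), of _ _ _ "\<theta>(a := t)"])
    show "wf_ctx H \<Gamma>' (insert \<psi> \<Delta>')" using * instance_of_in_class[OF t(2)] by simp
    show "lc_sub (\<theta>(a := t))" using * t by (simp add: lc_sub_upd)
    have eq: "sub_fm (\<theta>(a := t)) P = sub_fm \<theta> P" if "P \<in> \<Gamma> \<union> \<Delta>" for P
      using that assms(2) by (intro sub_upd_fresh) (auto simp: fv_sequent_def)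
    show "forced H \<Gamma>' (insert \<psi> \<Delta>') (sub_fm (\<theta>(a := t)) P)" if "P \<in> \<Gamma>" for P
      unfolding eq[OF UnI1[OF that]] by (rule forced_mono'[OF *(3)[OF that]]) auto
    have "inst (sub_fm \<theta> \<phi>) t = sub_fm (\<theta>(a := t)) (inst \<phi> (FVar a))"
      using a t *(2) by (simp add: inst_sub)
    then have "hits (insert \<psi> \<Delta>') (sub_fm (\<theta>(a := t)) (inst \<phi> (FVar a)))"
      using t(2) by (auto simp: hits_def)
    then show "hits (insert \<psi> \<Delta>') (sub_fm (\<theta>(a := t)) P)" if "P \<in> insert (inst \<phi> (FVar a)) \<Delta>" for P
      using that eq[of P] hits_mono[OF *(4) subset_insertI, of P \<psi>] by auto
  qed
  show "derives H \<Gamma>' \<Delta>'"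
  proof (cases "?A \<in> \<Phi>")
    case True
    then have A: "?A \<in> \<Delta>'" using *(4)[OF assms(1)] by (simp add: hits_class)
    have "finite (fv_sequent (\<Gamma>', \<Delta>'))"
      using * by (auto simp: wf_ctx_def finite_fv_sequent)
    then obtain b where b: "b \<notin> fv_sequent (\<Gamma>', \<Delta>')" using fresh_var by blast
    have "inst (sub_fm \<theta> \<phi>) (FVar b) \<in> \<Phi>" using class_Forall[OF True] by simp
    then have "derives H \<Gamma>' (insert (inst (sub_fm \<theta> \<phi>) (FVar b)) \<Delta>')"
      by (intro derives[of "FVar b"]) (auto intro: instance_of_class)
    then show ?thesis by (rule derives_forallR[OF *(1) A b])
  next
    case False
    then obtain t \<psi> where "lc_tm 0 t" "instance_of (inst (sub_fm \<theta> \<phi>) t) \<psi>" "\<psi> \<in> \<Delta>'"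
      using *(4)[OF assms(1)] by (auto simp: hits_def instance_of_Forall_iff)
    then show ?thesis using derives by (metis insert_absorb)
  qed
qed

section \<open>Logical, equality and arithmetical rules for the sequent relation\<close>

lemma entails_negL: "lc_atom 0 a \<Longrightarrow> entails {Pos a, Neg a} {}"
  by (rule entails_small) (auto intro: class_Pos class_Neg derives_negL)

lemma entails_negR: "lc_atom 0 a \<Longrightarrow> entails {} {Pos a, Neg a}"
  by (rule entails_small) (auto intro: class_Pos class_Neg derives_negR)

lemma entails_conjL:
  assumes "Conj \<phi> \<psi> \<in> \<Phi>" "\<chi> \<in> {\<phi>, \<psi>}"
  shows "entails {Conj \<phi> \<psi>} {\<chi>}"
proof (rule entails_small)
  fix H \<Gamma> \<Delta> \<theta>
  assume *: "wf_ctx H \<Gamma> \<Delta>" "lc_sub \<theta>" "sub_fm \<theta> ` {Conj \<phi> \<psi>} \<subseteq> \<Gamma>" "sub_fm \<theta> ` {\<chi>} \<subseteq> \<Delta>"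
  have \<Phi>: "sub_fm \<theta> \<phi> \<in> \<Phi>" "sub_fm \<theta> \<psi> \<in> \<Phi>"
    using class_Conj[OF assms(1)] * by (auto simp: class_sub)
  show "derives H \<Gamma> \<Delta>"
    by (rule derives_conjL[of _ _ _ "sub_fm \<theta> \<phi>" "sub_fm \<theta> \<psi>"], use * \<Phi> in auto,
        rule derives_ident[of _ _ _ "sub_fm \<theta> \<chi>"]) (use * assms \<Phi> in auto)
qed (use class_Conj[OF assms(1)] assms in auto)

lemma entails_conjR:
  assumes "Conj \<phi> \<psi> \<in> \<Phi>"
  shows "entails {\<phi>, \<psi>} {Conj \<phi> \<psi>}"
proof (rule entails_small)
  fix H \<Gamma> \<Delta> \<theta>
  assume *: "wf_ctx H \<Gamma> \<Delta>" "lc_sub \<theta>" "sub_fm \<theta> ` {\<phi>, \<psi>} \<subseteq> \<Gamma>" "sub_fm \<theta> ` {Conj \<phi> \<psi>} \<subseteq> \<Delta>"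
  have \<Phi>: "sub_fm \<theta> \<phi> \<in> \<Phi>" "sub_fm \<theta> \<psi> \<in> \<Phi>"
    using class_Conj[OF assms(1)] * by (auto simp: class_sub)
  have "derives H \<Gamma> (insert (sub_fm \<theta> \<phi>) \<Delta>)"
    by (rule derives_ident[of _ _ _ "sub_fm \<theta> \<phi>"]) (use * \<Phi> in auto)
  moreover have "derives H \<Gamma> (insert (sub_fm \<theta> \<psi>) \<Delta>)"
    by (rule derives_ident[of _ _ _ "sub_fm \<theta> \<psi>"]) (use * \<Phi> in auto)
  ultimately show "derives H \<Gamma> \<Delta>"
    using * by - (rule derives_conjR[of _ _ _ "sub_fm \<theta> \<phi>" "sub_fm \<theta> \<psi>"], auto)
qed (use class_Conj[OF assms(1)] assms in auto)

lemma entails_disjL: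
  assumes "Disj \<phi> \<psi> \<in> \<Phi>"
  shows "entails {Disj \<phi> \<psi>} {\<phi>, \<psi>}"
proof (rule entails_small)
  fix H \<Gamma> \<Delta> \<theta>
  assume *: "wf_ctx H \<Gamma> \<Delta>" "lc_sub \<theta>" "sub_fm \<theta> ` {Disj \<phi> \<psi>} \<subseteq> \<Gamma>" "sub_fm \<theta> ` {\<phi>, \<psi>} \<subseteq> \<Delta>"
  have \<Phi>: "sub_fm \<theta> \<phi> \<in> \<Phi>" "sub_fm \<theta> \<psi> \<in> \<Phi>"
    using class_Disj[OF assms(1)] * by (auto simp: class_sub)
  have "derives H (insert (sub_fm \<theta> \<phi>) \<Gamma>) \<Delta>"
    by (rule derives_ident[of _ _ _ "sub_fm \<theta> \<phi>"]) (use * \<Phi> in auto)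
  moreover have "derives H (insert (sub_fm \<theta> \<psi>) \<Gamma>) \<Delta>"
    by (rule derives_ident[of _ _ _ "sub_fm \<theta> \<psi>"]) (use * \<Phi> in auto)
  ultimately show "derives H \<Gamma> \<Delta>"
    using * by - (rule derives_disjL[of _ _ _ "sub_fm \<theta> \<phi>" "sub_fm \<theta> \<psi>"], auto)
qed (use class_Disj[OF assms(1)] assms in auto)

lemma entails_disjR:
  assumes "Disj \<phi> \<psi> \<in> \<Phi>" "\<chi> \<in> {\<phi>, \<psi>}"
  shows "entails {\<chi>} {Disj \<phi> \<psi>}"
proof (rule entails_small)
  fix H \<Gamma> \<Delta> \<theta>
  assume *: "wf_ctx H \<Gamma> \<Delta>" "lc_sub \<theta>" "sub_fm \<theta> ` {\<chi>} \<subseteq> \<Gamma>" "sub_fm \<theta> ` {Disj \<phi> \<psi>} \<subseteq> \<Delta>"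
  have \<Phi>: "sub_fm \<theta> \<phi> \<in> \<Phi>" "sub_fm \<theta> \<psi> \<in> \<Phi>"
    using class_Disj[OF assms(1)] * by (auto simp: class_sub)
  show "derives H \<Gamma> \<Delta>"
    by (rule derives_disjR[of _ _ _ "sub_fm \<theta> \<phi>" "sub_fm \<theta> \<psi>"], use * \<Phi> in auto,
        rule derives_ident[of _ _ _ "sub_fm \<theta> \<chi>"]) (use * assms \<Phi> in auto)
qed (use class_Disj[OF assms(1)] assms in auto)

lemma entails_existsR:
  assumes "Exists \<phi> \<in> \<Phi>" "lc_tm 0 t"
  shows "entails {inst \<phi> t} {Exists \<phi>}"
proof (rule entails_small)
  fix H \<Gamma> \<Delta> \<theta>
  assume *: "wf_ctx H \<Gamma> \<Delta>" "lc_sub \<theta>" "sub_fm \<theta> ` {inst \<phi> t} \<subseteq> \<Gamma>" "sub_fm \<theta> ` {Exists \<phi>} \<subseteq> \<Delta>"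
  have t: "lc_tm 0 (sub_tm \<theta> t)" using * assms by (simp add: lc_sub_tm)
  have i: "inst (sub_fm \<theta> \<phi>) (sub_tm \<theta> t) \<in> \<Gamma>" using * by (simp add: sub_inst)
  then have "derives H \<Gamma> (insert (inst (sub_fm \<theta> \<phi>) (sub_tm \<theta> t)) \<Delta>)"
    using *(1) by - (rule derives_ident[of _ _ _ "inst (sub_fm \<theta> \<phi>) (sub_tm \<theta> t)"], auto simp: wf_ctx_def)
  then show "derives H \<Gamma> \<Delta>"
    using * t by - (rule derives_existsR[of _ _ _ "sub_fm \<theta> \<phi>" "sub_tm \<theta> t"], auto)
qed (use class_Exists[OF assms] assms in auto)

text \<open>Outside the class no inference is made: an instance of the instantiated body is an
  instance of the quantified formula, and forcing supplies it.\<close>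

lemma entails_forallL:
  assumes "lc_tm 0 t"
  shows "entails {Forall \<phi>} {inst \<phi> t}"
proof (cases "Forall \<phi> \<in> \<Phi>")
  case True
  show ?thesis
  proof (rule entails_small)
    fix H \<Gamma> \<Delta> \<theta>
    assume *: "wf_ctx H \<Gamma> \<Delta>" "lc_sub \<theta>" "sub_fm \<theta> ` {Forall \<phi>} \<subseteq> \<Gamma>" "sub_fm \<theta> ` {inst \<phi> t} \<subseteq> \<Delta>"
    have t: "lc_tm 0 (sub_tm \<theta> t)" using * assms by (simp add: lc_sub_tm)
    have i: "inst (sub_fm \<theta> \<phi>) (sub_tm \<theta> t) \<in> \<Delta>" using * by (simp add: sub_inst)
    then have "derives H (insert (inst (sub_fm \<theta> \<phi>) (sub_tm \<theta> t)) \<Gamma>) \<Delta>"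
      using *(1) by - (rule derives_ident[of _ _ _ "inst (sub_fm \<theta> \<phi>) (sub_tm \<theta> t)"], auto simp: wf_ctx_def tracks_def)
    then show "derives H \<Gamma> \<Delta>"
      using * t by - (rule derives_forallL[of _ _ _ "sub_fm \<theta> \<phi>" "sub_tm \<theta> t"], auto)
  qed (use class_Forall[OF True assms] True in auto)
next
  case False
  show ?thesis
  proof (rule entailsI)
    fix H \<Gamma>' \<Delta>' \<theta>
    assume *: "wf_ctx H \<Gamma>' \<Delta>'" "lc_sub \<theta>" "\<And>P. P \<in> {Forall \<phi>} \<Longrightarrow> forced H \<Gamma>' \<Delta>' (sub_fm \<theta> P)"
      "\<And>P. P \<in> {inst \<phi> t} \<Longrightarrow> hits \<Delta>' (sub_fm \<theta> P)"
    have nF: "Forall (sub_fm \<theta> \<phi>) \<notin> \<Phi>" using class_sub[of \<theta> "Forall \<phi>"] False * by simp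
    obtain \<psi> where \<psi>: "instance_of (inst (sub_fm \<theta> \<phi>) (sub_tm \<theta> t)) \<psi>" "\<psi> \<in> \<Delta>'"
      using *(4)[of "inst \<phi> t"] *(2) by (auto simp: hits_def sub_inst)
    then have "instance_of (Forall (sub_fm \<theta> \<phi>)) \<psi>"
      using instance_of_Forall[OF nF _ \<psi>(1)] assms *(2) by (simp add: lc_sub_tm)
    then have "derives H \<Gamma>' (insert \<psi> \<Delta>')"
      using *(1) *(3)[of "Forall \<phi>"] by (intro forcedD) auto
    then show "derives H \<Gamma>' \<Delta>'" using \<psi> by (simp add: insert_absorb)
  qed
qed

lemma entails_refl: "lc_tm 0 t \<Longrightarrow> entails {} {Pos (Eq t t)}"
  by (rule entails_small) (auto intro: class_Pos derives_refl)

lemma entails_subst: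
  assumes "lc_tm 0 t" "lc_tm 0 u" "lc_atom 0 a"
  shows "entails {Pos (Eq t u), Pos (sub_atom (FVar(v := t)) a)} {Pos (sub_atom (FVar(v := u)) a)}"
proof (rule entails_small)
  fix H \<Gamma> \<Delta> \<theta>
  assume *: "wf_ctx H \<Gamma> \<Delta>" "lc_sub \<theta>"
    "sub_fm \<theta> ` {Pos (Eq t u), Pos (sub_atom (FVar(v := t)) a)} \<subseteq> \<Gamma>"
    "sub_fm \<theta> ` {Pos (sub_atom (FVar(v := u)) a)} \<subseteq> \<Delta>"
  text \<open>Move the substituted variable out of the way of \<open>\<theta>\<close>.\<close>
  obtain z where z: "z \<notin> (\<Union>y\<in>fv_fm (Pos a). fv_tm (\<theta> y))"
    using fresh_var[of "\<Union>y\<in>fv_fm (Pos a). fv_tm (\<theta> y)"] by (auto simp del: fv_fm.simps)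
  have s: "sub_fm \<theta> (Pos (sub_atom (FVar(v := r)) a)) =
      subst1 z (sub_tm \<theta> r) (sub_fm (\<theta>(v := FVar z)) (Pos a))" for r
  proof -
    have "sub_fm \<theta> (Pos (sub_atom (FVar(v := r)) a)) = sub_fm \<theta> (subst1 v r (Pos a))"
      by (simp add: subst1_def)
    also have "\<dots> = sub_fm (\<theta>(v := sub_tm \<theta> r)) (Pos a)" by (rule sub_subst1)
    also have "\<dots> = subst1 z (sub_tm \<theta> r) (sub_fm (\<theta>(v := FVar z)) (Pos a))"
      unfolding subst1_def sub_fm_comp using z
      by (intro sub_fm_cong) (auto intro!: sub_tm_id[symmetric])
    finally show ?thesis .
  qed
  show "derives H \<Gamma> \<Delta>"
    by (rule derives_subst[of _ _ _ "sub_tm \<theta> t" "sub_tm \<theta> u" z "sub_fm (\<theta>(v := FVar z)) (Pos a)"])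
      (use * s in auto)
qed (use assms in \<open>auto intro!: class_Pos simp: lc_sub_atom lc_sub_upd\<close>)

lemma entails_Q:
  assumes "Q_initial (\<Gamma>, \<Delta>)" "\<And>\<phi>. \<phi> \<in> \<Gamma> \<union> \<Delta> \<Longrightarrow> lc_fm 0 \<phi>"
  shows "entails \<Gamma> \<Delta>"
proof (rule entails_small)
  show "finite \<Gamma>" using assms(1) by cases auto
  have "\<forall>\<phi>\<in>\<Gamma> \<union> \<Delta>. lc_fm 0 \<phi>" using assms(2) by blast
  with assms(1) have "\<Gamma> \<union> \<Delta> \<subseteq> \<Phi>"
    by cases (auto intro: class_Pos class_Neg class_succ class_less)
  then show "\<Gamma> \<subseteq> \<Phi>" "\<Delta> \<subseteq> \<Phi>" by auto
  fix H \<Gamma>' \<Delta>' \<theta>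
  assume *: "wf_ctx H \<Gamma>' \<Delta>'" "lc_sub \<theta>" "sub_fm \<theta> ` \<Gamma> \<subseteq> \<Gamma>'" "sub_fm \<theta> ` \<Delta> \<subseteq> \<Delta>'"
  have "Q_initial (sub_fm \<theta> ` \<Gamma>, sub_fm \<theta> ` \<Delta>)"
    using assms(1) *(2) by cases (auto intro: Q_initial.intros simp: lc_sub_tm)
  then show "derives H \<Gamma>' \<Delta>'" using * by (intro derives_Q)
qed

section \<open>Induction by loops\<close>

definition tracked :: "companion list \<Rightarrow> nat set" where
  "tracked H = fst ` set H"

lemma fixes_tracked_iff: "fixes_tracked H \<theta> \<longleftrightarrow> (\<forall>x\<in>tracked H. \<theta> x = FVar x)"
  by (auto simp: fixes_tracked_def tracked_def)

lemma sub_image_id: "(\<And>\<phi>. \<phi> \<in> \<Gamma> \<Longrightarrow> sub_fm \<sigma> \<phi> = \<phi>) \<Longrightarrow> sub_fm \<sigma> ` \<Gamma> = \<Gamma>"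
  by (force simp: image_iff)

lemma wf_ctx_tracks_Cons:
  "wf_ctx H \<Gamma> \<Delta> \<Longrightarrow> Pos (Lt (FVar x) (FVar w)) \<in> \<Gamma> \<Longrightarrow> wf_ctx ((x, w, s) # H) \<Gamma> \<Delta>"
  by (auto simp: wf_ctx_def tracks_def)

text \<open>The loop runs through the instances of \<open>A\<close> at \<open>FVar X\<close>. Its body splits on whether \<open>X\<close> is zero
  or a successor \<open>Y + 1\<close>; in the latter case the induction step is applied in a context where the
  induction hypothesis, the instances of \<open>A\<close> at \<open>Y\<close>, is forced by the back edges.\<close>

lemma entails_ind:
  assumes FA: "universal A" and fin: "finite \<Gamma>" "finite \<Delta>"
    and a: "a \<notin> fv_sequent (\<Gamma>, \<Delta>)" "a \<notin> fv_fm A"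
    and step: "entails (insert (subst1 x (FVar a) A) \<Gamma>) (insert (subst1 x (Succ (FVar a)) A) \<Delta>)"
    and A0: "subst1 x Zero A \<in> \<Gamma>" and At: "subst1 x t A \<in> \<Delta>" and t: "lc_tm 0 t"
  shows "entails \<Gamma> \<Delta>"
proof (rule entailsI)
  fix H \<Gamma>' \<Delta>' \<theta>
  assume *: "wf_ctx H \<Gamma>' \<Delta>'" "lc_sub \<theta>" and PrG: "\<And>P. P \<in> \<Gamma> \<Longrightarrow> forced H \<Gamma>' \<Delta>' (sub_fm \<theta> P)"
    and hitG: "\<And>P. P \<in> \<Delta> \<Longrightarrow> hits \<Delta>' (sub_fm \<theta> P)"
  define B where "B u = sub_fm (\<theta>(x := u)) A" for u
  have B: "sub_fm \<theta> (subst1 x r A) = B (sub_tm \<theta> r)" for r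
    unfolding B_def by (rule sub_subst1)
  have lct: "lc_tm 0 (sub_tm \<theta> t)" using t * by (simp add: lc_sub_tm)
  obtain \<psi> where \<psi>: "instance_of (B (sub_tm \<theta> t)) \<psi>" "\<psi> \<in> \<Delta>'"
    using hitG[OF At] by (auto simp: B hits_def)
  \<comment> \<open>What the substitutions of the new loop have to leave alone: the context, the
    trace variables of the outer loops and the parameters of the induction formula.\<close>
  define W0 where "W0 = fv_sequent (\<Gamma>', \<Delta>') \<union> tracked H \<union> (\<Union>z\<in>fv_fm A. fv_tm (\<theta> z))"
  have finW0: "finite W0"
    using * by (auto simp: W0_def wf_ctx_def finite_fv_sequent tracked_def)
  then obtain X where X: "X \<notin> W0" using fresh_var by blast
  have "finite (insert X W0)" using finW0 by simp
  then obtain V where V: "V \<notin> W0" "V \<noteq> X" using fresh_var by blast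
  have FB: "universal (B (FVar X))" using FA *(2) by (simp add: B_def universal_sub lc_sub_upd)
  have Bsub: "sub_fm \<sigma> (B (FVar X)) = B (\<sigma> X)" if "\<And>z. z \<in> W0 \<Longrightarrow> \<sigma> z = FVar z" for \<sigma>
    unfolding B_def sub_fm_comp
    by (intro sub_fm_cong) (auto simp: W0_def intro!: sub_tm_id that)
  have fvB: "fv_fm (B (FVar X)) \<subseteq> insert X W0"
    by (auto simp: B_def fv_sub_fm W0_def split: if_splits)
  define W where "W = insert V (insert X W0)"
  have "finite W" "fv_fm (B (FVar X)) \<subseteq> W" using finW0 fvB by (auto simp: W_def)
  from generic_instance[OF FB this] obtain \<psi>0 where \<psi>0: "instance_of (B (FVar X)) \<psi>0"
    and gen: "\<forall>\<sigma> \<psi>. lc_sub \<sigma> \<longrightarrow> instance_of (sub_fm \<sigma> (B (FVar X))) \<psi> \<longrightarrow>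
      (\<exists>\<sigma>'. lc_sub \<sigma>' \<and> (\<forall>z\<in>W. \<sigma>' z = \<sigma> z) \<and> \<psi> = sub_fm \<sigma>' \<psi>0)"
    by blast
  \<comment> \<open>Every instance at every \<open>u\<close> is \<open>\<psi>0\<close> under a
    substitution that fixes the old context, with a free choice for \<open>V\<close>. It is used
    with \<open>V := X\<close> for the back edges and with a bound above \<open>t\<close> for
    entering the loop.\<close>
  have gen': "\<exists>\<sigma>. lc_sub \<sigma> \<and> (\<forall>z\<in>W0. \<sigma> z = FVar z) \<and> \<sigma> X = u \<and> \<sigma> V = v \<and> \<psi> = sub_fm \<sigma> \<psi>0"
    if uv: "lc_tm 0 u" "lc_tm 0 v" and i: "instance_of (B u) \<psi>" for u v \<psi>
  proof -
    let ?\<sigma> = "FVar(X := u, V := v)"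
    have lc: "lc_sub ?\<sigma>" using uv by (simp add: lc_sub_def)
    have "?\<sigma> z = FVar z" if "z \<in> W0" for z using that X V by auto
    from Bsub[of ?\<sigma>, OF this] V have "sub_fm ?\<sigma> (B (FVar X)) = B u" by simp
    then obtain \<sigma> where \<sigma>: "lc_sub \<sigma>" "\<forall>z\<in>W. \<sigma> z = ?\<sigma> z" "\<psi> = sub_fm \<sigma> \<psi>0"
      using gen lc i by (metis (no_types, lifting))
    have "\<sigma> z = FVar z" if "z \<in> W0" for z
      using \<sigma>(2) that X V by (auto simp: W_def)
    moreover have "\<sigma> X = u" "\<sigma> V = v" using \<sigma>(2) V by (auto simp: W_def)
    ultimately show ?thesis using \<sigma> by blast
  qed
  have B_inst: "instance_of (B u) (subst1 X u \<psi>0)" if "lc_tm 0 u" for u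
  proof -
    have "instance_of (sub_fm (FVar(X := u)) (B (FVar X))) (subst1 X u \<psi>0)"
      unfolding subst1_def using that by (intro instance_of_sub[OF \<psi>0]) (simp add: lc_sub_upd)
    moreover have "(FVar(X := u)) z = FVar z" if "z \<in> W0" for z using that X by auto
    from Bsub[of "FVar(X := u)", OF this] have "sub_fm (FVar(X := u)) (B (FVar X)) = B u" by simp
    ultimately show ?thesis by simp
  qed
  have \<psi>0X: "subst1 X (FVar X) \<psi>0 = \<psi>0" by (simp add: subst1_def)
  have \<Phi>: "\<psi>0 \<in> \<Phi>" "\<psi> \<in> \<Phi>" "subst1 X u \<psi>0 \<in> \<Phi>" if "lc_tm 0 u" for u
    using \<psi>0 \<psi> B_inst[OF that] instance_of_in_class by blast+
  let ?l = "Pos (Lt (FVar X) (FVar V))"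
  define \<Gamma>s where "\<Gamma>s = insert ?l \<Gamma>'"
  define \<Delta>s where "\<Delta>s = insert \<psi>0 \<Delta>'"
  define H' where "H' = (X, V, (\<Gamma>s, \<Delta>s)) # H"
  have Lt\<Phi>: "Pos (Lt r u) \<in> \<Phi>" "Pos (Eq r u) \<in> \<Phi>" if "lc_tm 0 r" "lc_tm 0 u" for r u
    using that by (auto intro: class_Pos)
  have fix0: "sub_fm \<sigma> ` \<Gamma>' = \<Gamma>'" "sub_fm \<sigma> ` \<Delta>' = \<Delta>'" "fixes_tracked H \<sigma>"
    if "\<forall>z\<in>W0. \<sigma> z = FVar z" for \<sigma>
    using that by (auto simp: W0_def fv_sequent_def fixes_tracked_iff intro!: sub_image_id sub_fm_id)
  have adms: "wf_ctx H \<Gamma>s \<Delta>s"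
    using * \<Phi>(1)[of Zero] Lt\<Phi>(1) by (simp add: \<Gamma>s_def \<Delta>s_def)
  have adm': "wf_ctx H' \<Gamma>s \<Delta>s"
    unfolding H'_def using adms by (rule wf_ctx_tracks_Cons) (simp add: \<Gamma>s_def)
  have sub\<Gamma>: "\<Gamma>' \<subseteq> \<Gamma>s" "\<Delta>' \<subseteq> \<Delta>s" by (auto simp: \<Gamma>s_def \<Delta>s_def)

  have "finite (insert X (fv_sequent (\<Gamma>s, \<Delta>s)))"
    using adms by (simp add: wf_ctx_def finite_fv_sequent)
  then obtain Y where Y: "Y \<notin> fv_sequent (\<Gamma>s, \<Delta>s)" "Y \<noteq> X" using fresh_var by blast
  have "derives H' \<Gamma>s \<Delta>s"
  proof (rule derives_nat_cases[of _ _ _ "FVar X" Y])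
    show "derives H' (insert (Pos (Eq (FVar X) Zero)) \<Gamma>s) \<Delta>s"
    proof (rule derives_rewrite[of _ _ _ "FVar X" Zero X \<psi>0])
      show "wf_ctx H' (insert (Pos (Eq (FVar X) Zero)) \<Gamma>s) \<Delta>s"
        using adm' Lt\<Phi> by simp
      have "forced H' (insert (Pos (Eq (FVar X) Zero)) \<Gamma>s) \<Delta>s (B Zero)"
        using forced_mono[OF PrG[OF A0], of "insert (Pos (Eq (FVar X) Zero)) \<Gamma>s" \<Delta>s "[(X, V, (\<Gamma>s, \<Delta>s))]"] sub\<Gamma>
        by (auto simp: B H'_def)
      then show "derives H' (insert (Pos (Eq (FVar X) Zero)) \<Gamma>s) (insert (subst1 X Zero \<psi>0) \<Delta>s)"
        by (rule forcedD) (use adm' Lt\<Phi> B_inst in auto)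
    qed (auto simp: \<psi>0X \<Delta>s_def)
  next
    let ?\<Gamma>2 = "insert (Pos (Eq (FVar X) (Succ (FVar Y)))) \<Gamma>s"
    let ?\<Gamma>3 = "insert (Pos (Lt (FVar Y) (FVar X))) ?\<Gamma>2"
    let ?\<Delta>3 = "insert (subst1 X (Succ (FVar Y)) \<psi>0) \<Delta>s"
    have adm2: "wf_ctx H' ?\<Gamma>2 \<Delta>s" and adm3: "wf_ctx H' ?\<Gamma>3 \<Delta>s" "wf_ctx H' ?\<Gamma>3 ?\<Delta>3"
      using adm' Lt\<Phi> \<Phi>(3) by auto
    have sub3: "\<Gamma>' \<subseteq> ?\<Gamma>3" "\<Delta>' \<subseteq> ?\<Delta>3" using sub\<Gamma> by auto
    let ?\<theta> = "\<theta>(a := FVar Y)"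
    have eq: "sub_fm ?\<theta> P = sub_fm \<theta> P" if "P \<in> \<Gamma> \<union> \<Delta>" for P
      using that a(1) by (intro sub_upd_fresh) (auto simp: fv_sequent_def)
    have eqA: "sub_fm ?\<theta> (subst1 x r A) = B (sub_tm ?\<theta> r)" for r
      unfolding sub_subst1 B_def using a(2) by (intro sub_fm_cong) auto
    \<comment> \<open>A requested instance at \<open>Y\<close> is \<open>\<psi>0\<close> under a
      substitution with \<open>X := Y\<close> and \<open>V := X\<close>. This maps the antecedent of
      the loop to \<open>Y < X\<close> together with the old context; both are present, so a back
      edge answers the request.\<close>
    have hyp: "forced H' ?\<Gamma>3 ?\<Delta>3 (B (FVar Y))"
      unfolding forced_def
    proof (intro allI impI)
      fix H1 \<Gamma>4 \<Delta>4 \<psi>'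
      assume e: "?\<Gamma>3 \<subseteq> \<Gamma>4" "?\<Delta>3 \<subseteq> \<Delta>4" "wf_ctx (H1 @ H') \<Gamma>4 \<Delta>4" "instance_of (B (FVar Y)) \<psi>'"
      obtain \<sigma> where \<sigma>: "lc_sub \<sigma>" "\<forall>z\<in>W0. \<sigma> z = FVar z" "\<sigma> X = FVar Y" "\<sigma> V = FVar X" "\<psi>' = sub_fm \<sigma> \<psi>0"
        using gen'[of "FVar Y" "FVar X", OF _ _ e(4)] by auto
      have "wf_ctx (H1 @ H') \<Gamma>4 (insert \<psi>' \<Delta>4)"
        using e instance_of_in_class by simp
      then show "derives (H1 @ H') \<Gamma>4 (insert \<psi>' \<Delta>4)"
        unfolding H'_def
      proof (rule derives_bud[where \<theta> = \<sigma>])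
        show "sub_fm \<sigma> ` \<Gamma>s \<subseteq> \<Gamma>4"
          using e(1) sub3(1) \<sigma>(3,4) by (simp add: \<Gamma>s_def fix0(1)[OF \<sigma>(2)])
        show "sub_fm \<sigma> ` \<Delta>s \<subseteq> insert \<psi>' \<Delta>4"
          using e(2) sub3(2) \<sigma>(5) by (auto simp: \<Delta>s_def fix0(2)[OF \<sigma>(2)])
      qed (use \<sigma> fix0(3)[OF \<sigma>(2)] in auto)
    qed
    have "derives H' ?\<Gamma>3 ?\<Delta>3"
    proof (rule entailsD[OF step adm3(2), where \<theta> = ?\<theta>])
      show "lc_sub ?\<theta>" using * by (simp add: lc_sub_upd)
      fix P
      show "forced H' ?\<Gamma>3 ?\<Delta>3 (sub_fm ?\<theta> P)" if "P \<in> insert (subst1 x (FVar a) A) \<Gamma>"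
      proof (cases "P = subst1 x (FVar a) A")
        case True
        then show ?thesis using hyp by (simp add: eqA)
      next
        case False
        then have P: "P \<in> \<Gamma>" using that by simp
        show ?thesis
          unfolding eq[OF UnI1[OF P]]
          using forced_mono[OF PrG[OF P] sub3, of "[(X, V, (\<Gamma>s, \<Delta>s))]"] by (simp add: H'_def)
      qed
      show "hits ?\<Delta>3 (sub_fm ?\<theta> P)" if "P \<in> insert (subst1 x (Succ (FVar a)) A) \<Delta>"
      proof (cases "P = subst1 x (Succ (FVar a)) A")
        case True
        then show ?thesis using B_inst[of "Succ (FVar Y)"] by (auto simp: eqA hits_def)
      next
        case False
        then have P: "P \<in> \<Delta>" using that by simp
        show ?thesis
          unfolding eq[OF UnI2[OF P]] by (rule hits_mono[OF hitG[OF P] sub3(2)])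
      qed
    qed
    then have "derives H' ?\<Gamma>3 \<Delta>s"
      by (intro derives_rewrite[of H' ?\<Gamma>3 \<Delta>s "FVar X" "Succ (FVar Y)" X \<psi>0] adm3) (auto simp: \<psi>0X \<Delta>s_def)
    then show "derives H' ?\<Gamma>2 \<Delta>s"
      by (rule derives_pred_less[OF adm2, rotated]) simp
  qed (use adm' Y in auto)
  then have "derives H \<Gamma>s \<Delta>s"
    using adm' unfolding H'_def by - (rule derives_loop)
  \<comment> \<open>The loop is entered by a substitution. The bound \<open>V := s t\<close> is
    chosen because \<open>t < s t\<close> is derivable outright and can be cut away.\<close>
  obtain \<sigma> where \<sigma>: "lc_sub \<sigma>" "\<forall>z\<in>W0. \<sigma> z = FVar z" "\<sigma> X = sub_tm \<theta> t" "\<sigma> V = Succ (sub_tm \<theta> t)"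
    "\<psi> = sub_fm \<sigma> \<psi>0"
    using gen'[of "sub_tm \<theta> t" "Succ (sub_tm \<theta> t)", OF _ _ \<psi>(1)] lct by auto
  let ?k = "Pos (Lt (sub_tm \<theta> t) (Succ (sub_tm \<theta> t)))"
  have \<sigma>s: "sub_fm \<sigma> ` \<Gamma>s = insert ?k \<Gamma>'" "sub_fm \<sigma> ` \<Delta>s = \<Delta>'"
    using \<sigma> \<psi>(2) by (auto simp: \<Gamma>s_def \<Delta>s_def fix0(1,2)[OF \<sigma>(2)])
  have k\<Phi>: "?k \<in> \<Phi>" using lct by (intro Lt\<Phi>) auto
  have "derives H (insert ?k \<Gamma>') \<Delta>'"
    using derives_sub[OF _ \<sigma>(1) fix0(3)[OF \<sigma>(2)] \<open>derives H \<Gamma>s \<Delta>s\<close>] * k\<Phi> unfolding \<sigma>s by simp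
  moreover have "derives H \<Gamma>' (insert ?k \<Delta>')"
    using * lct k\<Phi> by - (rule derives_less_succ[of _ _ _ "sub_tm \<theta> t"], auto)
  ultimately show "derives H \<Gamma>' \<Delta>'" using * by - (rule derives_cut)
qed

end

section \<open>Substitutional semantics\<close>

text \<open>An interpretation is a truth assignment to the atoms over locally closed terms: free variables
  act as constants, and every element of the domain is named by a term.\<close>

function Tr :: "(atom \<Rightarrow> bool) \<Rightarrow> fm \<Rightarrow> bool" where
  "Tr \<alpha> (Pos a) = \<alpha> a"
| "Tr \<alpha> (Neg a) = (\<not> \<alpha> a)"
| "Tr \<alpha> (Conj \<phi> \<psi>) = (Tr \<alpha> \<phi> \<and> Tr \<alpha> \<psi>)"
| "Tr \<alpha> (Disj \<phi> \<psi>) = (Tr \<alpha> \<phi> \<or> Tr \<alpha> \<psi>)"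
| "Tr \<alpha> (Forall \<phi>) = (\<forall>t. lc_tm 0 t \<longrightarrow> Tr \<alpha> (inst \<phi> t))"
| "Tr \<alpha> (Exists \<phi>) = (\<exists>t. lc_tm 0 t \<and> Tr \<alpha> (inst \<phi> t))"
  by pat_completeness auto
termination by (relation "measure (\<lambda>(\<alpha>, \<phi>). cpx \<phi>)") auto

text \<open>The domain consists of the terms themselves, so equality is a congruence rather than
  identity. Replacement is demanded for atoms and lifted to formulae by
  \<open>Tr_sub_eq\<close>.\<close>

locale arith_model =
  fixes \<alpha> :: "atom \<Rightarrow> bool"
  assumes eq_refl: "lc_tm 0 t \<Longrightarrow> \<alpha> (Eq t t)"
    and eq_subst: "lc_tm 0 t \<Longrightarrow> lc_tm 0 u \<Longrightarrow> lc_atom 0 a \<Longrightarrow> \<alpha> (Eq t u) \<Longrightarrow>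
      \<alpha> (sub_atom (FVar(v := t)) a) \<Longrightarrow> \<alpha> (sub_atom (FVar(v := u)) a)"
    and succ_nonzero: "lc_tm 0 t \<Longrightarrow> \<not> \<alpha> (Eq (Succ t) Zero)"
    and succ_inject: "lc_tm 0 t \<Longrightarrow> lc_tm 0 u \<Longrightarrow> \<alpha> (Eq (Succ t) (Succ u)) \<Longrightarrow> \<alpha> (Eq t u)"
    and pred_exists: "lc_tm 0 t \<Longrightarrow> \<not> \<alpha> (Eq t Zero) \<Longrightarrow> \<exists>u. lc_tm 0 u \<and> \<alpha> (Eq t (Succ u))"
    and plus_zero: "lc_tm 0 t \<Longrightarrow> \<alpha> (Eq (Plus t Zero) t)"
    and plus_succ: "lc_tm 0 t \<Longrightarrow> lc_tm 0 u \<Longrightarrow> \<alpha> (Eq (Plus t (Succ u)) (Succ (Plus t u)))"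
    and times_zero: "lc_tm 0 t \<Longrightarrow> \<alpha> (Eq (Times t Zero) Zero)"
    and times_succ: "lc_tm 0 t \<Longrightarrow> lc_tm 0 u \<Longrightarrow> \<alpha> (Eq (Times t (Succ u)) (Plus (Times t u) t))"
    and less_iff: "lc_tm 0 t \<Longrightarrow> lc_tm 0 u \<Longrightarrow>
      \<alpha> (Lt t u) \<longleftrightarrow> (\<exists>v. lc_tm 0 v \<and> \<alpha> (Eq (Plus t (Succ v)) u))"

text \<open>Parameters are the free variables of \<open>A\<close> other than \<open>x\<close>, which
  act as constants; other parameter values arise by substituting into \<open>A\<close>
  beforehand.\<close>

definition models_induction :: "(atom \<Rightarrow> bool) \<Rightarrow> fm \<Rightarrow> bool" where
  "models_induction \<alpha> A \<longleftrightarrow> (\<forall>x. Tr \<alpha> (subst1 x Zero A) \<longrightarrow>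
    (\<forall>t. lc_tm 0 t \<longrightarrow> Tr \<alpha> (subst1 x t A) \<longrightarrow> Tr \<alpha> (subst1 x (Succ t) A)) \<longrightarrow>
    (\<forall>t. lc_tm 0 t \<longrightarrow> Tr \<alpha> (subst1 x t A)))"

section \<open>A Henkin construction\<close>

instance tm :: countable by countable_datatype
instance atom :: countable by countable_datatype
instance fm :: countable by countable_datatype

text \<open>Requests that a complete pair of sets of formulae has to meet: deciding a formula, witnessing
  an existential formula on the left or a universal one on the right, and refuting the induction
  step for a formula that is true at zero and false at a term.\<close>

datatype request = Decide fm | WitL fm | WitR fm | IndR fm nat tm

instance request :: countable by countable_datatype

definition fresh_for :: "fm set \<Rightarrow> nat" where
  "fresh_for S = (SOME a. a \<notin> (\<Union>\<phi>\<in>S. fv_fm \<phi>))"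

lemma fresh_for: "finite S \<Longrightarrow> \<phi> \<in> S \<Longrightarrow> fresh_for S \<notin> fv_fm \<phi>"
proof -
  assume S: "finite S" "\<phi> \<in> S"
  then have "\<exists>a. a \<notin> (\<Union>\<phi>\<in>S. fv_fm \<phi>)" by (intro fresh_var) auto
  then have "fresh_for S \<notin> (\<Union>\<phi>\<in>S. fv_fm \<phi>)" unfolding fresh_for_def by (rule someI_ex)
  then show ?thesis using S by blast
qed

context formula_class
begin

text \<open>Deciding prefers the left side; if that is inconsistent, cut makes the right side
  consistent. A request whose condition fails is ignored for the moment and comes up again
  later.\<close>

fun meet :: "request \<Rightarrow> sequent \<Rightarrow> sequent" where
  "meet (Decide \<phi>) (\<Gamma>, \<Delta>) =
     (if \<not> universal \<phi> then (\<Gamma>, \<Delta>) else if entails (insert \<phi> \<Gamma>) \<Delta> then (\<Gamma>, insert \<phi> \<Delta>) else (insert \<phi> \<Gamma>, \<Delta>))"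
| "meet (WitL \<phi>) (\<Gamma>, \<Delta>) =
     (if Exists \<phi> \<in> \<Gamma> \<and> Exists \<phi> \<in> \<Phi> then (insert (inst \<phi> (FVar (fresh_for (\<Gamma> \<union> \<Delta>)))) \<Gamma>, \<Delta>) else (\<Gamma>, \<Delta>))"
| "meet (WitR \<phi>) (\<Gamma>, \<Delta>) =
     (if Forall \<phi> \<in> \<Delta> then (\<Gamma>, insert (inst \<phi> (FVar (fresh_for (\<Gamma> \<union> \<Delta>)))) \<Delta>) else (\<Gamma>, \<Delta>))"
| "meet (IndR A x t) (\<Gamma>, \<Delta>) =
     (if universal A \<and> lc_tm 0 t \<and> subst1 x Zero A \<in> \<Gamma> \<and> subst1 x t A \<in> \<Delta>
      then (let a = fresh_for (insert A (\<Gamma> \<union> \<Delta>)) in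
        (insert (subst1 x (FVar a) A) \<Gamma>, insert (subst1 x (Succ (FVar a)) A) \<Delta>))
      else (\<Gamma>, \<Delta>))"

definition consistent :: "sequent \<Rightarrow> bool" where
  "consistent s \<longleftrightarrow> finite (fst s) \<and> finite (snd s) \<and> \<not> entails (fst s) (snd s)"

lemma meet_extends: "fst s \<subseteq> fst (meet q s) \<and> snd s \<subseteq> snd (meet q s)"
  by (cases s; cases q) (auto simp: Let_def)

lemma fresh_for_sequent:
  "finite \<Gamma> \<Longrightarrow> finite \<Delta> \<Longrightarrow> fresh_for (\<Gamma> \<union> \<Delta>) \<notin> fv_sequent (\<Gamma>, \<Delta>)"
  using fresh_for[of "\<Gamma> \<union> \<Delta>"] by (auto simp: fv_sequent_def)

text \<open>Each case is the contrapositive of a closure property of \<open>entails\<close>: cut,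
  the two witnessing rules, and induction.\<close>

lemma meet_consistent:
  assumes "consistent s"
  shows "consistent (meet q s)"
proof -
  obtain \<Gamma> \<Delta> where s: "s = (\<Gamma>, \<Delta>)" by fastforce
  have fin: "finite \<Gamma>" "finite \<Delta>" and nR: "\<not> entails \<Gamma> \<Delta>" using assms s by (auto simp: consistent_def)
  show ?thesis
  proof (cases q)
    case (Decide \<phi>)
    then show ?thesis using fin nR entails_cut[of \<Gamma> \<phi> \<Delta>] by (auto simp: s consistent_def)
  next
    case (WitL \<phi>)
    then show ?thesis
      using fin nR entails_existsW[OF _ _ fresh_for_sequent[OF fin], of \<phi>] by (auto simp: s consistent_def)
  next
    case (WitR \<phi>)
    then show ?thesis
      using fin nR entails_forallW[OF _ fresh_for_sequent[OF fin], of \<phi>] by (auto simp: s consistent_def)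
  next
    case (IndR A x t)
    let ?a = "fresh_for (insert A (\<Gamma> \<union> \<Delta>))"
    have "?a \<notin> fv_sequent (\<Gamma>, \<Delta>)" "?a \<notin> fv_fm A"
      using fresh_for[of "insert A (\<Gamma> \<union> \<Delta>)"] fin by (auto simp: fv_sequent_def)
    then show ?thesis
      using fin nR IndR entails_ind[of A \<Gamma> \<Delta> ?a x t] by (auto simp: s consistent_def Let_def)
  qed
qed

text \<open>The first component of the decoded stage selects the request; the second makes every
  request recur beyond any given stage.\<close>

fun chain :: "sequent \<Rightarrow> nat \<Rightarrow> sequent" where
  "chain s 0 = s"
| "chain s (Suc k) = meet (from_nat (fst (prod_decode k))) (chain s k)"

lemma chain_consistent: "consistent s \<Longrightarrow> consistent (chain s k)"
  by (induction k) (auto intro: meet_consistent)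

lemma chain_mono:
  assumes "j \<le> k"
  shows "fst (chain s j) \<subseteq> fst (chain s k) \<and> snd (chain s j) \<subseteq> snd (chain s k)"
proof
  show "fst (chain s j) \<subseteq> fst (chain s k)"
    by (rule lift_Suc_mono_le[OF _ assms]) (simp add: meet_extends)
  show "snd (chain s j) \<subseteq> snd (chain s k)"
    by (rule lift_Suc_mono_le[OF _ assms]) (simp add: meet_extends)
qed

lemma chain_meets:
  obtains k where "j \<le> k" "chain s (Suc k) = meet q (chain s k)"
proof (rule that)
  show "j \<le> prod_encode (to_nat q, j)" by (rule le_prod_encode_2)
qed simp

section \<open>The limit of the chain\<close>

definition limL :: "sequent \<Rightarrow> fm set" where
  "limL s = (\<Union>k. fst (chain s k))"

definition limR :: "sequent \<Rightarrow> fm set" where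
  "limR s = (\<Union>k. snd (chain s k))"

lemma chain_sub_lim: "fst (chain s k) \<subseteq> limL s" "snd (chain s k) \<subseteq> limR s"
  by (auto simp: limL_def limR_def)

lemma finite_in_chain:
  assumes "finite G" "finite E" "G \<subseteq> limL s" "E \<subseteq> limR s"
  shows "\<exists>k. G \<subseteq> fst (chain s k) \<and> E \<subseteq> snd (chain s k)"
proof -
  have "\<exists>k. G \<subseteq> fst (chain s k)"
    using assms(1,3)
  proof (induction rule: finite_induct)
    case (insert \<phi> G)
    then obtain j k where "G \<subseteq> fst (chain s k)" "\<phi> \<in> fst (chain s j)" by (auto simp: limL_def)
    then show ?case
      using chain_mono[of j "max j k" s] chain_mono[of k "max j k" s]
      by (intro exI[of _ "max j k"]) auto
  qed simp
  moreover have "\<exists>k. E \<subseteq> snd (chain s k)"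
    using assms(2,4)
  proof (induction rule: finite_induct)
    case (insert \<phi> G)
    then obtain j k where "G \<subseteq> snd (chain s k)" "\<phi> \<in> snd (chain s j)" by (auto simp: limR_def)
    then show ?case
      using chain_mono[of j "max j k" s] chain_mono[of k "max j k" s]
      by (intro exI[of _ "max j k"]) auto
  qed simp
  ultimately obtain j k where "G \<subseteq> fst (chain s j)" "E \<subseteq> snd (chain s k)" by blast
  then show ?thesis
    using chain_mono[of j "max j k" s] chain_mono[of k "max j k" s]
    by (intro exI[of _ "max j k"]) auto
qed

lemma lim_consistent:
  assumes "consistent s" "finite G" "finite E" "G \<subseteq> limL s" "E \<subseteq> limR s"
  shows "\<not> entails G E"
proof -
  obtain k where "G \<subseteq> fst (chain s k)" "E \<subseteq> snd (chain s k)"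
    using finite_in_chain[OF assms(2-5)] by blast
  then show ?thesis
    using chain_consistent[OF assms(1), of k] entails_mono[of G E "fst (chain s k)" "snd (chain s k)"]
    by (auto simp: consistent_def)
qed

lemma lim_decides: "universal \<phi> \<Longrightarrow> \<phi> \<in> limL s \<or> \<phi> \<in> limR s"
proof -
  assume "universal \<phi>"
  obtain k where k: "chain s (Suc k) = meet (Decide \<phi>) (chain s k)" using chain_meets by blast
  obtain \<Gamma> \<Delta> where "chain s k = (\<Gamma>, \<Delta>)" by fastforce
  then have "\<phi> \<in> fst (chain s (Suc k)) \<or> \<phi> \<in> snd (chain s (Suc k))"
    using k \<open>universal \<phi>\<close> by simp
  then show ?thesis using chain_sub_lim by blast
qed

lemma lim_iff: "consistent s \<Longrightarrow> universal \<phi> \<Longrightarrow> \<phi> \<in> limR s \<longleftrightarrow> \<phi> \<notin> limL s"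
  using lim_decides[of \<phi> s] lim_consistent[of s "{\<phi>}" "{\<phi>}"] entails_ident[of \<phi> "{\<phi>}" "{\<phi>}"] by auto

lemma lim_WitL:
  assumes "Exists \<phi> \<in> limL s" "Exists \<phi> \<in> \<Phi>"
  shows "\<exists>t. lc_tm 0 t \<and> inst \<phi> t \<in> limL s"
proof -
  obtain j where j: "Exists \<phi> \<in> fst (chain s j)" using assms by (auto simp: limL_def)
  obtain k where k: "j \<le> k" "chain s (Suc k) = meet (WitL \<phi>) (chain s k)" using chain_meets by blast
  obtain \<Gamma> \<Delta> where c: "chain s k = (\<Gamma>, \<Delta>)" by fastforce
  have "Exists \<phi> \<in> \<Gamma>" using j chain_mono[OF k(1), of s] c by auto
  then have "\<exists>a. inst \<phi> (FVar a) \<in> fst (chain s (Suc k))"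
    using k(2) c assms(2) by auto
  then show ?thesis using chain_sub_lim(1)[of s "Suc k"] by (metis lc_tm.simps(1) subsetD)
qed

lemma lim_WitR:
  assumes "Forall \<phi> \<in> limR s"
  shows "\<exists>t. lc_tm 0 t \<and> inst \<phi> t \<in> limR s"
proof -
  obtain j where j: "Forall \<phi> \<in> snd (chain s j)" using assms by (auto simp: limR_def)
  obtain k where k: "j \<le> k" "chain s (Suc k) = meet (WitR \<phi>) (chain s k)" using chain_meets by blast
  obtain \<Gamma> \<Delta> where c: "chain s k = (\<Gamma>, \<Delta>)" by fastforce
  have "Forall \<phi> \<in> \<Delta>" using j chain_mono[OF k(1), of s] c by auto
  then have "\<exists>a. inst \<phi> (FVar a) \<in> snd (chain s (Suc k))"
    using k(2) c by auto
  then show ?thesis using chain_sub_lim(2)[of s "Suc k"] by (metis lc_tm.simps(1) subsetD)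
qed

lemma lim_IndR:
  assumes "universal A" "lc_tm 0 t" "subst1 x Zero A \<in> limL s" "subst1 x t A \<in> limR s"
  shows "\<exists>u. lc_tm 0 u \<and> subst1 x u A \<in> limL s \<and> subst1 x (Succ u) A \<in> limR s"
proof -
  obtain j where j: "{subst1 x Zero A} \<subseteq> fst (chain s j)" "{subst1 x t A} \<subseteq> snd (chain s j)"
    using finite_in_chain[of "{subst1 x Zero A}" "{subst1 x t A}" s] assms by auto
  obtain k where k: "j \<le> k" "chain s (Suc k) = meet (IndR A x t) (chain s k)" using chain_meets by blast
  obtain \<Gamma> \<Delta> where c: "chain s k = (\<Gamma>, \<Delta>)" by fastforce
  have "subst1 x Zero A \<in> \<Gamma>" "subst1 x t A \<in> \<Delta>" using j chain_mono[OF k(1), of s] c by auto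
  then have "\<exists>a. subst1 x (FVar a) A \<in> fst (chain s (Suc k)) \<and>
      subst1 x (Succ (FVar a)) A \<in> snd (chain s (Suc k))"
    using k(2) c assms(1,2) by (auto simp: Let_def)
  then show ?thesis using chain_sub_lim[of s "Suc k"] by (metis lc_tm.simps(1) subsetD)
qed

section \<open>The canonical term model\<close>

definition canon :: "sequent \<Rightarrow> atom \<Rightarrow> bool" where
  "canon s a \<longleftrightarrow> Pos a \<in> limL s"

lemma lim_derive:
  assumes "consistent s" "entails G {\<phi>}" "finite G" "G \<subseteq> limL s" "universal \<phi>"
  shows "\<phi> \<in> limL s"
  using assms lim_consistent[of s G "{\<phi>}"] lim_iff[of s \<phi>] by auto

text \<open>A universal formula that is not a quantification \<open>Forall\<close> lies in the
  class, so the rules for class formulae cover the propositional and existential cases. Witnesses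
  come from the requests, and the quantifier cases pass to instances, hence the induction on
  \<open>cpx\<close>.\<close>

lemma truth:
  assumes s: "consistent s"
  shows "universal \<phi> \<Longrightarrow> Tr (canon s) \<phi> \<longleftrightarrow> \<phi> \<in> limL s"
proof (induction "cpx \<phi>" arbitrary: \<phi> rule: less_induct)
  case less
  have cls: "\<phi> \<in> \<Phi>" if "\<And>\<psi>. \<phi> \<noteq> Forall \<psi>" using less.prems that by (cases rule: universal.cases) auto
  have lc: "lc_fm 0 \<phi>" using less.prems by (rule universal_lc)
  show ?case
  proof (cases \<phi>)
    case (Pos a)
    then show ?thesis by (simp add: canon_def)
  next
    case (Neg a)
    then have a: "lc_atom 0 a" using lc by simp
    have FA: "universal (Pos a)" "universal (Neg a)" using universal_class[OF class_Pos[OF a]] universal_class[OF class_Neg[OF a]] .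
    have "\<not> (Pos a \<in> limL s \<and> Neg a \<in> limL s)"
      using lim_consistent[OF s, of "{Pos a, Neg a}" "{}"] entails_negL[OF a] by auto
    moreover have "\<not> (Pos a \<in> limR s \<and> Neg a \<in> limR s)"
      using lim_consistent[OF s, of "{}" "{Pos a, Neg a}"] entails_negR[OF a] by auto
    ultimately show ?thesis using Neg lim_iff[OF s FA(1)] lim_iff[OF s FA(2)] by (auto simp: canon_def)
  next
    case (Conj \<psi> \<chi>)
    then have \<Phi>: "Conj \<psi> \<chi> \<in> \<Phi>" using cls by auto
    note \<Phi>' = class_Conj[OF \<Phi>]
    have IH: "Tr (canon s) \<psi> \<longleftrightarrow> \<psi> \<in> limL s" "Tr (canon s) \<chi> \<longleftrightarrow> \<chi> \<in> limL s"
      using less.hyps[of \<psi>] less.hyps[of \<chi>] \<Phi>' Conj by (auto intro: universal_class)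
    have "\<psi> \<in> limL s" "\<chi> \<in> limL s" if "Conj \<psi> \<chi> \<in> limL s"
      using lim_derive[OF s entails_conjL[OF \<Phi>] _ _ universal_class] that \<Phi>' by simp_all
    moreover have "Conj \<psi> \<chi> \<in> limL s" if "\<psi> \<in> limL s" "\<chi> \<in> limL s"
      by (rule lim_derive[OF s entails_conjR[OF \<Phi>] _ _ universal_class[OF \<Phi>]]) (use that in auto)
    ultimately show ?thesis
      unfolding Conj Tr.simps IH by blast
  next
    case (Disj \<psi> \<chi>)
    then have \<Phi>: "Disj \<psi> \<chi> \<in> \<Phi>" using cls by auto
    note \<Phi>' = class_Disj[OF \<Phi>]
    have IH: "Tr (canon s) \<psi> \<longleftrightarrow> \<psi> \<in> limL s" "Tr (canon s) \<chi> \<longleftrightarrow> \<chi> \<in> limL s"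
      using less.hyps[of \<psi>] less.hyps[of \<chi>] \<Phi>' Disj by (auto intro: universal_class)
    have "\<not> (Disj \<psi> \<chi> \<in> limL s \<and> \<psi> \<in> limR s \<and> \<chi> \<in> limR s)"
      using lim_consistent[OF s, of "{Disj \<psi> \<chi>}" "{\<psi>, \<chi>}"] entails_disjL[OF \<Phi>] by auto
    then have "\<psi> \<in> limL s \<or> \<chi> \<in> limL s" if "Disj \<psi> \<chi> \<in> limL s"
      using that \<Phi>' lim_decides[OF universal_class] by blast
    moreover have "Disj \<psi> \<chi> \<in> limL s" if "\<psi> \<in> limL s \<or> \<chi> \<in> limL s"
      using lim_derive[OF s entails_disjR[OF \<Phi>] _ _ universal_class[OF \<Phi>]] that by force
    ultimately show ?thesis
      unfolding Disj Tr.simps IH by blast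
  next
    case (Forall \<psi>)
    have Fi: "universal (inst \<psi> t)" if "lc_tm 0 t" for t using universal_Forall_inst less.prems Forall that by simp
    have IH: "Tr (canon s) (inst \<psi> t) \<longleftrightarrow> inst \<psi> t \<in> limL s" if "lc_tm 0 t" for t
      using less.hyps[of "inst \<psi> t"] Forall Fi[OF that] by simp
    have "inst \<psi> t \<in> limL s" if "Forall \<psi> \<in> limL s" "lc_tm 0 t" for t
      using lim_derive[OF s entails_forallL[OF that(2)]] that Fi by simp
    moreover have "Forall \<psi> \<in> limL s" if all: "\<forall>t. lc_tm 0 t \<longrightarrow> inst \<psi> t \<in> limL s"
    proof (rule ccontr)
      assume "Forall \<psi> \<notin> limL s"
      then have "Forall \<psi> \<in> limR s" using lim_iff[OF s less.prems] Forall by simp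
      then obtain t where "lc_tm 0 t" "inst \<psi> t \<in> limR s" using lim_WitR by blast
      then show False using all lim_iff[OF s Fi] by blast
    qed
    ultimately show ?thesis using Forall IH by auto
  next
    case (Exists \<psi>)
    then have \<Phi>: "Exists \<psi> \<in> \<Phi>" using cls by auto
    have IH: "Tr (canon s) (inst \<psi> t) \<longleftrightarrow> inst \<psi> t \<in> limL s" if "lc_tm 0 t" for t
      using less.hyps[of "inst \<psi> t"] Exists class_Exists[OF \<Phi> that] by (simp add: universal_class)
    have "Exists \<psi> \<in> limL s" if "inst \<psi> t \<in> limL s" "lc_tm 0 t" for t
      using lim_derive[OF s entails_existsR[OF \<Phi> that(2)]] that universal_class[OF \<Phi>] by simp
    then show ?thesis using lim_WitL[OF _ \<Phi>, of s] Exists IH by auto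
  qed
qed

lemma canon_model:
  assumes s: "consistent s"
  shows "arith_model (canon s)"
proof -
  have FA: "universal (Pos a)" "universal (Neg a)" if "lc_atom 0 a" for a
    using that class_Pos class_Neg universal_class by auto
  have der: "\<phi> \<in> limL s"
    if "Q_initial (G, {\<phi>})" "\<forall>\<psi>\<in>insert \<phi> G. lc_fm 0 \<psi>" "finite G" "G \<subseteq> limL s" "universal \<phi>" for G \<phi>
    by (rule lim_derive[OF s entails_Q[OF that(1)] that(3-5)]) (use that(2) in auto)
  have tN: "Tr (canon s) (Neg a) \<longleftrightarrow> Neg a \<in> limL s" if "lc_atom 0 a" for a
    using truth[OF s FA(2)[OF that]] .
  have tE: "Tr (canon s) (Exists (Pos a)) \<longleftrightarrow> Exists (Pos a) \<in> limL s" if "Exists (Pos a) \<in> \<Phi>" for a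
    using truth[OF s universal_class[OF that]] .
  show ?thesis
  proof
    fix t assume t: "lc_tm 0 t"
    show "canon s (Eq t t)"
      using lim_derive[OF s entails_refl[OF t]] FA t by (simp add: canon_def)
    show "\<not> canon s (Eq (Succ t) Zero)"
      using tN[of "Eq (Succ t) Zero"] der[OF Q_initial.intros(1)[of t]] t FA by simp
    show "canon s (Eq (Plus t Zero) t)"
      using der[OF Q_initial.intros(4)[of t]] t FA by (simp add: canon_def)
    show "canon s (Eq (Times t Zero) Zero)"
      using der[OF Q_initial.intros(6)[of t]] t FA by (simp add: canon_def)
    show "\<exists>u. lc_tm 0 u \<and> canon s (Eq t (Succ u))" if "\<not> canon s (Eq t Zero)"
    proof -
      have "Neg (Eq t Zero) \<in> limL s" using tN[of "Eq t Zero"] that t by simp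
      moreover have E: "Exists (Pos (Eq t (Succ (BVar 0)))) \<in> \<Phi>" using t by (rule class_succ)
      moreover have "lc_tm (Suc 0) t" using lc_tm_mono t by blast
      ultimately have "Exists (Pos (Eq t (Succ (BVar 0)))) \<in> limL s"
        using der[OF Q_initial.intros(3)[OF t]] t universal_class[OF E] by auto
      then have "Tr (canon s) (Exists (Pos (Eq t (Succ (BVar 0)))))" using tE[OF E] by blast
      then show ?thesis using t by (simp add: inst_succ)
    qed
  next
    fix t u assume tu: "lc_tm 0 t" "lc_tm 0 u"
    show "canon s (Eq t u)" if "canon s (Eq (Succ t) (Succ u))"
      using der[OF Q_initial.intros(2)[of t u]] that tu FA by (auto simp: canon_def)
    show "canon s (Eq (Plus t (Succ u)) (Succ (Plus t u)))"
      using der[OF Q_initial.intros(5)[of t u]] tu FA by (simp add: canon_def)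
    show "canon s (Eq (Times t (Succ u)) (Plus (Times t u) t))"
      using der[OF Q_initial.intros(7)[of t u]] tu FA by (simp add: canon_def)
    have E: "Exists (Pos (Eq (Plus t (Succ (BVar 0))) u)) \<in> \<Phi>" using tu by (rule class_less)
    have lc: "lc_tm (Suc 0) t" "lc_tm (Suc 0) u" using lc_tm_mono tu by blast+
    have "canon s (Lt t u) \<longleftrightarrow> Exists (Pos (Eq (Plus t (Succ (BVar 0))) u)) \<in> limL s"
      using der[OF Q_initial.intros(8)[OF tu]] der[OF Q_initial.intros(9)[OF tu]] tu lc FA universal_class[OF E]
      by (auto simp: canon_def)
    also have "\<dots> \<longleftrightarrow> Tr (canon s) (Exists (Pos (Eq (Plus t (Succ (BVar 0))) u)))" using tE[OF E] by blast
    finally show "canon s (Lt t u) \<longleftrightarrow> (\<exists>v. lc_tm 0 v \<and> canon s (Eq (Plus t (Succ v)) u))"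
      using tu by (simp add: inst_less)
    fix a v assume a: "lc_atom 0 a" "canon s (Eq t u)" "canon s (sub_atom (FVar(v := t)) a)"
    then show "canon s (sub_atom (FVar(v := u)) a)"
      using lim_derive[OF s entails_subst[OF tu a(1), of v]] FA tu by (auto simp: canon_def lc_sub_atom lc_sub_upd)
  qed
qed

text \<open>If induction failed at \<open>t\<close>, the request \<open>IndR\<close> would have put
  a counterexample to the induction step into the limit.\<close>

lemma canon_induction:
  assumes s: "consistent s" and A: "universal A"
  shows "models_induction (canon s) A"
  unfolding models_induction_def
proof (intro allI impI)
  fix x t
  assume 0: "Tr (canon s) (subst1 x Zero A)" and
    S: "\<forall>t. lc_tm 0 t \<longrightarrow> Tr (canon s) (subst1 x t A) \<longrightarrow> Tr (canon s) (subst1 x (Succ t) A)"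
    and t: "lc_tm 0 t"
  have FA: "universal (subst1 x u A)" if "lc_tm 0 u" for u
    using A that by (simp add: subst1_def universal_sub lc_sub_upd)
  have tr: "Tr (canon s) (subst1 x u A) \<longleftrightarrow> subst1 x u A \<in> limL s" if "lc_tm 0 u" for u
    using truth[OF s FA[OF that]] .
  show "Tr (canon s) (subst1 x t A)"
  proof (rule ccontr)
    assume "\<not> ?thesis"
    then have "subst1 x t A \<in> limR s" using lim_iff[OF s FA[OF t]] tr[OF t] by blast
    moreover have "subst1 x Zero A \<in> limL s" using 0 tr by simp
    ultimately obtain u where u: "lc_tm 0 u" "subst1 x u A \<in> limL s" "subst1 x (Succ u) A \<in> limR s"
      using lim_IndR[OF A t] by blast
    then show False using S tr lim_iff[OF s FA] by auto
  qed
qed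

theorem countermodel:
  assumes "\<not> entails {} {\<phi>}" "universal \<phi>"
  obtains \<alpha> where "arith_model \<alpha>" "\<And>A. universal A \<Longrightarrow> models_induction \<alpha> A" "\<not> Tr \<alpha> \<phi>"
proof -
  let ?s = "({}, {\<phi>})"
  have s: "consistent ?s" using assms by (simp add: consistent_def)
  have "\<phi> \<in> limR ?s" using chain_sub_lim(2)[of ?s 0] by simp
  then have "\<not> Tr (canon ?s) \<phi>" using truth[OF s assms(2)] lim_iff[OF s assms(2)] by blast
  then show ?thesis using that canon_model canon_induction s by blast
qed

end

section \<open>Soundness\<close>

lemma neg_open: "open_fm k u (neg \<phi>) = neg (open_fm k u \<phi>)"
  by (induction \<phi> arbitrary: k) auto

lemma neg_sub: "sub_fm \<sigma> (neg \<phi>) = neg (sub_fm \<sigma> \<phi>)"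
  by (induction \<phi>) auto

lemma fv_neg [simp]: "fv_fm (neg \<phi>) = fv_fm \<phi>"
  by (induction \<phi>) auto

lemma lc_neg [simp]: "lc_fm k (neg \<phi>) = lc_fm k \<phi>"
  by (induction \<phi> arbitrary: k) auto

lemma Tr_neg [simp]: "Tr \<alpha> (neg \<phi>) \<longleftrightarrow> \<not> Tr \<alpha> \<phi>"
proof (induction "cpx \<phi>" arbitrary: \<phi> rule: less_induct)
  case less
  show ?case
  proof (cases \<phi>)
    case (Conj \<psi> \<chi>)
    then show ?thesis using less[of \<psi>] less[of \<chi>] by simp
  next
    case (Disj \<psi> \<chi>)
    then show ?thesis using less[of \<psi>] less[of \<chi>] by simp
  next
    case (Forall \<psi>)
    then show ?thesis using less[of "inst \<psi> t" for t] by (simp add: inst_def neg_open[symmetric])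
  next
    case (Exists \<psi>)
    then show ?thesis using less[of "inst \<psi> t" for t] by (simp add: inst_def neg_open[symmetric])
  qed auto
qed

lemma Tr_imp [simp]: "Tr \<alpha> (imp \<phi> \<psi>) \<longleftrightarrow> (Tr \<alpha> \<phi> \<longrightarrow> Tr \<alpha> \<psi>)"
  by (simp add: imp_def)

lemma sub_imp [simp]: "sub_fm \<sigma> (imp \<phi> \<psi>) = imp (sub_fm \<sigma> \<phi>) (sub_fm \<sigma> \<psi>)"
  by (simp add: imp_def neg_sub)

lemma lc_imp [simp]: "lc_fm k (imp \<phi> \<psi>) \<longleftrightarrow> lc_fm k \<phi> \<and> lc_fm k \<psi>"
  by (simp add: imp_def)

lemma inst_sub_close:
  assumes "lc_sub \<sigma>" "lc_fm 0 \<phi>" "lc_tm 0 t"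
  shows "inst (sub_fm \<sigma> (close_fm 0 x \<phi>)) t = sub_fm (\<sigma>(x := t)) \<phi>"
  using inst_sub[OF assms(1,3), of x "close_fm 0 x \<phi>"] assms(2)
  by (simp add: fv_close_fm inst_close)

lemma Tr_allv:
  assumes "lc_sub \<sigma>" "lc_fm 0 \<phi>"
  shows "Tr \<alpha> (sub_fm \<sigma> (allv x \<phi>)) \<longleftrightarrow> (\<forall>t. lc_tm 0 t \<longrightarrow> Tr \<alpha> (sub_fm (\<sigma>(x := t)) \<phi>))"
  using assms by (simp add: allv_def inst_sub_close)

lemma Tr_exv:
  assumes "lc_sub \<sigma>" "lc_fm 0 \<phi>"
  shows "Tr \<alpha> (sub_fm \<sigma> (exv x \<phi>)) \<longleftrightarrow> (\<exists>t. lc_tm 0 t \<and> Tr \<alpha> (sub_fm (\<sigma>(x := t)) \<phi>))"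
  using assms by (auto simp: exv_def inst_sub_close)

lemma lc_allv: "lc_fm 0 \<phi> \<Longrightarrow> lc_fm 0 (allv x \<phi>)"
  by (simp add: allv_def lc_close_fm)

lemma lc_exv: "lc_fm 0 \<phi> \<Longrightarrow> lc_fm 0 (exv x \<phi>)"
  by (simp add: exv_def lc_close_fm)

lemma lc_foldr_allv: "lc_fm 0 \<phi> \<Longrightarrow> lc_fm 0 (foldr allv xs \<phi>)"
  by (induction xs) (auto simp: lc_allv)

lemma fv_foldr_allv: "fv_fm (foldr allv xs \<phi>) = fv_fm \<phi> - set xs"
  by (induction xs) (auto simp: allv_def fv_close_fm)

lemma sentence_univ_closure: "lc_fm 0 \<phi> \<Longrightarrow> sentence (univ_closure \<phi>)"
  by (simp add: sentence_def univ_closure_def lc_foldr_allv fv_foldr_allv)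

lemma Tr_univ_closure:
  assumes "lc_fm 0 \<phi>" "\<And>\<sigma>. lc_sub \<sigma> \<Longrightarrow> Tr \<alpha> (sub_fm \<sigma> \<phi>)" "lc_sub \<sigma>"
  shows "Tr \<alpha> (sub_fm \<sigma> (univ_closure \<phi>))"
proof -
  have "Tr \<alpha> (sub_fm \<sigma> (foldr allv xs \<phi>))" for xs
    using assms(3)
  proof (induction xs arbitrary: \<sigma>)
    case Nil
    then show ?case using assms(2) by simp
  next
    case (Cons x xs)
    have "Tr \<alpha> (sub_fm (\<sigma>(x := t)) (foldr allv xs \<phi>))" if "lc_tm 0 t" for t
      by (rule Cons.IH[OF lc_sub_upd[OF Cons.prems that]])
    then show ?case using Tr_allv[OF Cons.prems lc_foldr_allv[OF assms(1)]] by simp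
  qed
  then show ?thesis by (simp add: univ_closure_def)
qed

section \<open>Soundness of the finite calculus in an arithmetic model\<close>

context arith_model
begin

lemma eq_sym: "lc_tm 0 t \<Longrightarrow> lc_tm 0 u \<Longrightarrow> \<alpha> (Eq t u) \<Longrightarrow> \<alpha> (Eq u t)"
proof -
  assume a: "lc_tm 0 t" "lc_tm 0 u" "\<alpha> (Eq t u)"
  obtain v where v: "v \<notin> fv_tm t" using fresh_var finite_fv_tm by blast
  have "sub_tm (FVar(v := r)) t = t" for r using v by (intro sub_tm_id) auto
  then show ?thesis using eq_subst[of t u "Eq (FVar v) t" v] a eq_refl[of t] by simp
qed

lemma eq_trans:
  "lc_tm 0 t \<Longrightarrow> lc_tm 0 u \<Longrightarrow> lc_tm 0 r \<Longrightarrow> \<alpha> (Eq t u) \<Longrightarrow> \<alpha> (Eq u r) \<Longrightarrow> \<alpha> (Eq t r)"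
proof -
  assume a: "lc_tm 0 t" "lc_tm 0 u" "lc_tm 0 r" "\<alpha> (Eq t u)" "\<alpha> (Eq u r)"
  obtain v where v: "v \<notin> fv_tm t" using fresh_var finite_fv_tm by blast
  have "sub_tm (FVar(v := r)) t = t" for r using v by (intro sub_tm_id) auto
  then show ?thesis using eq_subst[of u r "Eq t (FVar v)" v] a by simp
qed

lemma eq_succ: "lc_tm 0 t \<Longrightarrow> lc_tm 0 u \<Longrightarrow> \<alpha> (Eq t u) \<Longrightarrow> \<alpha> (Eq (Succ t) (Succ u))"
proof -
  assume a: "lc_tm 0 t" "lc_tm 0 u" "\<alpha> (Eq t u)"
  obtain v where v: "v \<notin> fv_tm t" using fresh_var finite_fv_tm by blast
  have "sub_tm (FVar(v := r)) t = t" for r using v by (intro sub_tm_id) auto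
  then show ?thesis using eq_subst[of t u "Eq (Succ t) (Succ (FVar v))" v] a eq_refl[of "Succ t"] by simp
qed

text \<open>Stated for arbitrary \<open>\<sigma>\<close> because the quantifier case, after opening
  the body with a fresh \<open>b\<close>, continues with \<open>\<sigma>\<close> extended at
  \<open>b\<close>.\<close>

lemma Tr_sub_eq:
  assumes "lc_tm 0 t" "lc_tm 0 u" "\<alpha> (Eq t u)"
  shows "lc_fm 0 \<phi> \<Longrightarrow> lc_sub \<sigma> \<Longrightarrow> Tr \<alpha> (sub_fm (\<sigma>(x := t)) \<phi>) \<longleftrightarrow> Tr \<alpha> (sub_fm (\<sigma>(x := u)) \<phi>)"
proof (induction "cpx \<phi>" arbitrary: \<phi> \<sigma> rule: less_induct)
  case less
  have atom: "\<alpha> (sub_atom (\<sigma>(x := t)) a) \<longleftrightarrow> \<alpha> (sub_atom (\<sigma>(x := u)) a)" if a: "lc_atom 0 a" for a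
  proof -
    have "finite (\<Union>y\<in>fv_atom a. fv_tm (\<sigma> y))" by simp
    then obtain z where z: "z \<notin> (\<Union>y\<in>fv_atom a. fv_tm (\<sigma> y))" using fresh_var by blast
    \<comment> \<open>A fresh \<open>z\<close> keeps the replaced occurrences of \<open>x\<close>
      apart from variables that \<open>\<sigma>\<close> introduces elsewhere.\<close>
    have s: "sub_atom (\<sigma>(x := r)) a = sub_atom (FVar(z := r)) (sub_atom (\<sigma>(x := FVar z)) a)" for r
      unfolding sub_atom_comp using z by (intro sub_atom_cong) (auto intro!: sub_tm_id[symmetric])
    have "lc_atom 0 (sub_atom (\<sigma>(x := FVar z)) a)"
      using a less.prems by (simp add: lc_sub_atom lc_sub_upd)
    then show ?thesis
      using eq_subst[of t u _ z] eq_subst[of u t _ z] eq_sym[of t u] assms unfolding s[of t] s[of u] by blast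
  qed
  have q: "Tr \<alpha> (inst (sub_fm (\<sigma>(x := t)) \<psi>) r) \<longleftrightarrow> Tr \<alpha> (inst (sub_fm (\<sigma>(x := u)) \<psi>) r)"
    if \<psi>: "cpx \<psi> < cpx \<phi>" "lc_fm (Suc 0) \<psi>" and r: "lc_tm 0 r" for \<psi> r
  proof -
    obtain b where b: "b \<notin> insert x (fv_fm \<psi>)" using fresh_var[of "insert x (fv_fm \<psi>)"] by auto
    have e: "inst (sub_fm (\<sigma>(x := v)) \<psi>) r = sub_fm ((\<sigma>(b := r))(x := v)) (inst \<psi> (FVar b))"
      if "lc_tm 0 v" for v
      using inst_sub[of "\<sigma>(x := v)" r b \<psi>] less.prems b r that by (simp add: lc_sub_upd fun_upd_twist)
    show ?thesis
      unfolding e[OF assms(1)] e[OF assms(2)]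
      using \<psi> r less.prems by (intro less.hyps) (auto simp: lc_inst lc_sub_upd)
  qed
  show ?case
  proof (cases \<phi>)
    case (Conj \<psi> \<chi>)
    then show ?thesis using less.hyps[of \<psi> \<sigma>] less.hyps[of \<chi> \<sigma>] less.prems by simp
  next
    case (Disj \<psi> \<chi>)
    then show ?thesis using less.hyps[of \<psi> \<sigma>] less.hyps[of \<chi> \<sigma>] less.prems by simp
  qed (use less.prems atom q in auto)
qed

definition valid :: "sequent \<Rightarrow> bool" where
  "valid s \<longleftrightarrow> (\<forall>\<sigma>. lc_sub \<sigma> \<longrightarrow> (\<forall>\<phi>\<in>fst s. Tr \<alpha> (sub_fm \<sigma> \<phi>)) \<longrightarrow> (\<exists>\<phi>\<in>snd s. Tr \<alpha> (sub_fm \<sigma> \<phi>)))"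

lemma step_sound:
  assumes "step r ps s" "\<And>p. p \<in> set ps \<Longrightarrow> valid p" "wf_sequent s"
  shows "valid s"
  unfolding valid_def
proof (intro allI impI)
  fix \<sigma> assume \<sigma>: "lc_sub \<sigma>" and L: "\<forall>\<phi>\<in>fst s. Tr \<alpha> (sub_fm \<sigma> \<phi>)"
  have prem: "\<exists>\<phi>\<in>snd p. Tr \<alpha> (sub_fm \<tau> \<phi>)"
    if "p \<in> set ps" "lc_sub \<tau>" "\<forall>\<phi>\<in>fst p. Tr \<alpha> (sub_fm \<tau> \<phi>)" for p \<tau>
    using assms(2)[OF that(1)] that by (auto simp: valid_def)
  have eigen: "inst (sub_fm \<sigma> \<phi>) w = sub_fm (\<sigma>(a := w)) (inst \<phi> (FVar a))"
    if "lc_tm 0 w" "a \<notin> fv_fm \<phi>" for \<phi> w a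
    using inst_sub[OF \<sigma> that] .
  from assms(1) show "\<exists>\<phi>\<in>snd s. Tr \<alpha> (sub_fm \<sigma> \<phi>)"
  proof cases
    case (2 t)
    then have "lc_tm 0 (sub_tm \<sigma> t)" using assms(3) \<sigma> by (simp add: wf_sequent_def lc_sub_tm)
    then show ?thesis using 2 eq_refl by simp
  next
    case (3 t u x \<phi>)
    then have lc: "lc_tm 0 (sub_tm \<sigma> t)" "lc_tm 0 (sub_tm \<sigma> u)" "lc_fm 0 \<phi>"
      using assms(3) \<sigma> by (auto simp: wf_sequent_def lc_sub_tm subst1_def dest: lc_sub_fmD)
    then show ?thesis using 3 L Tr_sub_eq[OF lc(1,2) _ lc(3) \<sigma>, of x] by (simp add: sub_subst1)
  next
    case (6 \<Gamma> \<Gamma>' \<Delta> \<Delta>')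
    then show ?thesis using prem[of "(\<Gamma>, \<Delta>)" \<sigma>] \<sigma> L by auto
  next
    case (7 \<Gamma> \<phi> \<Delta>)
    then show ?thesis using prem[of "(\<Gamma>, insert \<phi> \<Delta>)" \<sigma>] prem[of "(insert \<phi> \<Gamma>, \<Delta>)" \<sigma>] \<sigma> L by auto
  next
    case (8 \<phi> \<psi> \<Gamma> \<Delta>)
    then show ?thesis using prem[of "(insert \<phi> (insert \<psi> \<Gamma>), \<Delta>)" \<sigma>] \<sigma> L by auto
  next
    case (9 \<Gamma> \<phi> \<Delta> \<psi>)
    then show ?thesis using prem[of "(\<Gamma>, insert \<phi> \<Delta>)" \<sigma>] prem[of "(\<Gamma>, insert \<psi> \<Delta>)" \<sigma>] \<sigma> L by auto
  next
    case (10 \<phi> \<Gamma> \<Delta> \<psi>)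
    then show ?thesis using prem[of "(insert \<phi> \<Gamma>, \<Delta>)" \<sigma>] prem[of "(insert \<psi> \<Gamma>, \<Delta>)" \<sigma>] \<sigma> L by auto
  next
    case (11 \<Gamma> \<phi> \<psi> \<Delta>)
    then show ?thesis using prem[of "(\<Gamma>, insert \<phi> (insert \<psi> \<Delta>))" \<sigma>] \<sigma> L by auto
  next
    case (12 t \<phi> \<Gamma> \<Delta>)
    then show ?thesis
      using prem[of "(insert (inst \<phi> t) \<Gamma>, \<Delta>)" \<sigma>] \<sigma> L by (auto simp: sub_inst lc_sub_tm)
  next
    case (13 a \<Gamma> \<phi> \<Delta>)
    then have eq: "sub_fm (\<sigma>(a := w)) \<psi> = sub_fm \<sigma> \<psi>" if "\<psi> \<in> \<Gamma> \<union> \<Delta>" for \<psi> w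
      using that by (intro sub_upd_fresh) (auto simp: fv_sequent_def)
    have a: "a \<notin> fv_fm \<phi>" using 13 by (auto simp: fv_sequent_def)
    show ?thesis
    proof (rule ccontr)
      assume no: "\<not> ?thesis"
      then obtain w where w: "lc_tm 0 w" "\<not> Tr \<alpha> (inst (sub_fm \<sigma> \<phi>) w)" using 13 by auto
      have "\<exists>\<psi>\<in>insert (inst \<phi> (FVar a)) \<Delta>. Tr \<alpha> (sub_fm (\<sigma>(a := w)) \<psi>)"
        using prem[of "(\<Gamma>, insert (inst \<phi> (FVar a)) \<Delta>)" "\<sigma>(a := w)"] 13 w \<sigma> L eq
        by (auto simp: lc_sub_upd)
      then show False using w eq no 13 eigen[OF w(1) a] by auto
    qed
  next
    case (14 a \<phi> \<Gamma> \<Delta>)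
    then have eq: "sub_fm (\<sigma>(a := w)) \<psi> = sub_fm \<sigma> \<psi>" if "\<psi> \<in> \<Gamma> \<union> \<Delta>" for \<psi> w
      using that by (intro sub_upd_fresh) (auto simp: fv_sequent_def)
    have a: "a \<notin> fv_fm \<phi>" using 14 by (auto simp: fv_sequent_def)
    obtain w where w: "lc_tm 0 w" "Tr \<alpha> (inst (sub_fm \<sigma> \<phi>) w)" using 14 L by auto
    have "\<exists>\<psi>\<in>\<Delta>. Tr \<alpha> (sub_fm (\<sigma>(a := w)) \<psi>)"
      using prem[of "(insert (inst \<phi> (FVar a)) \<Gamma>, \<Delta>)" "\<sigma>(a := w)"] 14 w \<sigma> L eq eigen[OF w(1) a]
      by (auto simp: lc_sub_upd)
    then show ?thesis using eq 14 by auto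
  next
    case (15 t \<Gamma> \<phi> \<Delta>)
    then show ?thesis
      using prem[of "(\<Gamma>, insert (inst \<phi> t) \<Delta>)" \<sigma>] \<sigma> L by (auto simp: sub_inst lc_sub_tm)
  next
    case (16 \<theta> \<Gamma> \<Delta>)
    then have "lc_sub (\<lambda>x. sub_tm \<sigma> (\<theta> x))" using \<sigma> by (intro lc_sub_comp) (auto simp: lc_sub_def)
    then show ?thesis
      using 16 prem[of "(\<Gamma>, \<Delta>)" "\<lambda>x. sub_tm \<sigma> (\<theta> x)"] L by (auto simp: sub_fm_comp)
  qed (use L in auto)
qed

lemma derivable_sound:
  assumes "derivable T s" "\<And>\<phi> \<sigma>. \<phi> \<in> T \<Longrightarrow> lc_sub \<sigma> \<Longrightarrow> Tr \<alpha> (sub_fm \<sigma> \<phi>)"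
  shows "valid s"
  using assms(1)
proof (induction rule: derivable.induct)
  case (1 \<phi>)
  then show ?case using assms(2) by (simp add: valid_def)
next
  case (2 r ps s)
  then have "\<And>p. p \<in> set ps \<Longrightarrow> valid p" by blast
  then show ?case using 2 by - (rule step_sound)
qed

lemma Q_axioms_true:
  assumes "\<phi> \<in> Q_axioms" "lc_sub \<sigma>"
  shows "Tr \<alpha> (sub_fm \<sigma> \<phi>)"
proof -
  have lc: "lc_tm 0 (\<sigma> x)" for x using assms(2) by (simp add: lc_sub_def)
  show ?thesis
    using assms(1) unfolding Q_axioms_def Let_def insert_iff empty_iff
    using succ_nonzero[OF lc] succ_inject[OF lc lc] pred_exists[OF lc] plus_zero[OF lc] plus_succ[OF lc lc]
      times_zero[OF lc] times_succ[OF lc lc] less_iff[OF lc lc]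
    by (elim disjE) (auto simp: iff_def Tr_exv assms(2))
qed

end

lemma Q_axioms_lc: "\<phi> \<in> Q_axioms \<Longrightarrow> lc_fm 0 \<phi>"
  by (auto simp: Q_axioms_def Let_def iff_def lc_exv)

section \<open>Closure properties of the hierarchy\<close>

text \<open>The atom that makes the quantifier directly above it bounded. Isolating it reduces
  invariance of \<open>Delta0\<close> under a map to a statement about atoms.\<close>

definition guard :: "atom \<Rightarrow> bool" where
  "guard a \<longleftrightarrow> (\<exists>t. a = Lt (BVar 0) t \<and> 0 \<notin> bv_tm t)"

text \<open>The body of a bounded quantifier, guard included, is itself in \<open>Delta0\<close>,
  since all literals are. Membership can therefore be decided along the structure of the
  formula.\<close>

lemma Delta0_iff:
  "Pos a \<in> Delta0" "Neg a \<in> Delta0"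
  "Conj \<phi> \<psi> \<in> Delta0 \<longleftrightarrow> \<phi> \<in> Delta0 \<and> \<psi> \<in> Delta0"
  "Disj \<phi> \<psi> \<in> Delta0 \<longleftrightarrow> \<phi> \<in> Delta0 \<and> \<psi> \<in> Delta0"
  "Forall \<phi> \<in> Delta0 \<longleftrightarrow> \<phi> \<in> Delta0 \<and> (\<exists>a \<psi>. \<phi> = Disj (Neg a) \<psi> \<and> guard a)"
  "Exists \<phi> \<in> Delta0 \<longleftrightarrow> \<phi> \<in> Delta0 \<and> (\<exists>a \<psi>. \<phi> = Conj (Pos a) \<psi> \<and> guard a)"
proof -
  have C: "\<phi> \<in> Delta0 \<and> \<psi> \<in> Delta0" if "Conj \<phi> \<psi> \<in> Delta0" for \<phi> \<psi>
    using that by cases auto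
  have D: "\<phi> \<in> Delta0 \<and> \<psi> \<in> Delta0" if "Disj \<phi> \<psi> \<in> Delta0" for \<phi> \<psi>
    using that by cases auto
  show "Conj \<phi> \<psi> \<in> Delta0 \<longleftrightarrow> \<phi> \<in> Delta0 \<and> \<psi> \<in> Delta0"
    "Disj \<phi> \<psi> \<in> Delta0 \<longleftrightarrow> \<phi> \<in> Delta0 \<and> \<psi> \<in> Delta0"
    by (auto dest: C D intro: Delta0.intros(3,4))
  show "Forall \<phi> \<in> Delta0 \<longleftrightarrow> \<phi> \<in> Delta0 \<and> (\<exists>a \<psi>. \<phi> = Disj (Neg a) \<psi> \<and> guard a)"
  proof
    assume "Forall \<phi> \<in> Delta0"
    then show "\<phi> \<in> Delta0 \<and> (\<exists>a \<psi>. \<phi> = Disj (Neg a) \<psi> \<and> guard a)"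
      by cases (auto simp: guard_def intro: Delta0.intros(1-4))
  next
    assume "\<phi> \<in> Delta0 \<and> (\<exists>a \<psi>. \<phi> = Disj (Neg a) \<psi> \<and> guard a)"
    then show "Forall \<phi> \<in> Delta0" by (auto simp: guard_def dest: D intro: Delta0.intros(5))
  qed
  show "Exists \<phi> \<in> Delta0 \<longleftrightarrow> \<phi> \<in> Delta0 \<and> (\<exists>a \<psi>. \<phi> = Conj (Pos a) \<psi> \<and> guard a)"
  proof
    assume "Exists \<phi> \<in> Delta0"
    then show "\<phi> \<in> Delta0 \<and> (\<exists>a \<psi>. \<phi> = Conj (Pos a) \<psi> \<and> guard a)"
      by cases (auto simp: guard_def intro: Delta0.intros(1-4))
  next
    assume "\<phi> \<in> Delta0 \<and> (\<exists>a \<psi>. \<phi> = Conj (Pos a) \<psi> \<and> guard a)"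
    then show "Exists \<phi> \<in> Delta0" by (auto simp: guard_def dest: C intro: Delta0.intros(6))
  qed
qed (auto intro: Delta0.intros)

lemma Sigma_Suc_iff: "\<phi> \<in> Sigma_fm (Suc n) \<longleftrightarrow> \<phi> \<in> Pi_fm n \<or> (\<exists>\<psi>. \<phi> = Exists \<psi> \<and> \<psi> \<in> Sigma_fm (Suc n))"
proof
  assume "\<phi> \<in> Sigma_fm (Suc n)"
  then obtain k \<psi> where "\<phi> = (Exists ^^ k) \<psi>" "\<psi> \<in> Pi_fm n" by auto
  then show "\<phi> \<in> Pi_fm n \<or> (\<exists>\<psi>. \<phi> = Exists \<psi> \<and> \<psi> \<in> Sigma_fm (Suc n))" by (cases k) auto
next
  assume "\<phi> \<in> Pi_fm n \<or> (\<exists>\<psi>. \<phi> = Exists \<psi> \<and> \<psi> \<in> Sigma_fm (Suc n))"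
  then show "\<phi> \<in> Sigma_fm (Suc n)"
  proof
    assume "\<phi> \<in> Pi_fm n"
    then show ?thesis by (auto intro: exI[of _ 0])
  next
    assume "\<exists>\<psi>. \<phi> = Exists \<psi> \<and> \<psi> \<in> Sigma_fm (Suc n)"
    then obtain k \<psi> where "\<phi> = (Exists ^^ Suc k) \<psi>" "\<psi> \<in> Pi_fm n" by auto
    then show ?thesis unfolding Sigma_fm.simps by blast
  qed
qed

lemma Pi_Suc_iff: "\<phi> \<in> Pi_fm (Suc n) \<longleftrightarrow> \<phi> \<in> Sigma_fm n \<or> (\<exists>\<psi>. \<phi> = Forall \<psi> \<and> \<psi> \<in> Pi_fm (Suc n))"
proof
  assume "\<phi> \<in> Pi_fm (Suc n)"
  then obtain k \<psi> where "\<phi> = (Forall ^^ k) \<psi>" "\<psi> \<in> Sigma_fm n" by auto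
  then show "\<phi> \<in> Sigma_fm n \<or> (\<exists>\<psi>. \<phi> = Forall \<psi> \<and> \<psi> \<in> Pi_fm (Suc n))" by (cases k) auto
next
  assume "\<phi> \<in> Sigma_fm n \<or> (\<exists>\<psi>. \<phi> = Forall \<psi> \<and> \<psi> \<in> Pi_fm (Suc n))"
  then show "\<phi> \<in> Pi_fm (Suc n)"
  proof
    assume "\<phi> \<in> Sigma_fm n"
    then show ?thesis by (auto intro: exI[of _ 0])
  next
    assume "\<exists>\<psi>. \<phi> = Forall \<psi> \<and> \<psi> \<in> Pi_fm (Suc n)"
    then obtain k \<psi> where "\<phi> = (Forall ^^ Suc k) \<psi>" "\<psi> \<in> Sigma_fm n" by auto
    then show ?thesis unfolding Pi_fm.simps by blast
  qed
qed

text \<open>The hierarchy is invariant under any map that acts on atoms, may depend on the binding depth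
  and respects the guards of bounded quantifiers; substitution, opening and closing are such maps.\<close>

lemma hierarchy_map:
  fixes f :: "nat \<Rightarrow> fm \<Rightarrow> fm"
  assumes f: "\<And>k a. f k (Pos a) = Pos (g k a)" "\<And>k a. f k (Neg a) = Neg (g k a)"
      "\<And>k \<phi> \<psi>. f k (Conj \<phi> \<psi>) = Conj (f k \<phi>) (f k \<psi>)" "\<And>k \<phi> \<psi>. f k (Disj \<phi> \<psi>) = Disj (f k \<phi>) (f k \<psi>)"
      "\<And>k \<phi>. f k (Forall \<phi>) = Forall (f (Suc k) \<phi>)" "\<And>k \<phi>. f k (Exists \<phi>) = Exists (f (Suc k) \<phi>)"
    and g: "\<And>k a. guard (g (Suc k) a) \<longleftrightarrow> guard a"
  shows "f k \<phi> \<in> Sigma_fm n \<longleftrightarrow> \<phi> \<in> Sigma_fm n" "f k \<phi> \<in> Pi_fm n \<longleftrightarrow> \<phi> \<in> Pi_fm n"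
proof -
  have inv: "f k \<phi> = Pos a \<longleftrightarrow> (\<exists>b. \<phi> = Pos b \<and> a = g k b)" "f k \<phi> = Neg a \<longleftrightarrow> (\<exists>b. \<phi> = Neg b \<and> a = g k b)"
    "f k \<phi> = Conj \<psi> \<chi> \<longleftrightarrow> (\<exists>\<psi>' \<chi>'. \<phi> = Conj \<psi>' \<chi>' \<and> \<psi> = f k \<psi>' \<and> \<chi> = f k \<chi>')"
    "f k \<phi> = Disj \<psi> \<chi> \<longleftrightarrow> (\<exists>\<psi>' \<chi>'. \<phi> = Disj \<psi>' \<chi>' \<and> \<psi> = f k \<psi>' \<and> \<chi> = f k \<chi>')"
    "f k \<phi> = Forall \<psi> \<longleftrightarrow> (\<exists>\<psi>'. \<phi> = Forall \<psi>' \<and> \<psi> = f (Suc k) \<psi>')"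
    "f k \<phi> = Exists \<psi> \<longleftrightarrow> (\<exists>\<psi>'. \<phi> = Exists \<psi>' \<and> \<psi> = f (Suc k) \<psi>')" for k \<phi> \<psi> \<chi> a
    by (cases \<phi>; auto simp: f)+
  have sh: "(\<exists>a \<psi>. f (Suc k) \<phi> = Disj (Neg a) \<psi> \<and> guard a) \<longleftrightarrow> (\<exists>a \<psi>. \<phi> = Disj (Neg a) \<psi> \<and> guard a)"
    "(\<exists>a \<psi>. f (Suc k) \<phi> = Conj (Pos a) \<psi> \<and> guard a) \<longleftrightarrow> (\<exists>a \<psi>. \<phi> = Conj (Pos a) \<psi> \<and> guard a)" for k \<phi>
    using g by (auto simp: inv f eq_commute[of "Neg _"] eq_commute[of "Pos _"])
  have D: "f k \<phi> \<in> Delta0 \<longleftrightarrow> \<phi> \<in> Delta0" for k \<phi>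
  proof (induction \<phi> arbitrary: k)
    case (Forall \<phi>)
    show ?case unfolding f Delta0_iff Forall sh ..
  next
    case (Exists \<phi>)
    show ?case unfolding f Delta0_iff Exists sh ..
  qed (auto simp: f Delta0_iff)
  have "(\<forall>k \<phi>. f k \<phi> \<in> Sigma_fm n \<longleftrightarrow> \<phi> \<in> Sigma_fm n) \<and> (\<forall>k \<phi>. f k \<phi> \<in> Pi_fm n \<longleftrightarrow> \<phi> \<in> Pi_fm n)"
  proof (induction n)
    case 0
    then show ?case using D by simp
  next
    case (Suc n)
    have nE: "f k \<phi> \<in> Sigma_fm (Suc n) \<longleftrightarrow> \<phi> \<in> Sigma_fm (Suc n)" if "\<nexists>\<psi>. \<phi> = Exists \<psi>" for k \<phi>
      using Sigma_Suc_iff[of "f k \<phi>" n] Sigma_Suc_iff[of \<phi> n] that Suc inv(6)[of k \<phi>] by metis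
    have nA: "f k \<phi> \<in> Pi_fm (Suc n) \<longleftrightarrow> \<phi> \<in> Pi_fm (Suc n)" if "\<nexists>\<psi>. \<phi> = Forall \<psi>" for k \<phi>
      using Pi_Suc_iff[of "f k \<phi>" n] Pi_Suc_iff[of \<phi> n] that Suc inv(5)[of k \<phi>] by metis
    have "f k \<phi> \<in> Sigma_fm (Suc n) \<longleftrightarrow> \<phi> \<in> Sigma_fm (Suc n)" for k \<phi>
    proof (induction \<phi> arbitrary: k)
      case (Exists \<phi>)
      have "f k (Exists \<phi>) \<in> Pi_fm n \<longleftrightarrow> Exists \<phi> \<in> Pi_fm n" using Suc by blast
      then show ?case
        using Exists[of "Suc k"] Sigma_Suc_iff[of "f k (Exists \<phi>)" n] Sigma_Suc_iff[of "Exists \<phi>" n] f(6) by simp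
    qed (rule nE, simp)+
    moreover have "f k \<phi> \<in> Pi_fm (Suc n) \<longleftrightarrow> \<phi> \<in> Pi_fm (Suc n)" for k \<phi>
    proof (induction \<phi> arbitrary: k)
      case (Forall \<phi>)
      have "f k (Forall \<phi>) \<in> Sigma_fm n \<longleftrightarrow> Forall \<phi> \<in> Sigma_fm n" using Suc by blast
      then show ?case
        using Forall[of "Suc k"] Pi_Suc_iff[of "f k (Forall \<phi>)" n] Pi_Suc_iff[of "Forall \<phi>" n] f(5) by simp
    qed (rule nA, simp)+
    ultimately show ?case by blast
  qed
  then show "f k \<phi> \<in> Sigma_fm n \<longleftrightarrow> \<phi> \<in> Sigma_fm n" "f k \<phi> \<in> Pi_fm n \<longleftrightarrow> \<phi> \<in> Pi_fm n" by blast+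
qed

section \<open>Invariance of the hierarchy under substitution, opening, closing and negation\<close>

lemma bv_lc: "lc_tm 0 u \<Longrightarrow> bv_tm u = {}"
  by (induction u) auto

text \<open>Locally closed values contain no dangling index, so one in a substituted term stems from
  the original term. Guards and formulae of \<open>Q\<close> can thus be recognised through a
  substitution.\<close>

lemma sub_tm_eq_iff:
  assumes "lc_sub \<sigma>"
  shows "sub_tm \<sigma> t = BVar i \<longleftrightarrow> t = BVar i"
    "sub_tm \<sigma> t = Succ (BVar i) \<longleftrightarrow> t = Succ (BVar i)"
    "sub_tm \<sigma> t = Plus r (Succ (BVar i)) \<longleftrightarrow> (\<exists>r'. t = Plus r' (Succ (BVar i)) \<and> sub_tm \<sigma> r' = r)"
proof -
  have "lc_tm 0 (\<sigma> x)" for x using assms by (simp add: lc_sub_def)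
  then have no: "\<sigma> x \<noteq> BVar i" "\<sigma> x \<noteq> Succ (BVar i)" "\<sigma> x \<noteq> Plus r (Succ (BVar i))" for x i r
    by (metis lc_tm.simps not_less0)+
  show 1: "sub_tm \<sigma> t = BVar i \<longleftrightarrow> t = BVar i" for t i
    using no by (cases t) auto
  show 2: "sub_tm \<sigma> t = Succ (BVar i) \<longleftrightarrow> t = Succ (BVar i)" for t i
    using no 1 by (cases t) auto
  show "sub_tm \<sigma> t = Plus r (Succ (BVar i)) \<longleftrightarrow> (\<exists>r'. t = Plus r' (Succ (BVar i)) \<and> sub_tm \<sigma> r' = r)"
    using no 2 by (cases t) auto
qed

lemma guard_sub: "lc_sub \<sigma> \<Longrightarrow> guard (sub_atom \<sigma> a) \<longleftrightarrow> guard a"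
proof -
  assume \<sigma>: "lc_sub \<sigma>"
  have "bv_tm (sub_tm \<sigma> t) = bv_tm t" for t
    using \<sigma> bv_lc by (induction t) (auto simp: lc_sub_def)
  then show ?thesis by (cases a) (auto simp: guard_def sub_tm_eq_iff[OF \<sigma>])
qed

lemma guard_open: "lc_tm 0 u \<Longrightarrow> guard (open_atom (Suc k) u a) \<longleftrightarrow> guard a"
proof -
  assume u: "lc_tm 0 u"
  have "0 \<in> bv_tm (open_tm (Suc k) u t) \<longleftrightarrow> 0 \<in> bv_tm t" for t
    using bv_lc[OF u] by (induction t) auto
  moreover have "open_tm (Suc k) u t = BVar 0 \<longleftrightarrow> t = BVar 0" for t
    using u by (cases t) auto
  ultimately show ?thesis by (cases a) (auto simp: guard_def)
qed

lemma guard_close: "guard (close_atom (Suc k) x a) \<longleftrightarrow> guard a"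
proof -
  have "0 \<in> bv_tm (close_tm (Suc k) x t) \<longleftrightarrow> 0 \<in> bv_tm t" for t
    by (induction t) auto
  moreover have "close_tm (Suc k) x t = BVar 0 \<longleftrightarrow> t = BVar 0" for t
    by (cases t) auto
  ultimately show ?thesis by (cases a) (auto simp: guard_def)
qed

lemma hierarchy_sub:
  assumes "lc_sub \<sigma>"
  shows "sub_fm \<sigma> \<phi> \<in> Sigma_fm n \<longleftrightarrow> \<phi> \<in> Sigma_fm n" "sub_fm \<sigma> \<phi> \<in> Pi_fm n \<longleftrightarrow> \<phi> \<in> Pi_fm n"
  using hierarchy_map[of "\<lambda>_. sub_fm \<sigma>" "\<lambda>_. sub_atom \<sigma>"] guard_sub[OF assms] by simp_all

lemma hierarchy_inst:
  assumes "lc_tm 0 u"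
  shows "inst \<phi> u \<in> Sigma_fm n \<longleftrightarrow> \<phi> \<in> Sigma_fm n" "inst \<phi> u \<in> Pi_fm n \<longleftrightarrow> \<phi> \<in> Pi_fm n"
  using hierarchy_map[of "\<lambda>k. open_fm k u" "\<lambda>k. open_atom k u"] guard_open[OF assms]
  by (simp_all add: inst_def)

lemma hierarchy_close:
  "close_fm 0 x \<phi> \<in> Sigma_fm n \<longleftrightarrow> \<phi> \<in> Sigma_fm n" "close_fm 0 x \<phi> \<in> Pi_fm n \<longleftrightarrow> \<phi> \<in> Pi_fm n"
  using hierarchy_map[of "\<lambda>k. close_fm k x" "\<lambda>k. close_atom k x"] guard_close by simp_all

lemma Delta0_neg: "\<phi> \<in> Delta0 \<Longrightarrow> neg \<phi> \<in> Delta0"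
  by (induction rule: Delta0.induct) (auto intro: Delta0.intros)

lemma hierarchy_neg:
  "(\<phi> \<in> Sigma_fm n \<longrightarrow> neg \<phi> \<in> Pi_fm n) \<and> (\<phi> \<in> Pi_fm n \<longrightarrow> neg \<phi> \<in> Sigma_fm n)"
proof (induction n arbitrary: \<phi>)
  case 0
  then show ?case using Delta0_neg by simp
next
  case (Suc n)
  have "neg ((Exists ^^ k) \<psi>) = (Forall ^^ k) (neg \<psi>)" "neg ((Forall ^^ k) \<psi>) = (Exists ^^ k) (neg \<psi>)" for k \<psi>
    by (induction k) auto
  then show ?case using Suc by fastforce
qed

lemma Pi_subset_Sigma: "Pi_fm n \<subseteq> Sigma_fm (Suc n)"
  using Sigma_Suc_iff by blast

lemma Sigma_subset_Pi: "Sigma_fm n \<subseteq> Pi_fm (Suc n)"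
  using Pi_Suc_iff by blast

text \<open>In a prenex formula a propositional connective can stand outermost only if the whole
  formula is a bounded matrix.\<close>

lemma hierarchy_Conj: "Conj \<phi> \<psi> \<in> Sigma_fm n \<union> Pi_fm n \<Longrightarrow> \<phi> \<in> Delta0 \<and> \<psi> \<in> Delta0"
proof (induction n)
  case (Suc n)
  then show ?case using Sigma_Suc_iff[of "Conj \<phi> \<psi>" n] Pi_Suc_iff[of "Conj \<phi> \<psi>" n] by blast
qed (simp add: Delta0_iff)

lemma hierarchy_Disj: "Disj \<phi> \<psi> \<in> Sigma_fm n \<union> Pi_fm n \<Longrightarrow> \<phi> \<in> Delta0 \<and> \<psi> \<in> Delta0"
proof (induction n)
  case (Suc n)
  then show ?case using Sigma_Suc_iff[of "Disj \<phi> \<psi>" n] Pi_Suc_iff[of "Disj \<phi> \<psi>" n] by blast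
qed (simp add: Delta0_iff)

lemma hierarchy_body:
  "(Forall \<phi> \<in> Sigma_fm n \<longrightarrow> \<phi> \<in> Sigma_fm n) \<and> (Exists \<phi> \<in> Sigma_fm n \<longrightarrow> \<phi> \<in> Sigma_fm n) \<and>
   (Forall \<phi> \<in> Pi_fm n \<longrightarrow> \<phi> \<in> Pi_fm n) \<and> (Exists \<phi> \<in> Pi_fm n \<longrightarrow> \<phi> \<in> Pi_fm n)"
proof (induction n)
  case 0
  show ?case by (simp add: Delta0_iff)
next
  case (Suc n)
  then show ?case
    using Sigma_Suc_iff[of "Forall \<phi>" n] Sigma_Suc_iff[of "Exists \<phi>" n] Pi_Suc_iff[of "Forall \<phi>" n]
      Pi_Suc_iff[of "Exists \<phi>" n] Pi_subset_Sigma[of n] Sigma_subset_Pi[of n] by blast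
qed

text \<open>The formulae of \<open>Q\<close> are added because \<open>class_succ\<close> and
  \<open>class_less\<close> ask for existential formulae that are not in
  \<open>Sigma_fm 0\<close>.\<close>

definition Sigma_class :: "nat \<Rightarrow> fm set" where
  "Sigma_class n = {\<phi> \<in> Sigma_fm n \<union> Q_formulas. lc_fm 0 \<phi>}"

lemma Q_formulas_cases:
  assumes "\<phi> \<in> Q_formulas"
  shows "\<phi> \<in> Delta0 \<or> (\<exists>t. lc_tm 0 t \<and> \<phi> = Exists (Pos (Eq t (Succ (BVar 0))))) \<or>
    (\<exists>t u. lc_tm 0 t \<and> lc_tm 0 u \<and> \<phi> = Exists (Pos (Eq (Plus t (Succ (BVar 0))) u)))"
  using assms Q_formulas_Sigma_0 by auto

lemma Q_formulas_intros:
  "lc_tm 0 t \<Longrightarrow> Exists (Pos (Eq t (Succ (BVar 0)))) \<in> Q_formulas"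
  "lc_tm 0 t \<Longrightarrow> lc_tm 0 u \<Longrightarrow> Exists (Pos (Eq (Plus t (Succ (BVar 0))) u)) \<in> Q_formulas"
  using Q_initial.intros(3,8) unfolding Q_formulas_def by fastforce+

lemma sub_fm_eq_Exists_Eq:
  "sub_fm \<sigma> \<phi> = Exists (Pos (Eq a b)) \<longleftrightarrow>
    (\<exists>t u. \<phi> = Exists (Pos (Eq t u)) \<and> sub_tm \<sigma> t = a \<and> sub_tm \<sigma> u = b)"
proof
  assume *: "sub_fm \<sigma> \<phi> = Exists (Pos (Eq a b))"
  then obtain \<psi> where \<psi>: "\<phi> = Exists \<psi>" "sub_fm \<sigma> \<psi> = Pos (Eq a b)" by (cases \<phi>) auto
  then obtain c where c: "\<psi> = Pos c" "sub_atom \<sigma> c = Eq a b" by (cases \<psi>) auto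
  then show "\<exists>t u. \<phi> = Exists (Pos (Eq t u)) \<and> sub_tm \<sigma> t = a \<and> sub_tm \<sigma> u = b"
    using \<psi> by (cases c) auto
qed auto

text \<open>Passing back from \<open>sub_fm \<sigma> \<phi>\<close> to \<open>\<phi>\<close> is the
  delicate direction: the shape of an existential formula of \<open>Q\<close> shows at its dangling
  index, which no substitution can create.\<close>

lemma Sigma_class_sub:
  assumes "lc_sub \<sigma>"
  shows "sub_fm \<sigma> \<phi> \<in> Sigma_class n \<longleftrightarrow> \<phi> \<in> Sigma_class n"
proof
  assume "\<phi> \<in> Sigma_class n"
  then have \<phi>: "\<phi> \<in> Sigma_fm n \<or> \<phi> \<in> Q_formulas" "lc_fm 0 \<phi>" by (auto simp: Sigma_class_def)
  from \<phi>(1) have "sub_fm \<sigma> \<phi> \<in> Sigma_fm n \<union> Q_formulas"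
  proof
    assume "\<phi> \<in> Q_formulas"
    from Q_formulas_cases[OF this] show ?thesis
    proof (elim disjE exE conjE)
      assume "\<phi> \<in> Delta0"
      then show ?thesis using hierarchy_sub(1)[OF assms, of \<phi> n] Delta0_subset[of n] by auto
    next
      fix t assume "lc_tm 0 t" "\<phi> = Exists (Pos (Eq t (Succ (BVar 0))))"
      then show ?thesis using assms by (simp add: lc_sub_tm Q_formulas_intros)
    next
      fix t u assume "lc_tm 0 t" "lc_tm 0 u" "\<phi> = Exists (Pos (Eq (Plus t (Succ (BVar 0))) u))"
      then show ?thesis using assms by (simp add: lc_sub_tm Q_formulas_intros)
    qed
  qed (use assms in \<open>simp add: hierarchy_sub\<close>)
  then show "sub_fm \<sigma> \<phi> \<in> Sigma_class n" using \<phi>(2) assms by (simp add: Sigma_class_def lc_sub_fm)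
next
  assume "sub_fm \<sigma> \<phi> \<in> Sigma_class n"
  then have \<phi>: "sub_fm \<sigma> \<phi> \<in> Sigma_fm n \<or> sub_fm \<sigma> \<phi> \<in> Q_formulas" "lc_fm 0 \<phi>"
    using assms by (auto simp: Sigma_class_def lc_sub_fm)
  from \<phi>(1) have "\<phi> \<in> Sigma_fm n \<union> Q_formulas"
  proof
    assume "sub_fm \<sigma> \<phi> \<in> Q_formulas"
    from Q_formulas_cases[OF this] show ?thesis
    proof (elim disjE exE conjE)
      assume "sub_fm \<sigma> \<phi> \<in> Delta0"
      then have "sub_fm \<sigma> \<phi> \<in> Sigma_fm 0" by simp
      then show ?thesis using hierarchy_sub(1)[OF assms, of \<phi> 0] Delta0_subset[of n] by auto
    next
      fix t assume "lc_tm 0 t" "sub_fm \<sigma> \<phi> = Exists (Pos (Eq t (Succ (BVar 0))))"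
      then show ?thesis
        using assms by (auto simp: sub_fm_eq_Exists_Eq sub_tm_eq_iff lc_sub_tm intro: Q_formulas_intros)
    next
      fix t u assume "lc_tm 0 t" "lc_tm 0 u" "sub_fm \<sigma> \<phi> = Exists (Pos (Eq (Plus t (Succ (BVar 0))) u))"
      then show ?thesis
        using assms by (auto simp: sub_fm_eq_Exists_Eq sub_tm_eq_iff lc_sub_tm intro: Q_formulas_intros)
    qed
  qed (use assms in \<open>simp add: hierarchy_sub\<close>)
  then show "\<phi> \<in> Sigma_class n" using \<phi>(2) by (simp add: Sigma_class_def)
qed

lemma Sigma_class_formula_class: "formula_class (Sigma_class n)"
proof
  fix \<phi> \<psi> :: fm and a t u
  have at: "Pos a \<in> Sigma_fm n" "Neg a \<in> Sigma_fm n" for a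
    using Delta0_subset[of n] by (auto simp: Delta0_iff subset_iff)
  show "\<phi> \<in> Sigma_class n \<Longrightarrow> lc_fm 0 \<phi>" by (simp add: Sigma_class_def)
  show "lc_atom 0 a \<Longrightarrow> Pos a \<in> Sigma_class n" "lc_atom 0 a \<Longrightarrow> Neg a \<in> Sigma_class n"
    using at by (auto simp: Sigma_class_def)
  show "\<phi> \<in> Sigma_class n \<and> \<psi> \<in> Sigma_class n" if "Conj \<phi> \<psi> \<in> Sigma_class n"
    using that hierarchy_Conj[of \<phi> \<psi> n] Q_formulas_cases[of "Conj \<phi> \<psi>"] Delta0_subset[of n]
    by (auto simp: Sigma_class_def Delta0_iff)
  show "\<phi> \<in> Sigma_class n \<and> \<psi> \<in> Sigma_class n" if "Disj \<phi> \<psi> \<in> Sigma_class n"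
    using that hierarchy_Disj[of \<phi> \<psi> n] Q_formulas_cases[of "Disj \<phi> \<psi>"] Delta0_subset[of n]
    by (auto simp: Sigma_class_def Delta0_iff)
  show "inst \<phi> t \<in> Sigma_class n" if "Forall \<phi> \<in> Sigma_class n" "lc_tm 0 t"
  proof -
    have "Forall \<phi> \<in> Sigma_fm n"
      using that(1) Q_formulas_cases[of "Forall \<phi>"] Delta0_subset[of n] by (auto simp: Sigma_class_def)
    then show ?thesis
      using that hierarchy_body[of \<phi> n] by (simp add: Sigma_class_def hierarchy_inst lc_inst)
  qed
  show "inst \<phi> t \<in> Sigma_class n" if "Exists \<phi> \<in> Sigma_class n" "lc_tm 0 t"
  proof -
    have "\<phi> \<in> Sigma_fm n"
      using that(1) Q_formulas_cases[of "Exists \<phi>"] Delta0_subset[of n] hierarchy_body[of \<phi> n] at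
      by (auto simp: Sigma_class_def Delta0_iff)
    then show ?thesis
      using that by (simp add: Sigma_class_def hierarchy_inst lc_inst)
  qed
  show "lc_sub \<sigma> \<Longrightarrow> sub_fm \<sigma> \<phi> \<in> Sigma_class n \<longleftrightarrow> \<phi> \<in> Sigma_class n" for \<sigma>
    by (rule Sigma_class_sub)
  assume t: "lc_tm 0 t"
  then have lc: "lc_tm (Suc 0) t" by (rule lc_tm_mono) simp
  then show "Exists (Pos (Eq t (Succ (BVar 0)))) \<in> Sigma_class n"
    using Q_formulas_intros(1)[OF t] by (simp add: Sigma_class_def)
  assume u: "lc_tm 0 u"
  then have "lc_tm (Suc 0) u" by (rule lc_tm_mono) simp
  then show "Exists (Pos (Eq (Plus t (Succ (BVar 0))) u)) \<in> Sigma_class n"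
    using Q_formulas_intros(2)[OF t u] lc by (simp add: Sigma_class_def)
qed

lemma Pi_universal: "\<phi> \<in> Pi_fm (Suc n) \<Longrightarrow> lc_fm 0 \<phi> \<Longrightarrow> formula_class.universal (Sigma_class n) \<phi>"
proof (induction "cpx \<phi>" arbitrary: \<phi> rule: less_induct)
  case less
  interpret formula_class "Sigma_class n" by (rule Sigma_class_formula_class)
  from less.prems(1) show ?case
    unfolding Pi_Suc_iff[of \<phi> n]
  proof (elim disjE exE conjE)
    assume "\<phi> \<in> Sigma_fm n"
    then show ?thesis using less.prems by (intro universal_class) (simp add: Sigma_class_def)
  next
    fix \<psi> assume "\<phi> = Forall \<psi>" "\<psi> \<in> Pi_fm (Suc n)"
    then show ?thesis
      using less.hyps less.prems(2)
      by (auto simp: lc_inst hierarchy_inst simp del: Pi_fm.simps intro!: universal_Forall)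
  qed
qed

section \<open>Prenex disjunctions\<close>

text \<open>A prenex form of the disjunction of \<open>\<chi>\<close> and \<open>\<phi>\<close>.
  With \<open>\<chi>\<close> locally closed no index needs shifting. It is a relation because a
  bounded quantifier also begins with \<open>Forall\<close> or \<open>Exists\<close>, so the formula
  alone does not tell where the prefix ends.\<close>

inductive push :: "fm \<Rightarrow> fm \<Rightarrow> fm \<Rightarrow> bool" for \<chi> where
  push_here: "push \<chi> \<phi> (Disj \<chi> \<phi>)"
| push_Forall: "push \<chi> \<phi> \<phi>' \<Longrightarrow> push \<chi> (Forall \<phi>) (Forall \<phi>')"
| push_Exists: "push \<chi> \<phi> \<phi>' \<Longrightarrow> push \<chi> (Exists \<phi>) (Exists \<phi>')"

lemma push_lc: "push \<chi> \<phi> \<phi>' \<Longrightarrow> lc_fm 0 \<chi> \<Longrightarrow> lc_fm k \<phi>' \<longleftrightarrow> lc_fm k \<phi>"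
  by (induction arbitrary: k rule: push.induct) (auto intro: lc_fm_mono)

lemma push_sub: "push \<chi> \<phi> \<phi>' \<Longrightarrow> push (sub_fm \<sigma> \<chi>) (sub_fm \<sigma> \<phi>) (sub_fm \<sigma> \<phi>')"
  by (induction rule: push.induct) (auto intro: push.intros)

lemma push_open: "push \<chi> \<phi> \<phi>' \<Longrightarrow> lc_fm 0 \<chi> \<Longrightarrow> push \<chi> (open_fm k u \<phi>) (open_fm k u \<phi>')"
  by (induction arbitrary: k rule: push.induct) (auto intro: push.intros simp: open_fm_lc[OF _ le0])

lemma Tr_push:
  assumes "lc_fm 0 \<chi>"
  shows "push \<chi> \<phi> \<phi>' \<Longrightarrow> Tr \<alpha> \<phi>' \<longleftrightarrow> Tr \<alpha> \<chi> \<or> Tr \<alpha> \<phi>"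
proof (induction "cpx \<phi>" arbitrary: \<phi> \<phi>' rule: less_induct)
  case less
  have IH: "Tr \<alpha> (inst \<psi>' t) \<longleftrightarrow> Tr \<alpha> \<chi> \<or> Tr \<alpha> (inst \<psi> t)"
    if "push \<chi> \<psi> \<psi>'" "cpx \<psi> < cpx \<phi>" for \<psi> \<psi>' t
    using less.hyps[of "inst \<psi> t" "inst \<psi>' t"] push_open[OF that(1) assms, of 0 t] that(2)
    by (simp add: inst_def)
  \<comment> \<open>If \<open>\<chi>\<close> is true, an existential quantifier in front of it still
    needs a witness.\<close>
  have ex: "\<exists>t. lc_tm 0 t" by (rule exI[of _ Zero]) simp
  from less.prems show ?case
  proof cases
    case push_here
    then show ?thesis by simp
  next
    case (push_Forall \<psi> \<psi>')
    then show ?thesis using IH[of \<psi> \<psi>'] by auto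
  next
    case (push_Exists \<psi> \<psi>')
    then show ?thesis using IH[of \<psi> \<psi>'] ex by auto
  qed
qed

text \<open>The bounded \<open>\<chi>\<close> is moved right to the bounded matrix, which leaves the
  quantifier prefix as it was.\<close>

lemma push_exists:
  assumes "\<chi> \<in> Delta0"
  shows "(\<phi> \<in> Sigma_fm n \<longrightarrow> (\<exists>\<phi>'\<in>Sigma_fm n. push \<chi> \<phi> \<phi>')) \<and> (\<phi> \<in> Pi_fm n \<longrightarrow> (\<exists>\<phi>'\<in>Pi_fm n. push \<chi> \<phi> \<phi>'))"
proof (induction n arbitrary: \<phi>)
  case 0
  then show ?case using assms by (auto intro: push_here Delta0.intros)
next
  case (Suc n)
  have E: "push \<chi> ((Exists ^^ k) \<psi>) ((Exists ^^ k) \<psi>')" "push \<chi> ((Forall ^^ k) \<psi>) ((Forall ^^ k) \<psi>')"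
    if "push \<chi> \<psi> \<psi>'" for k \<psi> \<psi>'
    using that by (induction k) (auto intro: push.intros)
  show ?case
  proof (intro conjI impI)
    assume "\<phi> \<in> Sigma_fm (Suc n)"
    then obtain k \<psi> where \<psi>: "\<phi> = (Exists ^^ k) \<psi>" "\<psi> \<in> Pi_fm n" by auto
    then obtain \<psi>' where "\<psi>' \<in> Pi_fm n" "push \<chi> \<psi> \<psi>'" using Suc by blast
    then show "\<exists>\<phi>'\<in>Sigma_fm (Suc n). push \<chi> \<phi> \<phi>'" using E(1)[of \<psi> \<psi>' k] \<psi> by auto
  next
    assume "\<phi> \<in> Pi_fm (Suc n)"
    then obtain k \<psi> where \<psi>: "\<phi> = (Forall ^^ k) \<psi>" "\<psi> \<in> Sigma_fm n" by auto
    then obtain \<psi>' where "\<psi>' \<in> Sigma_fm n" "push \<chi> \<psi> \<psi>'" using Suc by blast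
    then show "\<exists>\<phi>'\<in>Pi_fm (Suc n). push \<chi> \<phi> \<phi>'" using E(2)[of \<psi> \<psi>' k] \<psi> by auto
  qed
qed

section \<open>From \<open>\<Pi>\<close>-induction to \<open>\<Sigma>\<close>-induction in a model\<close>

context arith_model
begin

text \<open>Addition recurses on its second argument, so this goes beyond \<open>Q\<close>;
  induction for an atomic formula provides it.\<close>

lemma zero_plus:
  assumes ind: "\<And>a. lc_atom 0 a \<Longrightarrow> models_induction \<alpha> (Pos a)" and t: "lc_tm 0 t"
  shows "\<alpha> (Eq (Plus Zero t) t)"
proof -
  have s: "subst1 0 u (Pos (Eq (Plus Zero (FVar 0)) (FVar 0))) = Pos (Eq (Plus Zero u) u)" for u
    by (simp add: subst1_def)
  have "\<alpha> (Eq (Plus Zero (Succ u)) (Succ u))" if u: "lc_tm 0 u" "\<alpha> (Eq (Plus Zero u) u)" for u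
    using eq_trans[OF _ _ _ plus_succ[of Zero u] eq_succ[OF _ _ u(2)]] u by simp
  moreover have "\<alpha> (Eq (Plus Zero Zero) Zero)" by (rule plus_zero) simp
  ultimately show ?thesis
    using ind[of "Eq (Plus Zero (FVar 0)) (FVar 0)"] t unfolding models_induction_def
    by (auto simp: s dest!: spec[of _ "0::nat"])
qed

text \<open>Moving a successor from one summand to the other is what lets \<open>w\<close> ascend
  while \<open>y\<close> descends in \<open>Sigma_induction\<close>.\<close>

lemma succ_plus:
  assumes ind: "\<And>a. lc_atom 0 a \<Longrightarrow> models_induction \<alpha> (Pos a)" and u: "lc_tm 0 u" and t: "lc_tm 0 t"
  shows "\<alpha> (Eq (Plus (Succ u) t) (Plus u (Succ t)))"
proof -
  obtain x where x: "x \<notin> fv_tm u" using fresh_var finite_fv_tm by blast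
  have "sub_tm (FVar(x := r)) u = u" for r using x by (intro sub_tm_id) auto
  then have s: "subst1 x r (Pos (Eq (Plus (Succ u) (FVar x)) (Plus u (Succ (FVar x))))) =
      Pos (Eq (Plus (Succ u) r) (Plus u (Succ r)))" for r
    by (simp add: subst1_def)
  have "\<alpha> (Eq (Plus u (Succ Zero)) (Succ u))"
    using eq_trans[OF _ _ _ plus_succ[of u Zero] eq_succ[OF _ _ plus_zero[of u]]] u by simp
  then have 0: "\<alpha> (Eq (Plus (Succ u) Zero) (Plus u (Succ Zero)))"
    using eq_trans[OF _ _ _ plus_zero[of "Succ u"] eq_sym] u by simp
  have S: "\<alpha> (Eq (Plus (Succ u) (Succ r)) (Plus u (Succ (Succ r))))"
    if r: "lc_tm 0 r" "\<alpha> (Eq (Plus (Succ u) r) (Plus u (Succ r)))" for r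
  proof -
    have "\<alpha> (Eq (Plus (Succ u) (Succ r)) (Succ (Plus u (Succ r))))"
      using eq_trans[OF _ _ _ plus_succ[of "Succ u" r] eq_succ[OF _ _ r(2)]] u r by simp
    then show ?thesis
      using eq_trans[OF _ _ _ _ eq_sym[OF _ _ plus_succ[of u "Succ r"]]] u r by simp
  qed
  have "models_induction \<alpha> (Pos (Eq (Plus (Succ u) (FVar x)) (Plus u (Succ (FVar x)))))"
    using u by (intro ind) simp
  then have "\<forall>t. lc_tm 0 t \<longrightarrow> Tr \<alpha> (subst1 x t (Pos (Eq (Plus (Succ u) (FVar x)) (Plus u (Succ (FVar x))))))"
    unfolding models_induction_def by (rule allE[of _ x]) (use 0 S in \<open>simp add: s\<close>)
  then show ?thesis using t by (simp add: s)
qed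

text \<open>For \<open>\<phi>\<close> in \<open>\<Sigma>\<close>, the descending induction for \<open>\<phi>\<close> from \<open>t\<close> is the ascending induction on \<open>w\<close> for the
  \<open>\<Pi>\<close> formula \<open>\<forall>y. w + y = t \<longrightarrow> \<not> \<phi>(y)\<close>.\<close>

lemma Sigma_induction:
  assumes ind: "\<And>A. A \<in> Pi_fm (Suc n) \<Longrightarrow> lc_fm 0 A \<Longrightarrow> models_induction \<alpha> A"
    and \<phi>: "\<phi> \<in> Sigma_fm (Suc n)" "lc_fm 0 \<phi>" and \<sigma>: "lc_sub \<sigma>"
    and base: "Tr \<alpha> (sub_fm (\<sigma>(x := Zero)) \<phi>)"
    and step: "\<And>t. lc_tm 0 t \<Longrightarrow> Tr \<alpha> (sub_fm (\<sigma>(x := t)) \<phi>) \<Longrightarrow> Tr \<alpha> (sub_fm (\<sigma>(x := Succ t)) \<phi>)"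
    and t: "lc_tm 0 t"
  shows "Tr \<alpha> (sub_fm (\<sigma>(x := t)) \<phi>)"
proof (rule ccontr)
  assume neg: "\<not> Tr \<alpha> (sub_fm (\<sigma>(x := t)) \<phi>)"
  define p where "p u \<longleftrightarrow> Tr \<alpha> (sub_fm (\<sigma>(x := u)) \<phi>)" for u
  have p_cong: "p u \<longleftrightarrow> p v" if "lc_tm 0 u" "lc_tm 0 v" "\<alpha> (Eq u v)" for u v
    unfolding p_def using Tr_sub_eq[OF that \<phi>(2) \<sigma>] .
  have atoms: "models_induction \<alpha> (Pos a)" if "lc_atom 0 a" for a
    using that Delta0_subset[of "Suc n"] Delta0.intros(1)[of a] by (intro ind) auto
  \<comment> \<open>The parameters of the induction formula and of \<open>t\<close>; they must stay
    put when \<open>w\<close> and \<open>y\<close> receive values.\<close>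
  define W where "W = (\<Union>z\<in>fv_fm \<phi>. fv_tm (\<sigma> z)) \<union> fv_tm t"
  have "finite W" by (simp add: W_def)
  then obtain w where w: "w \<notin> W" using fresh_var by blast
  have "finite (insert w W)" using \<open>finite W\<close> by simp
  then obtain y where y: "y \<notin> W" "y \<noteq> w" using fresh_var by blast
  define \<chi> where "\<chi> = Neg (Eq (Plus (FVar w) (FVar y)) t)"
  define \<nu> where "\<nu> = sub_fm (\<sigma>(x := FVar y)) (neg \<phi>)"
  have "neg \<phi> \<in> Pi_fm (Suc n)" using hierarchy_neg \<phi>(1) by blast
  then have "\<nu> \<in> Pi_fm (Suc n)" using \<sigma> by (simp add: \<nu>_def hierarchy_sub(2) lc_sub_upd del: Pi_fm.simps)
  moreover have "\<chi> \<in> Delta0" unfolding \<chi>_def by (rule Delta0.intros)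
  \<comment> \<open>The disjunction of \<open>\<chi>\<close> and \<open>\<nu>\<close> need not be
    prenex; \<open>\<nu>'\<close> is an equivalent formula that stays in the class.\<close>
  ultimately obtain \<nu>' where \<nu>': "\<nu>' \<in> Pi_fm (Suc n)" "push \<chi> \<nu> \<nu>'" using push_exists by blast
  have lc\<chi>: "lc_fm 0 \<chi>" using t by (simp add: \<chi>_def)
  have lc\<nu>': "lc_fm 0 \<nu>'"
    using \<phi>(2) \<sigma> push_lc[OF \<nu>'(2) lc\<chi>] by (simp add: \<nu>_def lc_sub_fm lc_sub_upd)
  define B where "B = allv y \<nu>'"
  have "B \<in> Pi_fm (Suc n)"
    unfolding B_def allv_def using \<nu>'(1) hierarchy_close(2) Pi_Suc_iff by blast
  then have indB: "models_induction \<alpha> B"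
    using lc\<nu>' by (intro ind) (auto simp: B_def lc_allv)
  have B: "Tr \<alpha> (subst1 w u B) \<longleftrightarrow> (\<forall>v. lc_tm 0 v \<longrightarrow> \<alpha> (Eq (Plus u v) t) \<longrightarrow> \<not> p v)" if u: "lc_tm 0 u" for u
  proof -
    have lcw: "lc_sub (FVar(w := u))" using u by (simp add: lc_sub_upd)
    have "Tr \<alpha> (sub_fm (FVar(w := u, y := v)) \<nu>') \<longleftrightarrow> \<not> \<alpha> (Eq (Plus u v) t) \<or> \<not> p v" if v: "lc_tm 0 v" for v
    proof -
      let ?\<tau> = "FVar(w := u, y := v)"
      have \<tau>: "lc_sub ?\<tau>" using u v by (simp add: lc_sub_upd)
      have id: "?\<tau> z = FVar z" if "z \<in> W" for z using that w y by auto
      have "sub_tm ?\<tau> t = t" using id by (intro sub_tm_id) (auto simp: W_def)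
      then have c: "sub_fm ?\<tau> \<chi> = Neg (Eq (Plus u v) t)" using y by (simp add: \<chi>_def)
      have "sub_fm ?\<tau> \<nu> = sub_fm (\<sigma>(x := v)) (neg \<phi>)"
        unfolding \<nu>_def sub_fm_comp
        by (intro sub_fm_cong) (auto simp: W_def intro!: sub_tm_id id)
      then have "Tr \<alpha> (sub_fm ?\<tau> \<nu>) \<longleftrightarrow> \<not> p v" by (simp add: neg_sub p_def)
      then show ?thesis
        using Tr_push[OF _ push_sub[OF \<nu>'(2)], of ?\<tau> \<alpha>] u v t unfolding c by simp
    qed
    then show ?thesis
      unfolding B_def subst1_def using Tr_allv[OF lcw lc\<nu>'] by auto
  qed
  \<comment> \<open>At \<open>w = 0\<close> the condition on \<open>y\<close> says
    \<open>y = t\<close>, the assumed point of failure.\<close>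
  have "\<not> p v" if v: "lc_tm 0 v" "\<alpha> (Eq (Plus Zero v) t)" for v
  proof -
    have "\<alpha> (Eq v (Plus Zero v))" using eq_sym[OF _ _ zero_plus[OF atoms v(1)]] v by simp
    then have "\<alpha> (Eq v t)" using eq_trans[OF _ _ _ _ v(2)] v t by simp
    then show ?thesis using p_cong v t neg by (auto simp: p_def)
  qed
  then have "Tr \<alpha> (subst1 w Zero B)" using B by simp
  moreover have "Tr \<alpha> (subst1 w (Succ u) B)" if u: "lc_tm 0 u" "Tr \<alpha> (subst1 w u B)" for u
  proof -
    have "\<not> p v" if v: "lc_tm 0 v" "\<alpha> (Eq (Plus (Succ u) v) t)" for v
    proof -
      have "\<alpha> (Eq (Plus u (Succ v)) (Plus (Succ u) v))"
        using eq_sym[OF _ _ succ_plus[OF atoms u(1) v(1)]] u v by simp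
      then have "\<alpha> (Eq (Plus u (Succ v)) t)" using eq_trans[OF _ _ _ _ v(2)] u v t by simp
      then have "\<not> p (Succ v)" using u(2) B[OF u(1)] v by simp
      then show ?thesis using step[OF v(1)] by (auto simp: p_def)
    qed
    then show ?thesis using B[of "Succ u"] u by simp
  qed
  ultimately have "Tr \<alpha> (subst1 w t B)" using indB t unfolding models_induction_def by blast
  \<comment> \<open>At \<open>w = t\<close> the value \<open>y = 0\<close> satisfies the condition,
    so the failure has travelled from \<open>t\<close> down to zero.\<close>
  then have "\<not> p Zero" using B[OF t] plus_zero[OF t] by simp
  then show False using base by (simp add: p_def)
qed

lemma ISigma_true:
  assumes ind: "\<And>A. A \<in> Pi_fm (Suc n) \<Longrightarrow> lc_fm 0 A \<Longrightarrow> models_induction \<alpha> A"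
    and "\<psi> \<in> ISigma (Suc n)" "lc_sub \<sigma>"
  shows "Tr \<alpha> (sub_fm \<sigma> \<psi>)"
proof -
  from assms(2) consider A where "A \<in> Q_axioms" "\<psi> = univ_closure A"
    | x \<phi> where "\<phi> \<in> Sigma_fm (Suc n)" "lc_fm 0 \<phi>" "\<psi> = univ_closure (induction_fm x \<phi>)"
    unfolding ISigma_def by blast
  then show ?thesis
  proof cases
    case 1
    then show ?thesis using assms(3) Q_axioms_true Q_axioms_lc by (auto intro: Tr_univ_closure)
  next
    case 2
    have lcs: "lc_fm 0 (subst1 x u \<phi>)" if "lc_tm 0 u" for u
      using 2(2) that by (simp add: subst1_def lc_sub_fm lc_sub_upd)
    have lc: "lc_fm 0 (induction_fm x \<phi>)"
      using 2(2) lcs by (simp add: induction_fm_def lc_allv)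
    have "Tr \<alpha> (sub_fm \<sigma> (induction_fm x \<phi>))" if \<sigma>: "lc_sub \<sigma>" for \<sigma>
    proof -
      have step: "Tr \<alpha> (sub_fm \<sigma> (allv x (imp \<phi> (subst1 x (Succ (FVar x)) \<phi>)))) \<longleftrightarrow>
          (\<forall>u. lc_tm 0 u \<longrightarrow> Tr \<alpha> (sub_fm (\<sigma>(x := u)) \<phi>) \<longrightarrow> Tr \<alpha> (sub_fm (\<sigma>(x := Succ u)) \<phi>))"
        using Tr_allv[OF \<sigma>, of "imp \<phi> (subst1 x (Succ (FVar x)) \<phi>)"] 2(2) lcs by (simp add: sub_subst1)
      show ?thesis
        unfolding induction_fm_def sub_imp Tr_imp sub_fm.simps Tr.simps step Tr_allv[OF \<sigma> 2(2)]
        using Sigma_induction[OF ind 2(1,2) \<sigma>] by (simp add: sub_subst1)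
    qed
    then show ?thesis unfolding 2(3) using lc assms(3) by (intro Tr_univ_closure)
  qed
qed

end

section \<open>Back to the cyclic theory\<close>

lemma derivable_wf: "derivable T s \<Longrightarrow> wf_sequent s"
  by (induction rule: derivable.induct) (auto simp: wf_sequent_def sentence_def)

lemma derivable_leaf: "step r [] s \<Longrightarrow> wf_sequent s \<Longrightarrow> derivable T s"
  by (rule derivable.intros(2)) auto

lemma derivable_step1: "step r [p] s \<Longrightarrow> derivable T p \<Longrightarrow> wf_sequent s \<Longrightarrow> derivable T s"
  by (rule derivable.intros(2)) auto

lemma derivable_step2:
  "step r [p, q] s \<Longrightarrow> derivable T p \<Longrightarrow> derivable T q \<Longrightarrow> wf_sequent s \<Longrightarrow> derivable T s"
  by (rule derivable.intros(2)) auto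

lemma derivable_elim:
  assumes "derivable T ({}, {\<phi>})" "derivable T ({\<phi>}, {\<psi>})"
  shows "derivable T ({}, {\<psi>})"
proof -
  have lc: "lc_fm 0 \<phi>" "lc_fm 0 \<psi>"
    using derivable_wf[OF assms(2)] by (auto simp: wf_sequent_def)
  have "derivable T ({}, insert \<phi> {\<psi>})"
    by (rule derivable_step1[OF step.intros(6) assms(1)]) (use lc in \<open>auto simp: wf_sequent_def\<close>)
  from derivable_step2[OF step.intros(7) this assms(2)] lc show ?thesis by (simp add: wf_sequent_def)
qed

lemma derivable_ident: "lc_fm 0 \<phi> \<Longrightarrow> \<phi> \<in> \<Gamma> \<Longrightarrow> \<phi> \<in> \<Delta> \<Longrightarrow> wf_sequent (\<Gamma>, \<Delta>) \<Longrightarrow> derivable T (\<Gamma>, \<Delta>)"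
  by (rule derivable_step1[OF step.intros(6)[of "{\<phi>}" \<Gamma> "{\<phi>}" \<Delta>]])
    (auto intro!: derivable_leaf[OF step.intros(1)] simp: wf_sequent_def)

lemma derivable_allv:
  assumes "derivable T ({}, {allv x \<phi>})" "lc_fm 0 \<phi>"
  shows "derivable T ({}, {\<phi>})"
proof (rule derivable_elim[OF assms(1)])
  have "FVar(x := FVar x) = FVar" by auto
  then have "inst (close_fm 0 x \<phi>) (FVar x) = \<phi>" using assms(2) by (simp add: inst_close)
  then have "step ForallL [({\<phi>}, {\<phi>})] ({allv x \<phi>}, {\<phi>})"
    using step.intros(12)[of "FVar x" "close_fm 0 x \<phi>" "{}" "{\<phi>}"] by (simp add: allv_def)
  then show "derivable T ({allv x \<phi>}, {\<phi>})"
    by (rule derivable_step1)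
      (use assms(2) in \<open>auto intro!: derivable_ident[OF assms(2)] simp: wf_sequent_def lc_allv\<close>)
qed

lemma derivable_univ_closure:
  assumes "derivable T ({}, {univ_closure \<phi>})" "lc_fm 0 \<phi>"
  shows "derivable T ({}, {\<phi>})"
proof -
  have "derivable T ({}, {foldr allv xs \<phi>}) \<Longrightarrow> derivable T ({}, {\<phi>})" for xs
    by (induction xs) (auto dest: derivable_allv simp: lc_foldr_allv assms(2))
  then show ?thesis using assms(1) by (simp add: univ_closure_def)
qed

text \<open>The axiom contributed by a cyclic proof of a single formula carries the neutral elements
  of the empty conjunction and of the one-element disjunction; they are stripped here.\<close>

lemma derivable_Tru_imp:
  assumes "derivable T ({}, {imp Tru (Disj \<psi> Fls)})" "lc_fm 0 \<psi>"
  shows "derivable T ({}, {\<psi>})"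
proof (rule derivable_elim[OF assms(1)])
  let ?e = "Eq Zero Zero"
  have wf: "wf_sequent (\<Gamma>, {\<psi>})" if "\<Gamma> \<subseteq> {Pos ?e, Neg ?e, \<psi>, Disj \<psi> Fls, imp Tru (Disj \<psi> Fls)}" for \<Gamma>
    using that assms(2) finite_subset[OF that] by (auto simp: wf_sequent_def imp_def Tru_def Fls_def)
  have "derivable T ({Pos ?e, Neg ?e}, {\<psi>})"
    by (rule derivable_step1[OF step.intros(6)[of "{Pos ?e, Neg ?e}" _ "{}"]])
      (use assms(2) in \<open>auto intro!: derivable_leaf[OF step.intros(4)] simp: wf_sequent_def\<close>)
  moreover have "derivable T ({Neg ?e}, {Pos ?e, \<psi>})"
    by (rule derivable_step1[OF step.intros(6)[of "{}" _ "{Pos ?e}"]])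
      (use assms(2) in \<open>auto intro!: derivable_leaf[OF step.intros(2)] simp: wf_sequent_def\<close>)
  ultimately have N: "derivable T ({Neg ?e}, {\<psi>})"
    using derivable_step2[OF step.intros(7)[of "{Neg ?e}" "Pos ?e" "{\<psi>}"]] wf[of "{Neg ?e}"] by simp
  have I: "derivable T ({\<psi>}, {\<psi>})"
    by (rule derivable_ident[OF assms(2)]) (auto intro!: wf)
  have "derivable T ({Disj \<psi> Fls}, {\<psi>})"
    using derivable_step2[OF step.intros(10)[of \<psi> "{}" "{\<psi>}" "Neg ?e"] I N] wf[of "{Disj \<psi> Fls}"]
    by (simp add: Fls_def)
  then show "derivable T ({imp Tru (Disj \<psi> Fls)}, {\<psi>})"
    using derivable_step2[OF step.intros(10)[of "Neg ?e" "{}" "{\<psi>}" "Disj \<psi> Fls"] N]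
      wf[of "{imp Tru (Disj \<psi> Fls)}"] by (simp add: imp_def Tru_def)
qed

lemma C_theory_derivable:
  assumes "cyclic_proof \<pi>" "contains_only (\<Phi> \<union> Q_formulas) \<pi>" "concl \<pi> = ({}, {\<psi>})" "lc_fm 0 \<psi>"
  shows "derivable (C_theory \<Phi>) ({}, {\<psi>})"
proof -
  let ?A = "imp (foldr Conj [] Tru) (foldr Disj [\<psi>] Fls)"
  have "concl \<pi> = (set [], set [\<psi>])" using assms(3) by simp
  then have "univ_closure ?A \<in> C_theory \<Phi>" using assms(1,2) unfolding C_theory_def by blast
  moreover have lc: "lc_fm 0 ?A" using assms(4) by (simp add: Tru_def Fls_def)
  ultimately have "derivable (C_theory \<Phi>) ({}, {univ_closure ?A})"
    by (intro derivable.intros(1) sentence_univ_closure)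
  from derivable_univ_closure[OF this lc] show ?thesis
    using derivable_Tru_imp assms(4) by simp
qed

section \<open>Reassembling a universal formula from its instances\<close>

context formula_class
begin

text \<open>Quantifiers outside the class are put back by finite inferences in the theory, from
  instances at fresh variables, so no cyclic proof has to contain the universal formula.\<close>

lemma derivable_instances:
  assumes "universal P" "\<And>\<psi>. instance_of P \<psi> \<Longrightarrow> derivable T ({}, {\<psi>})"
  shows "derivable T ({}, {P})"
  using assms
proof (induction rule: universal.induct)
  case (universal_class \<phi>)
  then show ?case using instance_of_class by blast
next
  case (universal_Forall \<phi>)
  show ?case
  proof (cases "Forall \<phi> \<in> \<Phi>")
    case True
    then show ?thesis using universal_Forall.prems instance_of_class by blast
  next
    case False
    obtain a where a: "a \<notin> fv_fm \<phi>" using fresh_var finite_fv_fm by blast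
    have "derivable T ({}, {inst \<phi> (FVar a)})"
      by (rule universal_Forall.IH) (auto intro!: universal_Forall.prems instance_of_Forall[OF False, of "FVar a"])
    moreover have "lc_fm 0 (Forall \<phi>)"
      using derivable_wf[OF calculation] by (simp add: wf_sequent_def lc_inst)
    moreover have "a \<notin> fv_sequent ({}, insert (Forall \<phi>) {})" using a by (simp add: fv_sequent_def)
    ultimately show ?thesis
      using derivable_step1[OF step.intros(13)] by (simp add: wf_sequent_def)
  qed
qed

text \<open>The given instance is the chosen one on the right. With no loop open at the root, every
  back edge has its companion inside the derivation, which can then be unfolded.\<close>

lemma entails_cyclic_proof:
  assumes "entails {} {\<phi>}" "instance_of \<phi> \<psi>"
  shows "\<exists>\<pi>. cyclic_proof \<pi> \<and> contains_only \<Phi> \<pi> \<and> concl \<pi> = ({}, {\<psi>})"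
proof -
  have "derives [] {} {\<psi>}"
    by (rule entailsD[OF assms(1), where \<theta> = FVar])
      (use assms(2) instance_of_in_class in \<open>auto simp: wf_ctx_def tracks_def hits_def\<close>)
  then obtain d where "ok_der \<Phi> [] d" "dseq d = ({}, {\<psi>})" by (auto simp: derives_def)
  then show ?thesis using cyclic_proof_unfold[of \<Phi> d] by simp
qed

end

theorem theorem4p1:
  fixes n :: nat and \<phi> :: fm
  assumes "sentence \<phi>"
    and "\<phi> \<in> Pi_fm (Suc n)"
    and "provable (ISigma (Suc n)) \<phi>"
  shows "provable (C_theory (Sigma_fm n)) \<phi>"
proof -
  interpret formula_class "Sigma_class n" by (rule Sigma_class_formula_class)
  have universal\<phi>: "universal \<phi>" using assms(1,2) by (intro Pi_universal) (simp_all add: sentence_def del: Pi_fm.simps)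
  have entails: "entails {} {\<phi>}"
  proof (rule ccontr)
    assume "\<not> entails {} {\<phi>}"
    then obtain \<alpha> where \<alpha>: "arith_model \<alpha>" "\<And>A. universal A \<Longrightarrow> models_induction \<alpha> A" "\<not> Tr \<alpha> \<phi>"
      using countermodel universal\<phi> by blast
    interpret arith_model \<alpha> by (rule \<alpha>(1))
    have "Tr \<alpha> (sub_fm \<sigma> \<psi>)" if "\<psi> \<in> ISigma (Suc n)" "lc_sub \<sigma>" for \<psi> \<sigma>
      using ISigma_true[OF _ that] \<alpha>(2) Pi_universal by blast
    then have "valid ({}, {\<phi>})"
      using assms(3) derivable_sound unfolding provable_def by blast
    then have "Tr \<alpha> (sub_fm FVar \<phi>)" unfolding valid_def using lc_sub_FVar by fastforce
    then show False using \<alpha>(3) by simp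
  qed
  have "derivable (C_theory (Sigma_fm n)) ({}, {\<psi>})" if ins: "instance_of \<phi> \<psi>" for \<psi>
  proof -
    obtain \<pi> where "cyclic_proof \<pi>" "contains_only (Sigma_class n) \<pi>" "concl \<pi> = ({}, {\<psi>})"
      using entails_cyclic_proof[OF entails ins] by blast
    moreover have "Sigma_class n \<subseteq> Sigma_fm n \<union> Q_formulas" by (auto simp: Sigma_class_def)
    ultimately show ?thesis
      using class_lc[OF instance_of_in_class[OF ins]]
      by (intro C_theory_derivable[of \<pi>]) (auto simp: contains_only_def)
  qed
  then show ?thesis unfolding provable_def by (rule derivable_instances[OF universal\<phi>])
qed

end
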